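(* Let $d\in\{2,3\}$, let $\Omega\subset\mathbb{R}^d$ be a non-empty, open, bounded, simply connected Lipschitz domain, and let $\Gamma\subset\Omega$ be a non-degenerate closed polygonal contour ($d=2$) or closed polyhedral surface ($d=3$). Suppose that the error of the numerical quadrature method used over $\Gamma$ is bounded from above by $Ch^r$ for a $C>0$ and an $r>0$. Let $\boldsymbol u$ be the solution of $$-\nabla\cdot\boldsymbol\sigma(\boldsymbol u)=\int_\Gamma Q(\boldsymbol x')\boldsymbol n(\boldsymbol x')\delta_0(\boldsymbol x-\boldsymbol x')\,d\Gamma(\boldsymbol x')\ \text{ in }\Omega,\qquad \boldsymbol u=\boldsymbol 0\ \text{ on }\partial\Omega,$$ and let $\boldsymbol u_h$ be the solution of $$-\nabla\cdot\boldsymbol\sigma(\boldsymbol u_h)=\sum_{j=1}^m w_jQ(\boldsymbol x_j)\boldsymbol n(\boldsymbol x_j)\delta_0(\boldsymbol x-\boldsymbol x_j)\ \text{ in }\Omega,\qquad \boldsymbol u_h=\boldsymbol 0\ \text{ on }\partial\Omega,$$ where $\delta_0$ is the Dirac delta distribution. For $\delta>0$ let $\Omega_\delta=\{\boldsymbol x\in\Omega:\operatorname{dist}(\boldsymbol x,\Gamma)>\delta\}$ (that is, away from $\Gamma$). Then there is a $C_0>0$, independent of $h$, such that $$\|\boldsymbol u_h-\boldsymbol u\|_{\mathbf L^2(\Omega_\delta)}\le C_0h^r .$$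
   Context: Elasticity. $E$ is Young's modulus, $\nu$ is Poisson's ratio, $\mu=\frac{E}{2(1+\nu)}$, and $$\boldsymbol\sigma(\boldsymbol u)=\frac{E}{1+\nu}\Big\{\boldsymbol\epsilon(\boldsymbol u)+\frac{\nu}{1-2\nu}\operatorname{tr}(\boldsymbol\epsilon(\boldsymbol u))\mathbf I\Big\},\qquad \boldsymbol\epsilon(\boldsymbol u)=\tfrac12[\nabla\boldsymbol u+\nabla\boldsymbol u^T].$$ Forces and quadrature. $Q$ is the force magnitude on $\Gamma$ and $\boldsymbol n$ is the unit normal vector on $\Gamma$ pointing towards the centre of the region enclosed by $\Gamma$. $\Gamma$ is divided into $m$ elements (line segments if $d=2$, surface elements if $d=3$), and $h$ is the maximal length or diameter of these elements. A quadrature rule on this subdivision, with nodes $\boldsymbol x_j\in\Gamma$ and weights $w_j$, $j=1,\dots,m$, approximates $\int_\Gamma f\,d\Gamma$ by $\sum_{j=1}^m w_jf(\boldsymbol x_j)$. The quadrature assumption is the generic convergence bound $\big|\int_\Gamma f\,d\Gamma-\sum_{j=1}^m w_jf(\boldsymbol x_j)\big|\le Ch^r$ for integrands $f$ with sufficient smoothness, $r$ being the order of convergence of the rule (for example $r=2$ for the composite midpoint rule). Field solutions. For $\boldsymbol x\ne\boldsymbol x'$ the Green's tensor of linear elasticity in $\mathbb{R}^d$ is $$\boldsymbol G(\boldsymbol x,\boldsymbol x')=\frac{1}{8\pi\mu(1-\nu)}\Big(-(3-4\nu)\log\|\boldsymbol x-\boldsymbol x'\|\,\boldsymbol I_2+\frac{(\boldsymbol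 x-\boldsymbol x')\otimes(\boldsymbol x-\boldsymbol x')}{\|\boldsymbol x-\boldsymbol x'\|^2}\Big)\quad(d=2),$$ $$\boldsymbol G(\boldsymbol x,\boldsymbol x')=\frac{1+\nu}{8\pi E(1-\nu)}\Big[\frac{(3-4\nu)\boldsymbol I_3}{\|\boldsymbol x-\boldsymbol x'\|}+\frac{(\boldsymbol x-\boldsymbol x')\otimes(\boldsymbol x-\boldsymbol x')}{\|\boldsymbol x-\boldsymbol x'\|^3}\Big]\quad(d=3).$$ Put $\boldsymbol u^*(\boldsymbol x)=\int_\Gamma Q(\boldsymbol x')\boldsymbol G(\boldsymbol x,\boldsymbol x')\boldsymbol n(\boldsymbol x')\,d\Gamma(\boldsymbol x')$ and $\boldsymbol u_h^*(\boldsymbol x)=\sum_{j=1}^m w_jQ(\boldsymbol x_j)\boldsymbol G(\boldsymbol x,\boldsymbol x_j)\boldsymbol n(\boldsymbol x_j)$; these solve the two equations with the given forces on all of $\mathbb{R}^d$. Solutions. The solutions of the boundary value problems are expressed as $\boldsymbol u=\boldsymbol u^*+\boldsymbol v$ and $\boldsymbol u_h=\boldsymbol u_h^*+\boldsymbol v_h$, where $\boldsymbol v,\boldsymbol v_h\in\mathbf H^1(\Omega)$ are the weak solutions of $-\nabla\cdot\boldsymbol\sigma(\boldsymbol v)=\boldsymbol 0$ in $\Omega$, $\boldsymbol v=-\boldsymbol u^*$ on $\partial\Omega$, and $-\nabla\cdot\boldsymbol\sigma(\boldsymbol v_h)=\boldsymbol 0$ in $\Omega$, $\boldsymbol v_h=-\boldsymbol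 u_h^*$ on $\partial\Omega$; that is, the boundary condition holds and $\int_\Omega\boldsymbol\sigma(\boldsymbol v):\boldsymbol\epsilon(\boldsymbol\phi)\,d\Omega=0$ for all $\boldsymbol\phi\in\mathbf H^1_0(\Omega)$ (same for $\boldsymbol v_h$). $\mathbf L^2,\mathbf H^1,\mathbf H^1_0$ are the usual spaces of $\mathbb{R}^d$-valued fields. *)

theory Defs
  imports "HOL-Analysis.Analysis"
begin

section \<open>Smooth functions\<close>

primrec Ck_on :: "nat \<Rightarrow> 'a::euclidean_space set \<Rightarrow> ('a \<Rightarrow> 'b::real_normed_vector) \<Rightarrow> bool" where
  "Ck_on 0 S f \<longleftrightarrow> continuous_on S f"
| "Ck_on (Suc k) S f \<longleftrightarrow> (\<forall>x\<in>S. f differentiable (at x)) \<and>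
     (\<forall>b\<in>Basis. Ck_on k S (\<lambda>x. frechet_derivative f (at x) b))"

definition test_functions :: "'a::euclidean_space set \<Rightarrow> ('a \<Rightarrow> 'b::real_normed_vector) set" where
  "test_functions \<Omega> = {\<phi>. (\<forall>k. Ck_on k UNIV \<phi>) \<and>
     compact (closure {x. \<phi> x \<noteq> 0}) \<and> closure {x. \<phi> x \<noteq> 0} \<subseteq> \<Omega>}"


section \<open>Sobolev spaces\<close>

definition L2_space :: "(real^'n) set \<Rightarrow> (real^'n \<Rightarrow> 'b::euclidean_space) set" where
  "L2_space \<Omega> = {f. f \<in> borel_measurable (lebesgue_on \<Omega>) \<and>
     integrable (lebesgue_on \<Omega>) (\<lambda>x. (norm (f x))\<^sup>2)}"

definition L2_norm :: "(real^'n) set \<Rightarrow> (real^'n \<Rightarrow> 'b::euclidean_space) \<Rightarrow> real" where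
  "L2_norm \<Omega> f = sqrt (\<integral>x. (norm (f x))\<^sup>2 \<partial>lebesgue_on \<Omega>)"

definition is_weak_gradient ::
  "(real^'n) set \<Rightarrow> (real^'n \<Rightarrow> real^'n) \<Rightarrow> (real^'n \<Rightarrow> real^'n^'n) \<Rightarrow> bool" where
  "is_weak_gradient \<Omega> v D \<longleftrightarrow>
     (\<forall>\<phi>\<in>test_functions \<Omega>. \<forall>i j.
        (\<integral>x. v x $ i * frechet_derivative \<phi> (at x) (axis j 1) \<partial>lebesgue_on \<Omega>) =
        - (\<integral>x. D x $ i $ j * \<phi> x \<partial>lebesgue_on \<Omega>))"

definition H1_space :: "(real^'n) set \<Rightarrow> (real^'n \<Rightarrow> real^'n) set" where
  "H1_space \<Omega> = {v \<in> L2_space \<Omega>. \<exists>D\<in>L2_space \<Omega>. is_weak_gradient \<Omega> v D}"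

text \<open>The weak gradient is determined up to a null set, and it is only used under integrals.\<close>

definition weak_gradient ::
  "(real^'n) set \<Rightarrow> (real^'n \<Rightarrow> real^'n) \<Rightarrow> real^'n \<Rightarrow> real^'n^'n" where
  "weak_gradient \<Omega> v = (SOME D. D \<in> L2_space \<Omega> \<and> is_weak_gradient \<Omega> v D)"

definition H1_norm :: "(real^'n) set \<Rightarrow> (real^'n \<Rightarrow> real^'n) \<Rightarrow> real" where
  "H1_norm \<Omega> v = sqrt ((L2_norm \<Omega> v)\<^sup>2 + (L2_norm \<Omega> (weak_gradient \<Omega> v))\<^sup>2)"

definition H1_0_space :: "(real^'n) set \<Rightarrow> (real^'n \<Rightarrow> real^'n) set" where
  "H1_0_space \<Omega> = {v \<in> H1_space \<Omega>. \<exists>\<phi>. (\<forall>k::nat. \<phi> k \<in> test_functions \<Omega>) \<and>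
     (\<lambda>k. H1_norm \<Omega> (\<lambda>x. \<phi> k x - v x)) \<longlonglongrightarrow> 0}"

text \<open>
  The condition \<open>v = g\<close> on the boundary, for \<open>v\<close> in \<open>H1\<close> and boundary data \<open>g\<close> that are the
  restriction of a function which is regular near the boundary but possibly singular inside
  \<open>\<Omega>\<close>: the difference of \<open>v\<close> and an \<open>H1\<close> extension of the data belongs to \<open>H1_0\<close>.
\<close>

definition has_boundary_values ::
  "(real^'n) set \<Rightarrow> (real^'n \<Rightarrow> real^'n) \<Rightarrow> (real^'n \<Rightarrow> real^'n) \<Rightarrow> bool" where
  "has_boundary_values \<Omega> v g \<longleftrightarrow>
     (\<exists>g'\<in>H1_space \<Omega>. (\<exists>U. open U \<and> frontier \<Omega> \<subseteq> U \<and> (\<forall>x\<in>U \<inter> \<Omega>. g' x = g x)) \<and>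
        (\<lambda>x. v x - g' x) \<in> H1_0_space \<Omega>)"


section \<open>Domains and polyhedral surfaces\<close>

text \<open>
  Near each boundary point, \<open>\<Omega>\<close> is the strict epigraph, in the direction of a unit vector \<open>e\<close>,
  of a Lipschitz function on the hyperplane orthogonal to \<open>e\<close>.
\<close>

definition lipschitz_boundary :: "(real^'n) set \<Rightarrow> bool" where
  "lipschitz_boundary \<Omega> \<longleftrightarrow>
     (\<forall>p\<in>frontier \<Omega>. \<exists>U e \<gamma> L. open U \<and> p \<in> U \<and> norm e = 1 \<and>
        L-lipschitz_on {y. e \<bullet> y = 0} \<gamma> \<and>
        (\<forall>x\<in>U. x \<in> \<Omega> \<longleftrightarrow> e \<bullet> x > (\<gamma> (x - (e \<bullet> x) *\<^sub>R e) :: real)))"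

text \<open>
  A face is flat and possibly non-convex; in the plane it is a segment.
\<close>

definition polyhedral_face :: "(real^'n) set \<Rightarrow> bool" where
  "polyhedral_face F \<longleftrightarrow>
     aff_dim F = int CARD('n) - 1 \<and> connected (rel_interior F) \<and>
     (\<exists>\<P>. finite \<P> \<and> F = \<Union>\<P> \<and> (\<forall>P\<in>\<P>. polytope P \<and> aff_dim P = int CARD('n) - 1))"

text \<open>
  The surface is the union of the given faces. It is closed, i.e. a compact connected
  topological manifold without boundary of codimension one; in the plane it is
  a simple closed polygon.
\<close>

definition closed_polyhedral_surface :: "(real^'n) set set \<Rightarrow> bool" where
  "closed_polyhedral_surface \<F> \<longleftrightarrow>
     finite \<F> \<and> \<F> \<noteq> {} \<and> (\<forall>F\<in>\<F>. polyhedral_face F) \<and>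
     (\<forall>F\<in>\<F>. \<forall>F'\<in>\<F>. F \<noteq> F' \<longrightarrow> rel_interior F \<inter> F' = {}) \<and>
     connected (\<Union>\<F>) \<and>
     (\<forall>x\<in>\<Union>\<F>. \<exists>V k. openin (top_of_set (\<Union>\<F>)) V \<and> x \<in> V \<and>
        V homeomorphic {y::real^'n. y $ k = 0})"

text \<open>
  The normal points into the region enclosed by the surface. It is not prescribed where faces meet.
\<close>

definition inward_unit_normal :: "(real^'n) set set \<Rightarrow> (real^'n \<Rightarrow> real^'n) \<Rightarrow> bool" where
  "inward_unit_normal \<F> n \<longleftrightarrow>
     (\<forall>F\<in>\<F>. \<forall>x\<in>rel_interior F. norm (n x) = 1 \<and> (\<forall>y\<in>F. n x \<bullet> (y - x) = 0) \<and>
        (\<exists>\<epsilon>>0. \<forall>t\<in>{0<..<\<epsilon>}. x + t *\<^sub>R n x \<in> inside (\<Union>\<F>) \<and> x - t *\<^sub>R n x \<in> outside (\<Union>\<F>)))"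

text \<open>
  The length or area measure of a face is the image, under the orthogonal projection to the
  hyperplane of the face, of Lebesgue measure on the right prism of height one over the face.
\<close>

definition face_normal :: "(real^'n) set \<Rightarrow> real^'n" where
  "face_normal F = (SOME e. norm e = 1 \<and> (\<forall>x\<in>F. \<forall>y\<in>F. e \<bullet> (x - y) = 0))"

definition unit_prism :: "(real^'n) set \<Rightarrow> (real^'n) set" where
  "unit_prism F = {x + t *\<^sub>R face_normal F | x t. x \<in> F \<and> t \<in> {0..1}}"

definition face_integral ::
  "(real^'n) set \<Rightarrow> (real^'n \<Rightarrow> 'b::{banach, second_countable_topology}) \<Rightarrow> 'b" where
  "face_integral F f = (LINT y:unit_prism F|lebesgue. f (closest_point (affine hull F) y))"

definition surface_integral ::
  "(real^'n) set set \<Rightarrow> (real^'n \<Rightarrow> 'b::{banach, second_countable_topology}) \<Rightarrow> 'b" where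
  "surface_integral \<F> f = (\<Sum>F\<in>\<F>. face_integral F f)"

text \<open>\<open>C^k\<close> on each face, up to the boundary of the face.\<close>

definition piecewise_Ck :: "nat \<Rightarrow> (real^'n) set set \<Rightarrow> (real^'n \<Rightarrow> real) \<Rightarrow> bool" where
  "piecewise_Ck k \<F> f \<longleftrightarrow>
     (\<forall>F\<in>\<F>. \<exists>U g. open U \<and> F \<subseteq> U \<and> Ck_on k U g \<and> (\<forall>x\<in>rel_interior F. f x = g x))"


section \<open>Quadrature\<close>

record 'a quadrature =
  num_elems :: nat
  elem :: "nat \<Rightarrow> 'a set"
  node :: "nat \<Rightarrow> 'a"
  weight :: "nat \<Rightarrow> real"

text \<open>In the plane, the sets satisfying the following are exactly the non-degenerate segments.\<close>

definition surface_element :: "(real^'n) set \<Rightarrow> bool" where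
  "surface_element T \<longleftrightarrow> compact T \<and> connected T \<and> aff_dim T = int CARD('n) - 1 \<and>
     T \<subseteq> closure (rel_interior T)"

definition quadrature_on :: "(real^'n) set set \<Rightarrow> (real^'n) quadrature \<Rightarrow> bool" where
  "quadrature_on \<F> q \<longleftrightarrow>
     (\<forall>j\<in>{1..num_elems q}. surface_element (elem q j)) \<and>
     (\<Union>j\<in>{1..num_elems q}. elem q j) = \<Union>\<F> \<and>
     (\<forall>i\<in>{1..num_elems q}. \<forall>j\<in>{1..num_elems q}. i \<noteq> j \<longrightarrow>
        rel_interior (elem q i) \<inter> rel_interior (elem q j) = {}) \<and>
     (\<forall>j\<in>{1..num_elems q}. node q j \<in> \<Union>\<F>)"

definition mesh_size :: "(real^'n) quadrature \<Rightarrow> real" where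
  "mesh_size q = Max ((\<lambda>j. diameter (elem q j)) ` {1..num_elems q})"

definition quadrature_sum ::
  "(real^'n) quadrature \<Rightarrow> (real^'n \<Rightarrow> 'b::real_vector) \<Rightarrow> 'b" where
  "quadrature_sum q f = (\<Sum>j=1..num_elems q. weight q j *\<^sub>R f (node q j))"

text \<open>
  A quadrature method is a set of rules. The constant may depend on the integrand,
  but not on the rule.
\<close>

definition quadrature_order ::
  "nat \<Rightarrow> real \<Rightarrow> (real^'n) set set \<Rightarrow> (real^'n) quadrature set \<Rightarrow> bool" where
  "quadrature_order k r \<F> \<Q> \<longleftrightarrow>
     (\<forall>f. piecewise_Ck k \<F> f \<longrightarrow>
        (\<exists>C>0. \<forall>q\<in>\<Q>. \<bar>surface_integral \<F> f - quadrature_sum q f\<bar> \<le> C * mesh_size q powr r))"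


section \<open>Linear elasticity\<close>

definition strain :: "(real^'n) set \<Rightarrow> (real^'n \<Rightarrow> real^'n) \<Rightarrow> real^'n \<Rightarrow> real^'n^'n" where
  "strain \<Omega> v x = (1/2) *\<^sub>R (weak_gradient \<Omega> v x + transpose (weak_gradient \<Omega> v x))"

definition stress ::
  "real \<Rightarrow> real \<Rightarrow> (real^'n) set \<Rightarrow> (real^'n \<Rightarrow> real^'n) \<Rightarrow> real^'n \<Rightarrow> real^'n^'n" where
  "stress E \<nu> \<Omega> v x = (E / (1 + \<nu>)) *\<^sub>R
     (strain \<Omega> v x + (\<nu> / (1 - 2 * \<nu>) * trace (strain \<Omega> v x)) *\<^sub>R mat 1)"

definition tensor :: "real^'n \<Rightarrow> real^'n \<Rightarrow> real^'n^'n" where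
  "tensor a b = (\<chi> i j. a $ i * b $ j)"

definition shear_modulus :: "real \<Rightarrow> real \<Rightarrow> real" where
  "shear_modulus E \<nu> = E / (2 * (1 + \<nu>))"

definition green_2d :: "real \<Rightarrow> real \<Rightarrow> real^'n \<Rightarrow> real^'n \<Rightarrow> real^'n^'n" where
  "green_2d E \<nu> x x' = (1 / (8 * pi * shear_modulus E \<nu> * (1 - \<nu>))) *\<^sub>R
     ((- (3 - 4 * \<nu>) * ln (norm (x - x'))) *\<^sub>R mat 1
       + (1 / (norm (x - x'))\<^sup>2) *\<^sub>R tensor (x - x') (x - x'))"

definition green_3d :: "real \<Rightarrow> real \<Rightarrow> real^'n \<Rightarrow> real^'n \<Rightarrow> real^'n^'n" where
  "green_3d E \<nu> x x' = ((1 + \<nu>) / (8 * pi * E * (1 - \<nu>))) *\<^sub>R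
     (((3 - 4 * \<nu>) / norm (x - x')) *\<^sub>R mat 1
       + (1 / norm (x - x') ^ 3) *\<^sub>R tensor (x - x') (x - x'))"

definition green :: "real \<Rightarrow> real \<Rightarrow> real^'n \<Rightarrow> real^'n \<Rightarrow> real^'n^'n" where
  "green E \<nu> = (if CARD('n) = 2 then green_2d E \<nu> else green_3d E \<nu>)"

definition field_solution ::
  "real \<Rightarrow> real \<Rightarrow> (real^'n) set set \<Rightarrow> (real^'n \<Rightarrow> real) \<Rightarrow> (real^'n \<Rightarrow> real^'n) \<Rightarrow>
   real^'n \<Rightarrow> real^'n" where
  "field_solution E \<nu> \<F> Q n x =
     surface_integral \<F> (\<lambda>x'. Q x' *\<^sub>R (green E \<nu> x x' *v n x'))"

definition discrete_field_solution ::
  "real \<Rightarrow> real \<Rightarrow> (real^'n) quadrature \<Rightarrow> (real^'n \<Rightarrow> real) \<Rightarrow> (real^'n \<Rightarrow> real^'n) \<Rightarrow>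
   real^'n \<Rightarrow> real^'n" where
  "discrete_field_solution E \<nu> q Q n x =
     quadrature_sum q (\<lambda>x'. Q x' *\<^sub>R (green E \<nu> x x' *v n x'))"

definition elastic_weak_solution ::
  "real \<Rightarrow> real \<Rightarrow> (real^'n) set \<Rightarrow> (real^'n \<Rightarrow> real^'n) \<Rightarrow> (real^'n \<Rightarrow> real^'n) \<Rightarrow> bool" where
  "elastic_weak_solution E \<nu> \<Omega> g v \<longleftrightarrow>
     v \<in> H1_space \<Omega> \<and> has_boundary_values \<Omega> v g \<and>
     (\<forall>\<phi>\<in>H1_0_space \<Omega>. (\<integral>x. stress E \<nu> \<Omega> v x \<bullet> strain \<Omega> \<phi> x \<partial>lebesgue_on \<Omega>) = 0)"

text \<open>
  Solution of the homogeneous Dirichlet problem on \<open>\<Omega>\<close> whose singular load is the one generating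
  the full-space field \<open>w\<close>: the sum of \<open>w\<close> and of a regular part correcting the boundary values.
\<close>

definition dirichlet_solution ::
  "real \<Rightarrow> real \<Rightarrow> (real^'n) set \<Rightarrow> (real^'n \<Rightarrow> real^'n) \<Rightarrow> (real^'n \<Rightarrow> real^'n) \<Rightarrow> bool" where
  "dirichlet_solution E \<nu> \<Omega> w u \<longleftrightarrow>
     (\<exists>v. elastic_weak_solution E \<nu> \<Omega> (\<lambda>x. - w x) v \<and> (\<forall>x\<in>\<Omega>. u x = w x + v x))"

end

theory Submission
  imports Defs
begin

text \<open>
  Write \<open>u\<^sub>h - u = (u\<^sub>h\<^sup>* - u\<^sup>*) + (v\<^sub>h - v)\<close>. Away from \<open>\<Gamma>\<close> the first bracket and its gradient are quadrature errors
  of integrands \<open>Q n\<^sub>j K(x - \<cdot>)\<close> with \<open>K\<close> smooth off the origin. The quadrature hypothesis bounds each of them with a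
  constant depending on \<open>x\<close>; a gliding hump argument makes the constant uniform in \<open>x\<close>, because the sum of an
  absolutely convergent series of such integrands is again piecewise \<open>C\<^sup>k\<close>. For the second bracket, let
  \<open>g = \<zeta> (u\<^sup>* - u\<^sub>h\<^sup>*)\<close> with a smooth cut-off \<open>\<zeta>\<close> that vanishes near \<open>\<Gamma>\<close> and equals one near the boundary of \<open>\<Omega>\<close>.
  Then \<open>z = v\<^sub>h - v - g\<close> lies in \<open>H1_0\<close>, the energy identity tested with \<open>z\<close> bounds the strain of \<open>z\<close> by the gradient
  of \<open>g\<close>, and a Poincare inequality bounds \<open>z\<close> by its strain.
\<close>

subsection \<open>Calculus of \<open>C\<^sup>k\<close> functions\<close>

text \<open>The Green's tensor depends only on x - x', so every quantity to be estimated is a scalar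
  potential with a kernel smooth off the origin; differentiation in x merely replaces the kernel by
  a partial derivative, which is why gradients are covered by the same quadrature hypothesis. On the
  Sobolev side the obstacle is that the difference of the field solutions is singular on \<Gamma>
  and cannot itself serve as an H1 extension of the boundary data. The cut-off removes the singular
  part, so only values and gradients at a fixed distance from \<Gamma> enter. Mollification is
  developed for two facts behind the membership of z in \<open>H1_0\<close>: the weak gradient is
  unique almost everywhere, so the arbitrary representative in \<open>weak_gradient\<close> does no
  harm, and an H1 field vanishing outside a compact subset of \<Omega> is a limit of test functions.
  Admissible integrands are smooth only face by face; Q n_j is one of them because the normal is
  constant on each face. All constants are fixed before the quadrature rule is chosen, which is the
  independence of h.\<close>

lemma Ck_on_cong:
  fixes f g :: "'a::euclidean_space \<Rightarrow> 'b::real_normed_vector"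
  assumes "open S" and "Ck_on k S f" and "\<And>x. x \<in> S \<Longrightarrow> f x = g x"
  shows "Ck_on k S g"
  using assms(2,3)
proof (induction k arbitrary: f g)
  case 0
  then show ?case by (metis Ck_on.simps(1) continuous_on_cong)
next
  case (Suc k)
  have d: "(g has_derivative frechet_derivative f (at x)) (at x)" if "x \<in> S" for x
  proof -
    have "(f has_derivative frechet_derivative f (at x)) (at x)"
      using Suc.prems(1) that by (simp add: frechet_derivative_works)
    then show ?thesis
      using has_derivative_transform_within_open[OF _ assms(1) that] Suc.prems(2) by metis
  qed
  have eq: "frechet_derivative f (at x) = frechet_derivative g (at x)" if "x \<in> S" for x
    using frechet_derivative_at[OF d[OF that]] .
  have "Ck_on k S (\<lambda>x. frechet_derivative g (at x) b)" if "b \<in> Basis" for b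
    by (rule Suc.IH[of "\<lambda>x. frechet_derivative f (at x) b"]) (use Suc.prems(1) that eq in auto)
  then show ?case using d by (auto simp: differentiable_def)
qed

text \<open>A full derivative at a point is unique, so any explicit formula for it may replace
  \<open>frechet_derivative\<close>; the closure properties below then reduce to the usual
  differentiation rules.\<close>

lemma Ck_on_SucI:
  assumes "open S" and "\<And>x. x \<in> S \<Longrightarrow> (f has_derivative f' x) (at x)"
    and "\<And>b. b \<in> Basis \<Longrightarrow> Ck_on k S (\<lambda>x. f' x b)"
  shows "Ck_on (Suc k) S f"
proof -
  have "frechet_derivative f (at x) = f' x" if "x \<in> S" for x
    using frechet_derivative_at[OF assms(2)[OF that]] by simp
  then have "Ck_on k S (\<lambda>x. frechet_derivative f (at x) b)" if "b \<in> Basis" for b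
    by (intro Ck_on_cong[OF assms(1) assms(3)[OF that]]) auto
  then show ?thesis
    using assms(2) by (auto simp: differentiable_def)
qed

lemma Ck_on_subset: "Ck_on k S f \<Longrightarrow> T \<subseteq> S \<Longrightarrow> Ck_on k T f"
  by (induction k arbitrary: f) (auto intro: continuous_on_subset)

lemma Ck_on_imp_continuous_on:
  assumes "Ck_on k S f"
  shows "continuous_on S f"
proof (cases k)
  case 0
  then show ?thesis using assms by simp
next
  case (Suc j)
  then have "f differentiable (at x)" if "x \<in> S" for x using assms that by simp
  then show ?thesis
    by (simp add: continuous_at_imp_continuous_on differentiable_imp_continuous_within)
qed

lemma Ck_on_Suc_imp: "Ck_on (Suc k) S f \<Longrightarrow> Ck_on k S f"
proof (induction k arbitrary: f)
  case 0
  then show ?case using Ck_on_imp_continuous_on[OF 0] by simp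
next
  case (Suc k)
  then show ?case unfolding Ck_on.simps(2)[of _ S f] by blast
qed

lemma Ck_on_Suc_has_derivative:
  "Ck_on (Suc k) S f \<Longrightarrow> x \<in> S \<Longrightarrow> (f has_derivative frechet_derivative f (at x)) (at x)"
  by (simp add: frechet_derivative_works)

lemma Ck_on_const: "open S \<Longrightarrow> Ck_on k S (\<lambda>x. c)"
proof (induction k arbitrary: c)
  case (Suc k)
  show ?case
    by (rule Ck_on_SucI[where f'="\<lambda>x h. 0"]) (use Suc in auto)
qed simp

lemma Ck_on_bounded_linear_compose:
  assumes "open S" "bounded_linear L" "Ck_on k S f"
  shows "Ck_on k S (\<lambda>x. L (f x))"
  using assms(3)
proof (induction k arbitrary: f)
  case 0
  then show ?case
    using bounded_linear.continuous_on[OF assms(2)] by auto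
next
  case (Suc k)
  show ?case
  proof (rule Ck_on_SucI[OF assms(1), where f'="\<lambda>x h. L (frechet_derivative f (at x) h)"])
    show "((\<lambda>x. L (f x)) has_derivative (\<lambda>h. L (frechet_derivative f (at x) h))) (at x)"
      if "x \<in> S" for x
      by (rule bounded_linear.has_derivative[OF assms(2) Ck_on_Suc_has_derivative[OF Suc.prems that]])
    show "Ck_on k S (\<lambda>x. L (frechet_derivative f (at x) b))" if "b \<in> Basis" for b
      using Suc that by auto
  qed
qed

lemma Ck_on_ident: "open S \<Longrightarrow> Ck_on k S (\<lambda>x. x)"
proof (cases k)
  case (Suc j)
  assume "open S"
  then show ?thesis unfolding Suc
    by (intro Ck_on_SucI[where f'="\<lambda>x h. h"]) (auto intro: Ck_on_const)
qed auto

lemma Ck_on_add: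
  assumes "open S" "Ck_on k S f" "Ck_on k S g"
  shows "Ck_on k S (\<lambda>x. f x + g x)"
  using assms(2,3)
proof (induction k arbitrary: f g)
  case (Suc k)
  show ?case
    by (rule Ck_on_SucI[OF assms(1), where
          f'="\<lambda>x h. frechet_derivative f (at x) h + frechet_derivative g (at x) h"])
      (use Suc assms in \<open>auto intro!: has_derivative_add Ck_on_Suc_has_derivative\<close>)
qed (auto intro: continuous_intros)

lemma (in bounded_bilinear) Ck_on:
  assumes "open S" "Ck_on k S f" "Ck_on k S g"
  shows "Ck_on k S (\<lambda>x. prod (f x) (g x))"
  using assms(2,3)
proof (induction k arbitrary: f g)
  case 0
  then show ?case using continuous_on by auto
next
  case (Suc k)
  \<comment> \<open>Each summand of the product rule keeps one factor undifferentiated, and that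
    factor enters the induction at one order less.\<close>
  note fg = Ck_on_Suc_imp[OF Suc.prems(1)] Ck_on_Suc_imp[OF Suc.prems(2)]
  show ?case
  proof (rule Ck_on_SucI[OF assms(1), where f'="\<lambda>x h. prod (f x) (frechet_derivative g (at x) h)
            + prod (frechet_derivative f (at x) h) (g x)"])
    show "((\<lambda>x. prod (f x) (g x)) has_derivative (\<lambda>h. prod (f x) (frechet_derivative g (at x) h)
            + prod (frechet_derivative f (at x) h) (g x))) (at x)" if "x \<in> S" for x
      using Suc.prems that by (intro FDERIV Ck_on_Suc_has_derivative)
    show "Ck_on k S (\<lambda>x. prod (f x) (frechet_derivative g (at x) b)
            + prod (frechet_derivative f (at x) b) (g x))" if "b \<in> Basis" for b
      using Suc fg that assms(1) by (intro Ck_on_add Suc.IH) auto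
  qed
qed

lemmas Ck_on_mult = bounded_bilinear.Ck_on[OF bounded_bilinear_mult]
lemmas Ck_on_scaleR = bounded_bilinear.Ck_on[OF bounded_bilinear_scaleR]
lemmas Ck_on_inner = bounded_bilinear.Ck_on[OF bounded_bilinear_inner]

lemma Ck_on_sum:
  assumes "open S" "finite I" "\<And>i. i \<in> I \<Longrightarrow> Ck_on k S (f i)"
  shows "Ck_on k S (\<lambda>x. \<Sum>i\<in>I. f i x)"
  using assms(2,3) by (induction I rule: finite_induct) (auto intro: Ck_on_add Ck_on_const assms(1))

text \<open>The derivative of 1/f is again built from 1/f, now required at one order less, so the
  induction on the order closes without higher quotient rules.\<close>

lemma Ck_on_inverse:
  fixes f :: "'a::euclidean_space \<Rightarrow> real"
  assumes "open S" "Ck_on k S f" and nz: "\<And>x. x \<in> S \<Longrightarrow> f x \<noteq> 0"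
  shows "Ck_on k S (\<lambda>x. inverse (f x))"
  using assms(2)
proof (induction k)
  case 0
  then show ?case using nz by (auto intro!: continuous_intros)
next
  case (Suc k)
  note inv = Suc.IH[OF Ck_on_Suc_imp[OF Suc.prems]]
  show ?case
  proof (rule Ck_on_SucI[OF assms(1), where
        f'="\<lambda>x h. - (inverse (f x) * frechet_derivative f (at x) h * inverse (f x))"])
    show "((\<lambda>x. inverse (f x)) has_derivative
       (\<lambda>h. - (inverse (f x) * frechet_derivative f (at x) h * inverse (f x)))) (at x)" if "x \<in> S" for x
      using Suc.prems that nz by (intro Deriv.has_derivative_inverse Ck_on_Suc_has_derivative) auto
    show "Ck_on k S (\<lambda>x. - (inverse (f x) * frechet_derivative f (at x) b * inverse (f x)))"
      if "b \<in> Basis" for b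
      using Suc.prems inv that assms(1)
      by (intro Ck_on_bounded_linear_compose[where L=uminus] Ck_on_mult bounded_linear_minus
          bounded_linear_ident) auto
  qed
qed

lemma Ck_on_ln:
  fixes f :: "'a::euclidean_space \<Rightarrow> real"
  assumes "open S" "Ck_on k S f" and pos: "\<And>x. x \<in> S \<Longrightarrow> f x > 0"
  shows "Ck_on k S (\<lambda>x. ln (f x))"
proof (cases k)
  case 0
  then show ?thesis using assms by (force intro!: continuous_intros)
next
  case (Suc j)
  note f = assms(2)[unfolded Suc]
  show ?thesis unfolding Suc
  proof (rule Ck_on_SucI[OF assms(1), where
        f'="\<lambda>x h. inverse (f x) * frechet_derivative f (at x) h"])
    show "((\<lambda>x. ln (f x)) has_derivative (\<lambda>h. inverse (f x) * frechet_derivative f (at x) h)) (at x)"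
      if "x \<in> S" for x
      using DERIV_ln[OF pos[OF that]] Ck_on_Suc_has_derivative[OF f that]
      by (auto intro: has_derivative_compose[of f _ _ _ ln] simp: has_field_derivative_def)
    show "Ck_on j S (\<lambda>x. inverse (f x) * frechet_derivative f (at x) b)" if "b \<in> Basis" for b
      using f that assms(1) pos Ck_on_Suc_imp[OF f] by (intro Ck_on_mult Ck_on_inverse) force+
  qed
qed

lemma Ck_on_sqrt:
  fixes f :: "'a::euclidean_space \<Rightarrow> real"
  assumes "open S" "Ck_on k S f" and pos: "\<And>x. x \<in> S \<Longrightarrow> f x > 0"
  shows "Ck_on k S (\<lambda>x. sqrt (f x))"
  using assms(2)
proof (induction k)
  case 0
  then show ?case by (auto intro!: continuous_intros)
next
  case (Suc k)
  note f = Suc.prems and s = Suc.IH[OF Ck_on_Suc_imp[OF Suc.prems]]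
  show ?case
  proof (rule Ck_on_SucI[OF assms(1), where
        f'="\<lambda>x h. (inverse (sqrt (f x)) / 2) * frechet_derivative f (at x) h"])
    show "((\<lambda>x. sqrt (f x)) has_derivative
       (\<lambda>h. (inverse (sqrt (f x)) / 2) * frechet_derivative f (at x) h)) (at x)"
      if "x \<in> S" for x
      using DERIV_real_sqrt[OF pos[OF that]] Ck_on_Suc_has_derivative[OF f that]
      by (auto dest: has_derivative_compose[of f _ _ _ sqrt] simp: has_field_derivative_def)
    show "Ck_on k S (\<lambda>x. (inverse (sqrt (f x)) / 2) * frechet_derivative f (at x) b)"
      if "b \<in> Basis" for b
      using f that assms(1) pos s
      by (intro Ck_on_mult Ck_on_bounded_linear_compose[where L="\<lambda>x. x / 2"] Ck_on_inverse
          bounded_linear_divide) force+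
  qed
qed

text \<open>Covers the substitutions that occur: translations that move the field point,
  \<open>c = -1\<close> for reflections, and the rescaling of the bump function.\<close>

lemma Ck_on_affine_compose:
  assumes "open S" "open T" "Ck_on k T f" "\<And>x. x \<in> S \<Longrightarrow> c *\<^sub>R x + a \<in> T"
  shows "Ck_on k S (\<lambda>x. f (c *\<^sub>R x + a))"
  using assms(3)
proof (induction k arbitrary: f)
  case 0
  have "continuous_on S (\<lambda>x. c *\<^sub>R x + a)" by (intro continuous_intros)
  with 0 show ?case using assms(4)
    by (auto intro: continuous_on_compose2[of T f])
next
  case (Suc k)
  show ?case
  proof (rule Ck_on_SucI[OF assms(1), where
        f'="\<lambda>x h. frechet_derivative f (at (c *\<^sub>R x + a)) (c *\<^sub>R h)"])
    show d: "((\<lambda>x. f (c *\<^sub>R x + a)) has_derivative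
        (\<lambda>h. frechet_derivative f (at (c *\<^sub>R x + a)) (c *\<^sub>R h))) (at x)" if "x \<in> S" for x
    proof (rule has_derivative_compose[where g=f and f="\<lambda>x. c *\<^sub>R x + a"])
      show "((\<lambda>x. c *\<^sub>R x + a) has_derivative (*\<^sub>R) c) (at x)"
        by (auto intro!: derivative_eq_intros)
      show "(f has_derivative frechet_derivative f (at (c *\<^sub>R x + a))) (at (c *\<^sub>R x + a))"
        using Suc.prems assms(4) that by (intro Ck_on_Suc_has_derivative)
    qed
    show "Ck_on k S (\<lambda>x. frechet_derivative f (at (c *\<^sub>R x + a)) (c *\<^sub>R b))" if "b \<in> Basis" for b
    proof (rule Ck_on_cong[OF assms(1)])
      show "Ck_on k S (\<lambda>x. c *\<^sub>R frechet_derivative f (at (c *\<^sub>R x + a)) b)"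
        using Suc.IH[of "\<lambda>x. frechet_derivative f (at x) b"] Suc.prems that
        by (intro Ck_on_bounded_linear_compose[OF assms(1) bounded_linear_scaleR_right]) simp
      show "c *\<^sub>R frechet_derivative f (at (c *\<^sub>R x + a)) b =
            frechet_derivative f (at (c *\<^sub>R x + a)) (c *\<^sub>R b)" if "x \<in> S" for x
      proof -
        have "linear (frechet_derivative f (at (c *\<^sub>R x + a)))"
          using Ck_on_Suc_has_derivative[OF Suc.prems assms(4)[OF that]]
          by (rule has_derivative_linear)
        then show ?thesis by (simp add: linear_cmul)
      qed
    qed
  qed
qed

subsection \<open>A smooth bump function\<close>

text \<open>The functions exp(-1/t) t^(-m), extended by zero. The whole family is taken instead of m
  = 0 alone because differentiation leads from m to m + 1 and m + 2 and never leaves it.\<close>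

definition bump_profile :: "nat \<Rightarrow> real \<Rightarrow> real" where
  "bump_profile m t = (if t > 0 then exp (- inverse t) * inverse t ^ m else 0)"

text \<open>With s = 1/t the claim becomes s^m / exp s -> 0 at infinity.\<close>

lemma bump_profile_at_0: "((\<lambda>t. bump_profile m t) \<longlongrightarrow> 0) (at_right 0)"
proof -
  have "((\<lambda>s. s ^ m / exp s) \<longlongrightarrow> (0::real)) at_top"
    by (rule tendsto_power_div_exp_0)
  then have "((\<lambda>t. inverse t ^ m / exp (inverse t)) \<longlongrightarrow> (0::real)) (at_right 0)"
    by (rule filterlim_compose[OF _ filterlim_inverse_at_top_right])
  then show ?thesis
  proof (rule Lim_transform_eventually)
    show "\<forall>\<^sub>F t in at_right 0. inverse t ^ m / exp (inverse t) = bump_profile m t"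
      by (rule eventually_mono[OF eventually_at_right_less[of 0]])
        (simp add: bump_profile_def exp_minus field_simps)
  qed
qed

lemma bump_profile_has_derivative:
  "(bump_profile m has_real_derivative
     bump_profile (m + 2) t - real m * bump_profile (m + 1) t) (at t)"
proof -
  consider "t > 0" | "t < 0" | "t = 0" by linarith
  then show ?thesis
  proof cases
    case 1
    have "((\<lambda>t. exp (- inverse t) * inverse t ^ m) has_real_derivative
        bump_profile (m + 2) t - real m * bump_profile (m + 1) t) (at t)"
      using 1 by (auto intro!: derivative_eq_intros simp: bump_profile_def algebra_simps power2_eq_square)
        (cases m; simp)
    then show ?thesis
      by (rule has_field_derivative_transform_within_open[where S="{0<..}"])
        (use 1 in \<open>auto simp: bump_profile_def\<close>)
  next
    case 2
    have "((\<lambda>t. 0) has_real_derivative 0) (at t)" by simp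
    then have "(bump_profile m has_real_derivative 0) (at t)"
      by (rule has_field_derivative_transform_within_open[where S="{..<0}"])
        (use 2 in \<open>auto simp: bump_profile_def\<close>)
    then show ?thesis using 2 by (simp add: bump_profile_def)
  next
    case 3
    \<comment> \<open>To the right of 0 the difference quotient of the m-th profile is the (m+1)-st
      profile, which tends to 0; to the left it vanishes identically.\<close>
    have "((\<lambda>h. bump_profile m h / h) \<longlongrightarrow> 0) (at_right 0)"
    proof (rule Lim_transform_eventually[OF bump_profile_at_0[of "Suc m"]])
      show "\<forall>\<^sub>F t in at_right 0. bump_profile (Suc m) t = bump_profile m t / t"
        by (rule eventually_mono[OF eventually_at_right_less[of 0]])
          (simp add: bump_profile_def field_simps)
    qed
    moreover have "((\<lambda>h. bump_profile m h / h) \<longlongrightarrow> 0) (at_left 0)"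
      by (rule Lim_transform_eventually[OF tendsto_const])
        (auto simp: bump_profile_def eventually_at_filter)
    ultimately have "((\<lambda>h. bump_profile m h / h) \<longlongrightarrow> 0) (at 0)"
      by (simp add: filterlim_split_at)
    then show ?thesis
      unfolding 3 has_field_derivative_iff by (simp add: bump_profile_def)
  qed
qed

text \<open>Order and profile index are coupled: lowering k by one raises m by up to two. Hence m is
  generalised in the induction.\<close>

lemma Ck_on_bump_profile:
  assumes "open S" "\<And>k. Ck_on k S f"
  shows "Ck_on k S (\<lambda>x. bump_profile m (f x))"
proof (induction k arbitrary: m)
  case 0
  have "continuous_on UNIV (bump_profile m)"
    using bump_profile_has_derivative[THEN DERIV_isCont]
    by (simp add: continuous_on_eq_continuous_at)
  moreover have "continuous_on S f" using assms(2)[of 0] by simp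
  ultimately show ?case by (auto intro: continuous_on_compose2)
next
  case (Suc k)
  show ?case
  proof (rule Ck_on_SucI[OF assms(1), where f'="\<lambda>x h.
        (bump_profile (m + 2) (f x) + (- real m) * bump_profile (m + 1) (f x)) * frechet_derivative f (at x) h"])
    show "((\<lambda>x. bump_profile m (f x)) has_derivative (\<lambda>h.
        (bump_profile (m + 2) (f x) + (- real m) * bump_profile (m + 1) (f x)) * frechet_derivative f (at x) h)) (at x)"
      if "x \<in> S" for x
      using bump_profile_has_derivative[of m "f x"]
        Ck_on_Suc_has_derivative[OF assms(2)[of "Suc 0"] that]
      by (auto intro: has_derivative_compose[of f _ _ _ "bump_profile m"] simp: has_field_derivative_def)
    show "Ck_on k S (\<lambda>x. (bump_profile (m + 2) (f x) + (- real m) * bump_profile (m + 1) (f x)) * frechet_derivative f (at x) b)"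
      if "b \<in> Basis" for b
      using assms(2)[of "Suc k"] that Suc
      by (intro Ck_on_mult Ck_on_add Ck_on_const assms(1)) auto
  qed
qed

definition bump :: "'a::euclidean_space \<Rightarrow> real" where
  "bump x = bump_profile 0 (1 - x \<bullet> x)"

lemma Ck_on_bump: "Ck_on k UNIV bump"
proof -
  have "Ck_on j UNIV (\<lambda>x::'a. 1 + (- 1) * (x \<bullet> x))" for j
    by (intro Ck_on_add Ck_on_const Ck_on_mult Ck_on_inner Ck_on_ident) auto
  from Ck_on_bump_profile[OF _ this] show ?thesis unfolding bump_def by simp
qed

lemma bump_nonneg: "bump x \<ge> 0"
  by (simp add: bump_def bump_profile_def)

lemma bump_eq_0_iff: "bump x = 0 \<longleftrightarrow> norm x \<ge> 1"
  by (simp add: bump_def bump_profile_def norm_eq_sqrt_inner not_less)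

subsection \<open>Superpositions of translates\<close>

text \<open>Integrals of g(x - \<tau> s) against a weight w cover all superpositions of the
  development: convolution with a mollifier (Lebesgue measure, \<tau> the identity), potentials of a
  face (\<tau> the projection to the face) and series of translated kernels (counting measure).
  Compactness of T keeps g bounded along the translates.\<close>

lemma integrable_translate:
  fixes g :: "'a::euclidean_space \<Rightarrow> real" and w :: "'s \<Rightarrow> 'b::euclidean_space"
  assumes w: "integrable M w" and \<tau>: "\<tau> \<in> borel_measurable M"
    and T: "compact T" "\<And>s. s \<in> space M \<Longrightarrow> \<tau> s \<in> T"
    and g: "continuous_on W g" and x: "\<And>t. t \<in> T \<Longrightarrow> x - t \<in> W"
  shows "integrable M (\<lambda>s. g (x - \<tau> s) *\<^sub>R w s)"
proof -
  have c: "continuous_on T (\<lambda>t. g (x - t))"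
    using x by (auto intro!: continuous_on_compose2[OF g] continuous_intros)
  then obtain B where B: "\<And>t. t \<in> T \<Longrightarrow> norm (g (x - t)) \<le> B"
    using compact_imp_bounded[OF compact_continuous_image[OF c T(1)]]
    by (auto simp: bounded_iff)
  have "\<tau> \<in> measurable M (restrict_space borel T)"
    using \<tau> T(2) by (auto intro!: measurable_restrict_space2)
  from measurable_compose[OF this borel_measurable_continuous_on_restrict[OF c]]
  have m: "(\<lambda>s. g (x - \<tau> s)) \<in> borel_measurable M" by simp
  show ?thesis
  proof (rule Bochner_Integration.integrable_bound)
    show "integrable M (\<lambda>s. B *\<^sub>R norm (w s))" using w by auto
    show "(\<lambda>s. g (x - \<tau> s) *\<^sub>R w s) \<in> borel_measurable M" using m w by auto
    show "AE s in M. norm (g (x - \<tau> s) *\<^sub>R w s) \<le> norm (B *\<^sub>R norm (w s))"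
    proof (rule AE_I2)
      fix s assume "s \<in> space M"
      then have "\<bar>g (x - \<tau> s)\<bar> \<le> B" using B T(2) by fastforce
      then show "norm (g (x - \<tau> s) *\<^sub>R w s) \<le> norm (B *\<^sub>R norm (w s))"
        by (auto simp: abs_mult intro!: mult_right_mono)
    qed
  qed
qed

lemma norm_integral_scaleR_le:
  fixes g :: "'s \<Rightarrow> real" and w :: "'s \<Rightarrow> 'b::euclidean_space"
  assumes "integrable M w" "integrable M (\<lambda>s. g s *\<^sub>R w s)"
    and "\<And>s. s \<in> space M \<Longrightarrow> \<bar>g s\<bar> \<le> e"
  shows "norm (\<integral>s. g s *\<^sub>R w s \<partial>M) \<le> e * (\<integral>s. norm (w s) \<partial>M)"
proof -
  have "norm (\<integral>s. g s *\<^sub>R w s \<partial>M) \<le> (\<integral>s. norm (g s *\<^sub>R w s) \<partial>M)" by (rule integral_norm_bound)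
  also have "\<dots> \<le> (\<integral>s. e * norm (w s) \<partial>M)"
    using assms integrable_norm[OF assms(2)]
    by (intro integral_mono) (auto intro!: mult_right_mono)
  finally show ?thesis by simp
qed

text \<open>For all y near x the differences y - t stay in one compact subset of W. This turns
  continuity of g into uniform continuity, simultaneously for all s.\<close>

lemma compact_translates:
  fixes T :: "'a::euclidean_space set"
  assumes "compact T" "open U" "x \<in> U" "\<And>x t. x \<in> U \<Longrightarrow> t \<in> T \<Longrightarrow> x - t \<in> W"
  obtains \<rho> A where "\<rho> > 0" "ball x \<rho> \<subseteq> U" "compact A" "A \<subseteq> W"
    "\<And>y t. y \<in> ball x \<rho> \<Longrightarrow> t \<in> T \<Longrightarrow> y - t \<in> A"
proof -
  obtain \<rho> where \<rho>: "\<rho> > 0" "cball x \<rho> \<subseteq> U" using assms(2,3) open_contains_cball by blast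
  have "compact ((\<lambda>(y, t). y - t) ` (cball x \<rho> \<times> T))"
    by (intro compact_continuous_image compact_Times assms(1) compact_cball)
      (auto simp: case_prod_unfold intro!: continuous_intros)
  with \<rho> show ?thesis
    by (intro that[of \<rho> "(\<lambda>(y, t). y - t) ` (cball x \<rho> \<times> T)"]) (use assms(4) \<rho> in auto)
qed

text \<open>\<open>Ck_on\<close> speaks of partial derivatives only; this converts smallness of all
  of them into smallness of the operator norm, as the mean value inequality demands.\<close>

lemma onorm_le_sum_Basis:
  fixes f :: "'a::euclidean_space \<Rightarrow> real"
  assumes "linear f"
  shows "onorm f \<le> (\<Sum>b\<in>Basis. \<bar>f b\<bar>)"
proof (rule onorm_le)
  fix x
  have "f x = f (\<Sum>b\<in>Basis. (x \<bullet> b) *\<^sub>R b)" by (simp add: euclidean_representation)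
  also have "\<dots> = (\<Sum>b\<in>Basis. (x \<bullet> b) * f b)" using assms by (simp add: linear_sum linear_cmul)
  finally have "norm (f x) \<le> (\<Sum>b\<in>Basis. \<bar>x \<bullet> b\<bar> * \<bar>f b\<bar>)"
    by (simp add: abs_mult[symmetric])
  also have "\<dots> \<le> (\<Sum>b\<in>Basis. norm x * \<bar>f b\<bar>)"
    by (intro sum_mono mult_right_mono Basis_le_norm) auto
  finally show "norm (f x) \<le> (\<Sum>b\<in>Basis. \<bar>f b\<bar>) * norm x"
    by (simp add: sum_distrib_left mult.commute)
qed

lemma continuous_on_integral_translate:
  fixes g :: "'a::euclidean_space \<Rightarrow> real" and w :: "'s \<Rightarrow> 'b::euclidean_space"
  assumes w: "integrable M w" and \<tau>: "\<tau> \<in> borel_measurable M"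
    and T: "compact T" "\<And>s. s \<in> space M \<Longrightarrow> \<tau> s \<in> T"
    and U: "open U" and UT: "\<And>x t. x \<in> U \<Longrightarrow> t \<in> T \<Longrightarrow> x - t \<in> W"
    and g: "continuous_on W g"
  shows "continuous_on U (\<lambda>x. \<integral>s. g (x - \<tau> s) *\<^sub>R w s \<partial>M)"
proof (rule continuous_at_imp_continuous_on, rule ballI)
  fix x assume x: "x \<in> U"
  have int: "integrable M (\<lambda>s. g (x - \<tau> s) *\<^sub>R w s)" if "x \<in> U" for x
    by (rule integrable_translate[OF w \<tau> T g]) (use UT that in auto)
  from compact_translates[OF T(1) U x UT] obtain \<rho> A where
    A: "\<rho> > 0" "ball x \<rho> \<subseteq> U" "compact A" "A \<subseteq> W" "\<And>y t. y \<in> ball x \<rho> \<Longrightarrow> t \<in> T \<Longrightarrow> y - t \<in> A"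
    by metis
  have unif: "uniformly_continuous_on A g"
    using A g by (intro compact_uniformly_continuous) (auto intro: continuous_on_subset)
  define N where "N = (\<integral>s. norm (w s) \<partial>M)"
  have N: "N \<ge> 0" by (simp add: N_def)
  show "isCont (\<lambda>x. \<integral>s. g (x - \<tau> s) *\<^sub>R w s \<partial>M) x"
    unfolding continuous_at_eps_delta
  proof (intro allI impI)
    fix e :: real assume "e > 0"
    \<comment> \<open>N may be zero, hence N + 1 in the denominator.\<close>
    then have "e / (N + 1) > 0" using N by auto
    with unif obtain d where d: "d > 0"
      "\<And>a a'. a \<in> A \<Longrightarrow> a' \<in> A \<Longrightarrow> dist a' a < d \<Longrightarrow> dist (g a') (g a) < e / (N + 1)"
      unfolding uniformly_continuous_on_def by metis
    show "\<exists>d>0. \<forall>y. dist y x < d \<longrightarrow>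
      dist (\<integral>s. g (y - \<tau> s) *\<^sub>R w s \<partial>M) (\<integral>s. g (x - \<tau> s) *\<^sub>R w s \<partial>M) < e"
    proof (intro exI[of _ "min d \<rho>"] conjI allI impI)
      show "min d \<rho> > 0" using d A by simp
      fix y assume "dist y x < min d \<rho>"
      then have y: "y \<in> ball x \<rho>" "dist y x < d" by (auto simp: dist_commute)
      then have "y \<in> U" using A by auto
      note iy = int[OF \<open>y \<in> U\<close>] and ix = int[OF x]
      have "norm (\<integral>s. (g (y - \<tau> s) - g (x - \<tau> s)) *\<^sub>R w s \<partial>M) \<le> e / (N + 1) * N"
        unfolding N_def
      proof (rule norm_integral_scaleR_le[OF w])
        show "integrable M (\<lambda>s. (g (y - \<tau> s) - g (x - \<tau> s)) *\<^sub>R w s)"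
          unfolding scaleR_diff_left by (intro Bochner_Integration.integrable_diff iy ix)
        fix s assume s: "s \<in> space M"
        have "dist (g (y - \<tau> s)) (g (x - \<tau> s)) < e / (N + 1)"
          using A y T s by (intro d(2)) (auto simp: dist_norm)
        then show "\<bar>g (y - \<tau> s) - g (x - \<tau> s)\<bar> \<le> e / ((\<integral>s. norm (w s) \<partial>M) + 1)"
          by (simp add: dist_norm N_def)
      qed
      also have "\<dots> < e" using N \<open>e > 0\<close> by (simp add: field_simps)
      finally show "dist (\<integral>s. g (y - \<tau> s) *\<^sub>R w s \<partial>M) (\<integral>s. g (x - \<tau> s) *\<^sub>R w s \<partial>M) < e"
        using iy ix by (simp add: dist_norm scaleR_diff_left)
    qed
  qed
qed

text \<open>The mean value inequality bounds the linearisation error of g at x - \<tau> s by the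
  oscillation of its derivative on one compact set. The bound is uniform in s and survives
  integration against the norm of w.\<close>

lemma has_derivative_integral_translate:
  fixes g :: "'a::euclidean_space \<Rightarrow> real" and w :: "'s \<Rightarrow> 'b::euclidean_space"
  assumes w: "integrable M w" and \<tau>: "\<tau> \<in> borel_measurable M"
    and T: "compact T" "\<And>s. s \<in> space M \<Longrightarrow> \<tau> s \<in> T"
    and U: "open U" and UT: "\<And>x t. x \<in> U \<Longrightarrow> t \<in> T \<Longrightarrow> x - t \<in> W"
    and g: "Ck_on (Suc 0) W g" and x: "x \<in> U"
  shows "((\<lambda>x. \<integral>s. g (x - \<tau> s) *\<^sub>R w s \<partial>M) has_derivative
     (\<lambda>h. \<integral>s. frechet_derivative g (at (x - \<tau> s)) h *\<^sub>R w s \<partial>M)) (at x)"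
proof -
  define g' where "g' a = frechet_derivative g (at a)" for a
  have int: "integrable M (\<lambda>s. g (x - \<tau> s) *\<^sub>R w s)" if "x \<in> U" for x
    by (rule integrable_translate[OF w \<tau> T Ck_on_imp_continuous_on[OF g]]) (use UT that in auto)
  have g': "(g has_derivative g' a) (at a)" if "a \<in> W" for a
    using g that by (simp add: g'_def frechet_derivative_works)
  have lin: "linear (g' a)" if "a \<in> W" for a using g'[OF that] by (rule has_derivative_linear)
  have cont: "continuous_on W (\<lambda>a. g' a b)" if "b \<in> Basis" for b
    using g that by (simp add: g'_def)
  have expand: "g' a h = (\<Sum>b\<in>Basis. (h \<bullet> b) * g' a b)" if "a \<in> W" for a h
  proof -
    have "g' a h = g' a (\<Sum>b\<in>Basis. (h \<bullet> b) *\<^sub>R b)" by (simp add: euclidean_representation)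
    then show ?thesis using lin[OF that] by (simp add: linear_sum linear_cmul)
  qed
  have int': "integrable M (\<lambda>s. g' (x - \<tau> s) h *\<^sub>R w s)" if x: "x \<in> U" for x h
  proof (rule integrable_translate[where g="\<lambda>a. g' a h", OF w \<tau> T _ UT[OF x]])
    have "continuous_on W (\<lambda>a. \<Sum>b\<in>Basis. (h \<bullet> b) * g' a b)"
      by (intro continuous_intros cont)
    then show "continuous_on W (\<lambda>a. g' a h)" using expand continuous_on_cong by fastforce
  qed auto
  from compact_translates[OF T(1) U x UT] obtain \<rho> A where
    A: "\<rho> > 0" "ball x \<rho> \<subseteq> U" "compact A" "A \<subseteq> W" "\<And>y t. y \<in> ball x \<rho> \<Longrightarrow> t \<in> T \<Longrightarrow> y - t \<in> A"
    by metis
  define N where "N = (\<integral>s. norm (w s) \<partial>M)"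
  have N: "N \<ge> 0" by (simp add: N_def)
  have "((\<lambda>x. \<integral>s. g (x - \<tau> s) *\<^sub>R w s \<partial>M) has_derivative
     (\<lambda>h. \<integral>s. g' (x - \<tau> s) h *\<^sub>R w s \<partial>M)) (at x)"
    unfolding has_derivative_at_alt
  proof (intro conjI allI impI)
    have "linear (\<lambda>h. \<integral>s. g' (x - \<tau> s) h *\<^sub>R w s \<partial>M)"
    proof (rule linearI)
      fix h h' and c :: real
      have eq: "(\<integral>s. g' (x - \<tau> s) (h + h') *\<^sub>R w s \<partial>M) =
          (\<integral>s. g' (x - \<tau> s) h *\<^sub>R w s + g' (x - \<tau> s) h' *\<^sub>R w s \<partial>M)"
        using lin UT[OF x] T(2)
        by (intro Bochner_Integration.integral_cong) (auto simp: linear_add scaleR_add_left)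
      show "(\<integral>s. g' (x - \<tau> s) (h + h') *\<^sub>R w s \<partial>M) =
          (\<integral>s. g' (x - \<tau> s) h *\<^sub>R w s \<partial>M) + (\<integral>s. g' (x - \<tau> s) h' *\<^sub>R w s \<partial>M)"
        unfolding eq by (rule Bochner_Integration.integral_add[OF int'[OF x] int'[OF x]])
      have eq: "(\<integral>s. g' (x - \<tau> s) (c *\<^sub>R h) *\<^sub>R w s \<partial>M) =
          (\<integral>s. c *\<^sub>R (g' (x - \<tau> s) h *\<^sub>R w s) \<partial>M)"
        using lin UT[OF x] T(2)
        by (intro Bochner_Integration.integral_cong) (auto simp: linear_cmul)
      show "(\<integral>s. g' (x - \<tau> s) (c *\<^sub>R h) *\<^sub>R w s \<partial>M) = c *\<^sub>R (\<integral>s. g' (x - \<tau> s) h *\<^sub>R w s \<partial>M)"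
        unfolding eq by (rule integral_scaleR_right)
    qed
    then show "bounded_linear (\<lambda>h. \<integral>s. g' (x - \<tau> s) h *\<^sub>R w s \<partial>M)"
      by (simp add: linear_conv_bounded_linear)
    fix e :: real assume e: "e > 0"
    define e' where "e' = e / (N + 1)"
    have e': "e' > 0" "e' * N \<le> e" using e N by (auto simp: e'_def field_simps)
    have "\<exists>d>0. \<forall>a\<in>A. \<forall>a'\<in>A. dist a' a < d \<longrightarrow> \<bar>g' a' b - g' a b\<bar> < e' / DIM('a)"
      if "b \<in> Basis" for b
    proof -
      have "uniformly_continuous_on A (\<lambda>a. g' a b)"
        using A cont[OF that] by (intro compact_uniformly_continuous) (auto intro: continuous_on_subset)
      moreover have "e' / DIM('a) > 0" using e' by simp
      ultimately show ?thesis unfolding uniformly_continuous_on_def by (simp add: dist_real_def)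
    qed
    then obtain d where d: "\<And>b. b \<in> Basis \<Longrightarrow> d b > 0"
      "\<And>b a a'. \<lbrakk>b \<in> Basis; a \<in> A; a' \<in> A; dist a' a < d b\<rbrakk> \<Longrightarrow> \<bar>g' a' b - g' a b\<bar> < e' / DIM('a)"
      by metis
    \<comment> \<open>Below \<rho> the translates stay in the compact set \<open>A\<close>; below
      each \<open>d b\<close> the partial derivative in direction b oscillates by less than its
      share of \<open>e'\<close>.\<close>
    define D where "D = min \<rho> (Min (d ` Basis))"
    have D: "D > 0" "D \<le> \<rho>" "\<And>b. b \<in> Basis \<Longrightarrow> D \<le> d b"
      using d(1) A(1) by (auto simp: D_def min.coboundedI2)
    have on: "onorm (g' a' - g' a) \<le> e'" if "a \<in> A" "a' \<in> A" "dist a' a < D" for a a'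
    proof -
      have "onorm (g' a' - g' a) \<le> (\<Sum>b\<in>Basis. \<bar>(g' a' - g' a) b\<bar>)"
        using lin A that unfolding fun_diff_def
        by (intro onorm_le_sum_Basis linear_compose_sub) auto
      also have "\<dots> \<le> (\<Sum>b\<in>(Basis::'a set). e' / DIM('a))"
        using d(2) that D by (intro sum_mono) (force simp: less_imp_le)
      finally show ?thesis by simp
    qed
    show "\<exists>d>0. \<forall>y. norm (y - x) < d \<longrightarrow>
        norm ((\<integral>s. g (y - \<tau> s) *\<^sub>R w s \<partial>M) - (\<integral>s. g (x - \<tau> s) *\<^sub>R w s \<partial>M) -
           (\<integral>s. g' (x - \<tau> s) (y - x) *\<^sub>R w s \<partial>M)) \<le> e * norm (y - x)"
    proof (intro exI[of _ D] conjI allI impI D(1))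
      fix y assume y: "norm (y - x) < D"
      have yU: "y \<in> U" using y D A by (auto simp: dist_norm norm_minus_commute)
      have *: "(\<integral>s. g (y - \<tau> s) *\<^sub>R w s \<partial>M) - (\<integral>s. g (x - \<tau> s) *\<^sub>R w s \<partial>M) -
           (\<integral>s. g' (x - \<tau> s) (y - x) *\<^sub>R w s \<partial>M) =
         (\<integral>s. (g (y - \<tau> s) - g (x - \<tau> s) - g' (x - \<tau> s) (y - x)) *\<^sub>R w s \<partial>M)"
        using int[OF yU] int[OF x] int'[OF x] by (simp add: scaleR_diff_left)
      have "norm (\<integral>s. (g (y - \<tau> s) - g (x - \<tau> s) - g' (x - \<tau> s) (y - x)) *\<^sub>R w s \<partial>M)
          \<le> (norm (y - x) * e') * (\<integral>s. norm (w s) \<partial>M)"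
      proof (rule norm_integral_scaleR_le[OF w])
        show "integrable M (\<lambda>s. (g (y - \<tau> s) - g (x - \<tau> s) - g' (x - \<tau> s) (y - x)) *\<^sub>R w s)"
          using int[OF yU] int[OF x] int'[OF x] by (simp add: scaleR_diff_left)
        fix s assume s: "s \<in> space M"
        define S where "S = (\<lambda>z. z - \<tau> s) ` ball x D"
        have SA: "S \<subseteq> A" using A(5) D T(2)[OF s] by (auto simp: S_def)
        have "norm (g (y - \<tau> s) - g (x - \<tau> s) - g' (x - \<tau> s) ((y - \<tau> s) - (x - \<tau> s)))
          \<le> norm ((y - \<tau> s) - (x - \<tau> s)) * e'"
        proof (rule differentiable_bound_linearization[where S=S])
          fix t :: real assume t: "t \<in> {0..1}"
          have "x + t *\<^sub>R (y - x) \<in> ball x D"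
          proof -
            have "norm (t *\<^sub>R (y - x)) \<le> norm (y - x)" using t by (simp add: mult_left_le_one_le)
            then show ?thesis using y by (simp add: dist_norm)
          qed
          then show "x - \<tau> s + t *\<^sub>R (y - \<tau> s - (x - \<tau> s)) \<in> S"
            by (auto simp: S_def image_iff intro!: bexI[of _ "x + t *\<^sub>R (y - x)"])
        next
          fix a assume "a \<in> S"
          then show "(g has_derivative g' a) (at a within S)"
            using g' SA A(4) by (blast intro: has_derivative_at_withinI)
        next
          fix a assume a: "a \<in> S"
          have xs: "x - \<tau> s \<in> A" using A(1,5) T(2)[OF s] by simp
          from a SA show "onorm (g' a - g' (x - \<tau> s)) \<le> e'"
            by (intro on xs) (auto simp: S_def dist_norm norm_minus_commute)
        next
          show "x - \<tau> s \<in> S" using D by (auto simp: S_def)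
        qed
        then show "\<bar>g (y - \<tau> s) - g (x - \<tau> s) - g' (x - \<tau> s) (y - x)\<bar> \<le> norm (y - x) * e'"
          by simp
      qed
      also have "\<dots> = norm (y - x) * (e' * N)" by (simp add: N_def)
      also have "\<dots> \<le> norm (y - x) * e" using e' by (intro mult_left_mono) auto
      finally show "norm ((\<integral>s. g (y - \<tau> s) *\<^sub>R w s \<partial>M) - (\<integral>s. g (x - \<tau> s) *\<^sub>R w s \<partial>M) -
           (\<integral>s. g' (x - \<tau> s) (y - x) *\<^sub>R w s \<partial>M)) \<le> e * norm (y - x)"
        unfolding * by (simp add: mult.commute)
    qed
  qed
  then show ?thesis unfolding g'_def .
qed

text \<open>Differentiation only replaces the kernel g by one of its partial derivatives, so the
  integral inherits the order of smoothness of g.\<close>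

lemma Ck_on_integral_translate:
  fixes g :: "'a::euclidean_space \<Rightarrow> real" and w :: "'s \<Rightarrow> 'b::euclidean_space"
  assumes w: "integrable M w" and \<tau>: "\<tau> \<in> borel_measurable M"
    and T: "compact T" "\<And>s. s \<in> space M \<Longrightarrow> \<tau> s \<in> T"
    and U: "open U" and UT: "\<And>x t. x \<in> U \<Longrightarrow> t \<in> T \<Longrightarrow> x - t \<in> W"
    and g: "Ck_on k W g"
  shows "Ck_on k U (\<lambda>x. \<integral>s. g (x - \<tau> s) *\<^sub>R w s \<partial>M)"
  using g
proof (induction k arbitrary: g)
  case 0
  then show ?case
    using continuous_on_integral_translate[OF w \<tau> T U UT] by simp
next
  case (Suc k)
  have g1: "Ck_on (Suc 0) W g"
    using Suc.prems by (auto intro: Ck_on_imp_continuous_on)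
  show ?case
  proof (rule Ck_on_SucI[OF U, where
        f'="\<lambda>x h. \<integral>s. frechet_derivative g (at (x - \<tau> s)) h *\<^sub>R w s \<partial>M"])
    show "((\<lambda>x. \<integral>s. g (x - \<tau> s) *\<^sub>R w s \<partial>M) has_derivative
      (\<lambda>h. \<integral>s. frechet_derivative g (at (x - \<tau> s)) h *\<^sub>R w s \<partial>M)) (at x)" if "x \<in> U" for x
      by (rule has_derivative_integral_translate[OF w \<tau> T U UT g1 that])
    show "Ck_on k U (\<lambda>x. \<integral>s. frechet_derivative g (at (x - \<tau> s)) b *\<^sub>R w s \<partial>M)"
      if "b \<in> Basis" for b
      using Suc.IH[of "\<lambda>a. frechet_derivative g (at a) b"] Suc.prems that by simp
  qed
qed

subsection \<open>Square integrable fields\<close>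

lemma L2_spaceD:
  assumes "f \<in> L2_space \<Omega>"
  shows "f \<in> borel_measurable (lebesgue_on \<Omega>)" "integrable (lebesgue_on \<Omega>) (\<lambda>x. (norm (f x))\<^sup>2)"
  using assms by (auto simp: L2_space_def)

lemma L2_norm_nonneg: "L2_norm \<Omega> f \<ge> 0"
  by (simp add: L2_norm_def)

lemma L2_norm_power2: "(L2_norm \<Omega> f)\<^sup>2 = (\<integral>x. (norm (f x))\<^sup>2 \<partial>lebesgue_on \<Omega>)"
  by (simp add: L2_norm_def)

lemma L2_norm_cong_AE:
  assumes "f \<in> L2_space \<Omega>" "g \<in> L2_space \<Omega>" "AE x in lebesgue_on \<Omega>. f x = g x"
  shows "L2_norm \<Omega> f = L2_norm \<Omega> g"
  unfolding L2_norm_def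
  using assms(3) L2_spaceD[OF assms(1)] L2_spaceD[OF assms(2)]
  by (intro arg_cong[of _ _ sqrt] integral_cong_AE) auto

lemma L2_norm_le:
  assumes "f \<in> borel_measurable (lebesgue_on \<Omega>)" "g \<in> L2_space \<Omega>" "c \<ge> 0"
    and "AE x in lebesgue_on \<Omega>. norm (f x) \<le> c * norm (g x)"
  shows "f \<in> L2_space \<Omega>" "L2_norm \<Omega> f \<le> c * L2_norm \<Omega> g"
proof -
  have le: "AE x in lebesgue_on \<Omega>. (norm (f x))\<^sup>2 \<le> c\<^sup>2 * (norm (g x))\<^sup>2"
    using assms(4)
  proof eventually_elim
    case (elim x)
    then have "(norm (f x))\<^sup>2 \<le> (c * norm (g x))\<^sup>2" by (intro power_mono) auto
    then show ?case by (simp add: power_mult_distrib)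
  qed
  have int: "integrable (lebesgue_on \<Omega>) (\<lambda>x. (norm (f x))\<^sup>2)"
    by (rule Bochner_Integration.integrable_bound[where f="\<lambda>x. c\<^sup>2 * (norm (g x))\<^sup>2"])
      (use assms(1) L2_spaceD[OF assms(2)] le in auto)
  then show "f \<in> L2_space \<Omega>" using assms(1) by (simp add: L2_space_def)
  have "(\<integral>x. (norm (f x))\<^sup>2 \<partial>lebesgue_on \<Omega>) \<le> (\<integral>x. c\<^sup>2 * (norm (g x))\<^sup>2 \<partial>lebesgue_on \<Omega>)"
    using le int L2_spaceD[OF assms(2)] by (intro integral_mono_AE) auto
  then have "(\<integral>x. (norm (f x))\<^sup>2 \<partial>lebesgue_on \<Omega>) \<le> (c * L2_norm \<Omega> g)\<^sup>2"
    by (simp add: power_mult_distrib L2_norm_power2)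
  then show "L2_norm \<Omega> f \<le> c * L2_norm \<Omega> g"
    unfolding L2_norm_def[of \<Omega> f] by (rule real_le_lsqrt[rotated]) (intro mult_nonneg_nonneg assms L2_norm_nonneg)
qed

lemma integrable_norm_mult_L2:
  fixes f :: "real^'n \<Rightarrow> 'b::euclidean_space" and g :: "real^'n \<Rightarrow> 'c::euclidean_space"
  assumes "f \<in> L2_space \<Omega>" "g \<in> L2_space \<Omega>"
  shows "integrable (lebesgue_on \<Omega>) (\<lambda>x. norm (f x) * norm (g x))"
proof -
  note f = L2_spaceD[OF assms(1)] and g = L2_spaceD[OF assms(2)]
  have *: "norm (f x) * norm (g x) \<le> (norm (f x))\<^sup>2 + (norm (g x))\<^sup>2" for x
    using sum_squares_bound[of "norm (f x)" "norm (g x)"] mult_nonneg_nonneg[of "norm (f x)" "norm (g x)"]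
      norm_ge_zero[of "f x"] norm_ge_zero[of "g x"] by linarith
  show ?thesis
    by (rule Bochner_Integration.integrable_bound[where f="\<lambda>x. (norm (f x))\<^sup>2 + (norm (g x))\<^sup>2"])
      (use f g * in \<open>auto simp: abs_mult\<close>)
qed

lemma integrable_inner_L2:
  assumes "f \<in> L2_space \<Omega>" "g \<in> L2_space \<Omega>"
  shows "integrable (lebesgue_on \<Omega>) (\<lambda>x. f x \<bullet> g x)"
  by (rule Bochner_Integration.integrable_bound[OF integrable_norm_mult_L2[OF assms]])
    (use L2_spaceD[OF assms(1)] L2_spaceD[OF assms(2)] in \<open>auto simp: abs_mult Cauchy_Schwarz_ineq2\<close>)

lemma integrable_mult_L2:
  fixes f g :: "real^'n \<Rightarrow> real"
  assumes "f \<in> L2_space \<Omega>" "g \<in> L2_space \<Omega>"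
  shows "integrable (lebesgue_on \<Omega>) (\<lambda>x. f x * g x)"
  using integrable_inner_L2[OF assms] by simp

text \<open>The integral of (|f| + t |g|)^2 is a nonnegative quadratic polynomial in t, so its
  discriminant is not positive.\<close>

lemma L2_Cauchy_Schwarz_norm:
  assumes "f \<in> L2_space \<Omega>" "g \<in> L2_space \<Omega>"
  shows "(\<integral>x. norm (f x) * norm (g x) \<partial>lebesgue_on \<Omega>) \<le> L2_norm \<Omega> f * L2_norm \<Omega> g"
proof -
  note f = L2_spaceD[OF assms(1)] and g = L2_spaceD[OF assms(2)]
  define A B C where "A = (L2_norm \<Omega> f)\<^sup>2" and "B = (\<integral>x. norm (f x) * norm (g x) \<partial>lebesgue_on \<Omega>)"
    and "C = (L2_norm \<Omega> g)\<^sup>2"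
  have q: "0 \<le> A + 2 * t * B + t\<^sup>2 * C" for t
  proof -
    have "0 \<le> (\<integral>x. (norm (f x) + t * norm (g x))\<^sup>2 \<partial>lebesgue_on \<Omega>)" by simp
    also have "\<dots> = (\<integral>x. (norm (f x))\<^sup>2 + (2 * t) * (norm (f x) * norm (g x)) + t\<^sup>2 * (norm (g x))\<^sup>2 \<partial>lebesgue_on \<Omega>)"
      by (rule Bochner_Integration.integral_cong) (auto simp: power2_eq_square algebra_simps)
    also have "\<dots> = A + 2 * t * B + t\<^sup>2 * C"
      using f g integrable_norm_mult_L2[OF assms] by (simp add: A_def B_def C_def L2_norm_power2)
    finally show ?thesis .
  qed
  have "B\<^sup>2 \<le> A * C"
  \<comment> \<open>For C = 0 the polynomial is affine and nonnegative, which forces B = 0: the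
    chosen t would give it the value -1. Otherwise t = -B/C is its minimiser.\<close>
  proof (cases "C = 0")
    case True
    have "B = 0"
    proof (rule ccontr)
      assume "B \<noteq> 0"
      have "A \<ge> 0" by (simp add: A_def)
      with q[of "- (A + 1) / (2 * B)"] True \<open>B \<noteq> 0\<close> show False by (simp add: field_simps)
    qed
    then show ?thesis using True by simp
  next
    case False
    then have "C > 0" by (simp add: C_def)
    have "0 \<le> (A + 2 * (- B / C) * B + (- B / C)\<^sup>2 * C) * C"
      using q[of "- B / C"] \<open>C > 0\<close> by (intro mult_nonneg_nonneg) auto
    also have "\<dots> = A * C - B\<^sup>2" using False by (simp add: field_simps power2_eq_square)
    finally show ?thesis by simp
  qed
  then have "B\<^sup>2 \<le> (L2_norm \<Omega> f * L2_norm \<Omega> g)\<^sup>2" by (simp add: A_def C_def power_mult_distrib)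
  then show ?thesis unfolding B_def[symmetric]
    using L2_norm_nonneg by (metis abs_le_square_iff abs_of_nonneg abs_le_D1 mult_nonneg_nonneg)
qed

lemma L2_Cauchy_Schwarz:
  assumes "f \<in> L2_space \<Omega>" "g \<in> L2_space \<Omega>"
  shows "\<bar>\<integral>x. f x \<bullet> g x \<partial>lebesgue_on \<Omega>\<bar> \<le> L2_norm \<Omega> f * L2_norm \<Omega> g"
proof -
  have "\<bar>\<integral>x. f x \<bullet> g x \<partial>lebesgue_on \<Omega>\<bar> \<le> (\<integral>x. \<bar>f x \<bullet> g x\<bar> \<partial>lebesgue_on \<Omega>)"
    using integral_norm_bound[of "lebesgue_on \<Omega>" "\<lambda>x. f x \<bullet> g x"] by simp
  also have "\<dots> \<le> (\<integral>x. norm (f x) * norm (g x) \<partial>lebesgue_on \<Omega>)"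
    by (rule integral_mono) (use integrable_norm_mult_L2[OF assms] integrable_inner_L2[OF assms] in \<open>auto simp: Cauchy_Schwarz_ineq2\<close>)
  finally show ?thesis using L2_Cauchy_Schwarz_norm[OF assms] by simp
qed

lemma L2_add:
  assumes "f \<in> L2_space \<Omega>" "g \<in> L2_space \<Omega>"
  shows "(\<lambda>x. f x + g x) \<in> L2_space \<Omega>" "L2_norm \<Omega> (\<lambda>x. f x + g x) \<le> L2_norm \<Omega> f + L2_norm \<Omega> g"
proof -
  note f = L2_spaceD[OF assms(1)] and g = L2_spaceD[OF assms(2)]
  have int: "integrable (lebesgue_on \<Omega>) (\<lambda>x. (norm (f x + g x))\<^sup>2)"
  proof (rule Bochner_Integration.integrable_bound[where f="\<lambda>x. 2 * (norm (f x))\<^sup>2 + 2 * (norm (g x))\<^sup>2"])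
    have "(norm (f x + g x))\<^sup>2 \<le> 2 * (norm (f x))\<^sup>2 + 2 * (norm (g x))\<^sup>2" for x
    proof -
      have "(norm (f x + g x))\<^sup>2 \<le> (norm (f x) + norm (g x))\<^sup>2"
        by (intro power_mono norm_triangle_ineq) auto
      then show ?thesis using sum_squares_bound[of "norm (f x)" "norm (g x)"] by (simp add: power2_sum)
    qed
    then show "AE x in lebesgue_on \<Omega>. norm ((norm (f x + g x))\<^sup>2) \<le> norm (2 * (norm (f x))\<^sup>2 + 2 * (norm (g x))\<^sup>2)"
      by auto
  qed (use f g in auto)
  then show "(\<lambda>x. f x + g x) \<in> L2_space \<Omega>" using f g by (simp add: L2_space_def)
  have "(\<integral>x. (norm (f x + g x))\<^sup>2 \<partial>lebesgue_on \<Omega>) \<le>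
      (\<integral>x. (norm (f x))\<^sup>2 + 2 * (norm (f x) * norm (g x)) + (norm (g x))\<^sup>2 \<partial>lebesgue_on \<Omega>)"
  proof (rule integral_mono[OF int])
    show "(norm (f x + g x))\<^sup>2 \<le> (norm (f x))\<^sup>2 + 2 * (norm (f x) * norm (g x)) + (norm (g x))\<^sup>2" for x
    proof -
      have "(norm (f x + g x))\<^sup>2 \<le> (norm (f x) + norm (g x))\<^sup>2"
        by (intro power_mono norm_triangle_ineq) auto
      then show ?thesis by (simp add: power2_sum)
    qed
  qed (use f g integrable_norm_mult_L2[OF assms] in auto)
  also have "\<dots> = (L2_norm \<Omega> f)\<^sup>2 + 2 * (\<integral>x. norm (f x) * norm (g x) \<partial>lebesgue_on \<Omega>) + (L2_norm \<Omega> g)\<^sup>2"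
    using f g integrable_norm_mult_L2[OF assms] by (simp add: L2_norm_power2)
  also have "\<dots> \<le> (L2_norm \<Omega> f + L2_norm \<Omega> g)\<^sup>2"
    using L2_Cauchy_Schwarz_norm[OF assms] by (simp add: power2_sum)
  finally show "L2_norm \<Omega> (\<lambda>x. f x + g x) \<le> L2_norm \<Omega> f + L2_norm \<Omega> g"
    unfolding L2_norm_def[of \<Omega> "\<lambda>x. f x + g x"] by (rule real_le_lsqrt[rotated]) (simp add: L2_norm_nonneg)
qed

lemma L2_bounded_linear:
  assumes "f \<in> L2_space \<Omega>" "bounded_linear L"
  shows "(\<lambda>x. L (f x)) \<in> L2_space \<Omega>" "L2_norm \<Omega> (\<lambda>x. L (f x)) \<le> onorm L * L2_norm \<Omega> f"
proof -
  have "L \<in> borel_measurable borel"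
    using assms(2) by (intro borel_measurable_continuous_onI linear_continuous_on)
  then have m: "(\<lambda>x. L (f x)) \<in> borel_measurable (lebesgue_on \<Omega>)"
    using L2_spaceD(1)[OF assms(1)] by auto
  note * = L2_norm_le[OF m assms(1) onorm_pos_le[OF assms(2)] AE_I2[OF onorm[OF assms(2)]]]
  show "(\<lambda>x. L (f x)) \<in> L2_space \<Omega>" "L2_norm \<Omega> (\<lambda>x. L (f x)) \<le> onorm L * L2_norm \<Omega> f"
    using * by auto
qed

lemma L2_diff:
  assumes "f \<in> L2_space \<Omega>" "g \<in> L2_space \<Omega>"
  shows "(\<lambda>x. f x - g x) \<in> L2_space \<Omega>" "L2_norm \<Omega> (\<lambda>x. f x - g x) \<le> L2_norm \<Omega> f + L2_norm \<Omega> g"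
proof -
  have m: "(\<lambda>x. - g x) \<in> L2_space \<Omega>" "L2_norm \<Omega> (\<lambda>x. - g x) = L2_norm \<Omega> g"
    using assms(2) by (auto simp: L2_space_def L2_norm_def)
  show "(\<lambda>x. f x - g x) \<in> L2_space \<Omega>" "L2_norm \<Omega> (\<lambda>x. f x - g x) \<le> L2_norm \<Omega> f + L2_norm \<Omega> g"
    using L2_add[OF assms(1) m(1)] m(2) by auto
qed

lemma L2_norm_diff_commute: "L2_norm \<Omega> (\<lambda>x. f x - g x) = L2_norm \<Omega> (\<lambda>x. g x - f x)"
  by (simp add: L2_norm_def norm_minus_commute)

lemma L2_bounded:
  assumes "f \<in> borel_measurable (lebesgue_on \<Omega>)" "\<Omega> \<in> lmeasurable" "B \<ge> 0"
    and "\<And>x. x \<in> \<Omega> \<Longrightarrow> norm (f x) \<le> B"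
  shows "f \<in> L2_space \<Omega>" "L2_norm \<Omega> f \<le> B * sqrt (measure lebesgue \<Omega>)"
proof -
  interpret finite_measure "lebesgue_on \<Omega>" by (rule finite_measure_lebesgue_on[OF assms(2)])
  have 1: "(\<lambda>x. 1::real) \<in> L2_space \<Omega>" by (simp add: L2_space_def)
  have "AE x in lebesgue_on \<Omega>. norm (f x) \<le> B * norm (1::real)"
    using assms(4) by (intro AE_I2) auto
  note * = L2_norm_le[OF assms(1) 1 assms(3) this]
  have "measure (lebesgue_on \<Omega>) \<Omega> = measure lebesgue \<Omega>"
    using assms(2) by (intro measure_restrict_space) auto
  then have "L2_norm \<Omega> (\<lambda>x. 1::real) = sqrt (measure lebesgue \<Omega>)"
    by (simp add: L2_norm_def)
  then show "f \<in> L2_space \<Omega>" "L2_norm \<Omega> f \<le> B * sqrt (measure lebesgue \<Omega>)" using * by auto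
qed

lemma L2_norm_0_imp_AE:
  assumes "f \<in> L2_space \<Omega>" "L2_norm \<Omega> f = 0"
  shows "AE x in lebesgue_on \<Omega>. f x = 0"
proof -
  have "(\<integral>x. (norm (f x))\<^sup>2 \<partial>lebesgue_on \<Omega>) = 0"
    using assms(2) L2_norm_power2[of \<Omega> f] by simp
  then have "AE x in lebesgue_on \<Omega>. (norm (f x))\<^sup>2 = 0"
    using L2_spaceD[OF assms(1)] by (subst (asm) integral_nonneg_eq_0_iff_AE) auto
  then show ?thesis by auto
qed

lemma L2_imp_integrable:
  assumes "f \<in> L2_space \<Omega>" "\<Omega> \<in> lmeasurable"
  shows "integrable (lebesgue_on \<Omega>) f"
proof -
  have "(\<lambda>x. 1::real) \<in> L2_space \<Omega>"
    by (rule L2_bounded(1)[of _ _ 1]) (use assms in auto)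
  from integrable_norm_mult_L2[OF this assms(1)] have "integrable (lebesgue_on \<Omega>) (\<lambda>x. norm (f x))"
    by simp
  then show ?thesis using L2_spaceD(1)[OF assms(1)] integrable_norm_iff by blast
qed

lemma L2_norm_tendsto_0:
  assumes "\<And>k. f k \<in> borel_measurable (lebesgue_on \<Omega>)" "g \<in> L2_space \<Omega>"
    and bound: "\<And>k. AE x in lebesgue_on \<Omega>. norm (f k x) \<le> norm (g x)"
    and lim: "AE x in lebesgue_on \<Omega>. (\<lambda>k. f k x) \<longlonglongrightarrow> 0"
  shows "(\<lambda>k. L2_norm \<Omega> (f k)) \<longlonglongrightarrow> 0"
proof -
  have "(\<lambda>k. \<integral>x. (norm (f k x))\<^sup>2 \<partial>lebesgue_on \<Omega>) \<longlonglongrightarrow> (\<integral>x. 0 \<partial>lebesgue_on \<Omega>)"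
  proof (rule integral_dominated_convergence[where w="\<lambda>x. (norm (g x))\<^sup>2"])
    show "AE x in lebesgue_on \<Omega>. (\<lambda>k. (norm (f k x))\<^sup>2) \<longlonglongrightarrow> 0"
      using lim
    proof eventually_elim
      case (elim x)
      from tendsto_power[OF tendsto_norm_zero[OF elim], of 2] show ?case by simp
    qed
    show "AE x in lebesgue_on \<Omega>. norm ((norm (f k x))\<^sup>2) \<le> (norm (g x))\<^sup>2" for k
      using bound[of k] by eventually_elim (auto intro: power_mono)
  qed (use assms L2_spaceD[OF assms(2)] in auto)
  then have "(\<lambda>k. sqrt (\<integral>x. (norm (f k x))\<^sup>2 \<partial>lebesgue_on \<Omega>)) \<longlonglongrightarrow> sqrt 0"
    by (intro tendsto_real_sqrt) simp
  then show ?thesis by (simp add: L2_norm_def)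
qed

text \<open>Truncation makes f bounded at small cost in L2. A measurable function is an almost
  everywhere limit of continuous ones, and truncating these as well provides the constant for
  dominated convergence.\<close>

lemma continuous_bounded_dense_L2:
  fixes f :: "real^'n \<Rightarrow> 'b::euclidean_space"
  assumes f: "f \<in> L2_space \<Omega>" and \<Omega>: "\<Omega> \<in> lmeasurable" and e: "e > 0"
  obtains g B where "continuous_on UNIV g" "\<And>x. norm (g x) \<le> B"
    "g \<in> L2_space \<Omega>" "L2_norm \<Omega> (\<lambda>x. f x - g x) < e"
proof -
  note fm = L2_spaceD(1)[OF f]
  \<comment> \<open>The metric projection onto the ball of radius N serves as truncation: it is
    continuous, fixes values in the ball and moves v by at most the norm of v.\<close>
  define c where "c N = closest_point (cball (0::'b) N)" for N :: real
  have c_cont: "continuous_on UNIV (c N)" if "N \<ge> 0" for N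
    unfolding c_def using that by (intro continuous_on_closest_point) auto
  have c_norm: "norm (c N v) \<le> N" if "N \<ge> 0" for N v
    using closest_point_in_set[of "cball (0::'b) N" v] that by (auto simp: c_def)
  have c_self: "c N v = v" if "norm v \<le> N" for N v
    unfolding c_def using that by (intro closest_point_self) auto
  have c_dist: "norm (v - c N v) \<le> norm v" if "N \<ge> 0" for N v
    using closest_point_le[of "cball (0::'b) N" 0 v] that by (simp add: c_def dist_norm)
  have cm: "c N \<in> borel_measurable borel" if "N \<ge> 0" for N
    using c_cont[OF that] by (rule borel_measurable_continuous_onI)
  have cfm: "(\<lambda>x. c (real N) (f x)) \<in> borel_measurable (lebesgue_on \<Omega>)" for N :: nat
    using measurable_compose[OF fm cm[of "real N"]] by simp
  have "(\<lambda>N. L2_norm \<Omega> (\<lambda>x. f x - c (real N) (f x))) \<longlonglongrightarrow> 0"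
  proof (rule L2_norm_tendsto_0[OF _ f])
    show "(\<lambda>x. f x - c (real k) (f x)) \<in> borel_measurable (lebesgue_on \<Omega>)" for k
      using fm cfm by auto
    show "AE x in lebesgue_on \<Omega>. norm (f x - c (real k) (f x)) \<le> norm (f x)" for k
      using c_dist by auto
    have "(\<lambda>k. f x - c (real k) (f x)) \<longlonglongrightarrow> 0" for x
    proof (rule Lim_transform_eventually[OF tendsto_const])
      obtain k0 where "norm (f x) \<le> real k0" using real_arch_simple by blast
      then show "\<forall>\<^sub>F k in sequentially. 0 = f x - c (real k) (f x)"
        by (intro eventually_sequentiallyI[of k0]) (auto simp: c_self)
    qed
    then show "AE x in lebesgue_on \<Omega>. (\<lambda>k. f x - c (real k) (f x)) \<longlonglongrightarrow> 0" by auto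
  qed
  from order_tendstoD(2)[OF this, of "e/2"] e obtain N :: nat
    where N: "L2_norm \<Omega> (\<lambda>x. f x - c (real N) (f x)) < e / 2"
    by (auto simp: eventually_sequentially)
  have "\<Omega> \<in> sets lebesgue" using \<Omega> by auto
  \<comment> \<open>The continuous functions approximate f extended by zero off the null set
    \<open>Z\<close>; on \<Omega> their limit is f.\<close>
  with fm obtain Z g where Z: "negligible Z" and g: "\<And>n. continuous_on UNIV (g n)"
    and lim: "\<And>x. x \<notin> Z \<Longrightarrow> (\<lambda>n. g n x) \<longlonglongrightarrow> (if x \<in> \<Omega> then f x else 0)"
    using measurable_on_iff_borel_measurable[of \<Omega> f] unfolding measurable_on_def by blast
  define G where "G n x = c (real N) (g n x)" for n :: nat and x
  have G: "continuous_on UNIV (G n)" "norm (G n x) \<le> real N" for n x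
    unfolding G_def using c_norm by (auto intro!: continuous_on_compose2[OF c_cont[of "real N"] g])
  have Gm: "G n \<in> borel_measurable (lebesgue_on \<Omega>)" for n
    using G(1)[of n] \<open>\<Omega> \<in> sets lebesgue\<close>
    by (intro continuous_imp_measurable_on_sets_lebesgue) (auto intro: continuous_on_subset)
  have GL: "G n \<in> L2_space \<Omega>" for n
    by (rule L2_bounded(1)[OF Gm \<Omega>, of "real N"]) (use G in auto)
  have cL: "(\<lambda>x. c (real N) (f x)) \<in> L2_space \<Omega>"
    by (rule L2_bounded(1)[OF cfm \<Omega>, of "real N"]) (use c_norm in auto)
  have constL: "(\<lambda>x. 2 * real N) \<in> L2_space \<Omega>"
    by (rule L2_bounded(1)[OF _ \<Omega>, of _ "2 * real N"]) auto
  have "(\<lambda>n. L2_norm \<Omega> (\<lambda>x. c (real N) (f x) - G n x)) \<longlonglongrightarrow> 0"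
  proof (rule L2_norm_tendsto_0[OF _ constL])
    show "(\<lambda>x. c (real N) (f x) - G k x) \<in> borel_measurable (lebesgue_on \<Omega>)" for k
      using cfm Gm by auto
    have "norm (c (real N) (f x) - G k x) \<le> norm (2 * real N)" for x k
      using norm_triangle_ineq4[of "c (real N) (f x)" "G k x"] G(2)[of k x] c_norm[of "real N" "f x"] by simp
    then show "AE x in lebesgue_on \<Omega>. norm (c (real N) (f x) - G k x) \<le> norm (2 * real N)" for k
      by auto
    have "AE x in lebesgue_on \<Omega>. x \<notin> Z"
      using Z \<open>\<Omega> \<in> sets lebesgue\<close>
      by (subst AE_restrict_space_iff) (auto simp: negligible_iff_null_sets intro: AE_mp[OF AE_not_in])
    moreover have "AE x in lebesgue_on \<Omega>. x \<in> \<Omega>"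
      by (intro AE_I2) auto
    ultimately show "AE x in lebesgue_on \<Omega>. (\<lambda>k. c (real N) (f x) - G k x) \<longlonglongrightarrow> 0"
    proof eventually_elim
      case (elim x)
      then have "(\<lambda>n. g n x) \<longlonglongrightarrow> f x" using lim[of x] by simp
      then have "(\<lambda>n. G n x) \<longlonglongrightarrow> c (real N) (f x)"
        unfolding G_def using c_cont[of "real N"]
        by (intro isCont_tendsto_compose[of _ "c (real N)"]) (auto simp: continuous_on_eq_continuous_at)
      from tendsto_diff[OF tendsto_const[of "c (real N) (f x)"] this] show ?case by simp
    qed
  qed
  from order_tendstoD(2)[OF this, of "e/2"] e obtain n
    where n: "L2_norm \<Omega> (\<lambda>x. c (real N) (f x) - G n x) < e / 2"
    by (auto simp: eventually_sequentially)
  have "L2_norm \<Omega> (\<lambda>x. (f x - c (real N) (f x)) + (c (real N) (f x) - G n x)) < e"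
    using L2_add(2)[OF L2_diff(1)[OF f cL] L2_diff(1)[OF cL GL[of n]]] N n by linarith
  then show ?thesis using G GL by (intro that[of "G n" "real N"]) auto
qed

subsection \<open>Mollification\<close>

text \<open>Normalised by its actual integral, so that total mass one holds for every \<epsilon> > 0
  without a change of variables.\<close>

definition mollifier :: "real \<Rightarrow> 'a::euclidean_space \<Rightarrow> real" where
  "mollifier \<epsilon> z = bump (inverse \<epsilon> *\<^sub>R z) / (integral\<^sup>L lborel (\<lambda>z::'a. bump (inverse \<epsilon> *\<^sub>R z)))"

lemma continuous_on_bump: "continuous_on S bump"
  using Ck_on_bump[of 0] by (auto intro: continuous_on_subset)

lemma bump_scaled_eq_0_iff: "\<epsilon> > 0 \<Longrightarrow> bump (inverse \<epsilon> *\<^sub>R z) = 0 \<longleftrightarrow> norm z \<ge> \<epsilon>"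
  by (simp add: bump_eq_0_iff field_simps)

lemma integrable_bump_scaled:
  assumes "\<epsilon> > 0"
  shows "integrable lborel (\<lambda>z::'a::euclidean_space. bump (inverse \<epsilon> *\<^sub>R z))"
proof -
  have "continuous_on (cball (0::'a) \<epsilon>) (\<lambda>z. bump (inverse \<epsilon> *\<^sub>R z))"
    by (rule continuous_on_compose2[OF continuous_on_bump[of UNIV]]) (auto intro!: continuous_intros)
  from borel_integrable_compact[OF compact_cball this]
  have "integrable lborel (\<lambda>z. indicator (cball (0::'a) \<epsilon>) z *\<^sub>R bump (inverse \<epsilon> *\<^sub>R z))" .
  moreover have "(\<lambda>z. indicator (cball (0::'a) \<epsilon>) z *\<^sub>R bump (inverse \<epsilon> *\<^sub>R z)) = (\<lambda>z. bump (inverse \<epsilon> *\<^sub>R z))"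
    using bump_scaled_eq_0_iff[OF assms] by (fastforce simp: indicator_def)
  ultimately show ?thesis by simp
qed

text \<open>If the integral vanished, the nonnegative bump would vanish almost everywhere and the
  closed complement of a ball around 0 would have full measure; a closed set of full measure is the
  whole space.\<close>

lemma integral_bump_scaled_pos:
  assumes "\<epsilon> > 0"
  shows "(integral\<^sup>L lborel (\<lambda>z::'a::euclidean_space. bump (inverse \<epsilon> *\<^sub>R z))) > 0"
proof (rule ccontr)
  let ?I = "integral\<^sup>L lborel (\<lambda>z::'a. bump (inverse \<epsilon> *\<^sub>R z))"
  assume "\<not> ?I > 0"
  moreover have "?I \<ge> 0" by (simp add: bump_nonneg)
  ultimately have "?I = 0" by simp
  then have "AE z::'a in lborel. bump (inverse \<epsilon> *\<^sub>R z) = 0"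
    using integrable_bump_scaled[OF assms] by (subst (asm) integral_nonneg_eq_0_iff_AE) (auto simp: bump_nonneg)
  then have "AE z::'a in lebesgue. z \<in> - ball 0 \<epsilon>"
    using bump_scaled_eq_0_iff[OF assms] by (intro AE_completion) (auto simp: not_less)
  then have "(0::'a) \<in> - ball 0 \<epsilon>" by (rule mem_closed_if_AE_lebesgue[rotated]) auto
  then show False using assms by simp
qed

lemma mollifier_nonneg: "mollifier \<epsilon> z \<ge> 0"
  by (simp add: mollifier_def bump_nonneg)

lemma mollifier_eq_0_iff: "\<epsilon> > 0 \<Longrightarrow> mollifier \<epsilon> z = 0 \<longleftrightarrow> norm z \<ge> \<epsilon>"
  using bump_scaled_eq_0_iff[of \<epsilon> z] integral_bump_scaled_pos[of \<epsilon>, where 'a='a]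
  by (simp add: mollifier_def)

lemma mollifier_minus_commute: "mollifier \<epsilon> (x - y) = mollifier \<epsilon> (y - x)"
proof -
  have "inverse \<epsilon> *\<^sub>R (y - x) = - (inverse \<epsilon> *\<^sub>R (x - y))" by (simp add: scaleR_diff_right)
  then show ?thesis unfolding mollifier_def bump_def by simp
qed

lemma Ck_on_mollifier: "Ck_on k UNIV (mollifier \<epsilon>)"
proof -
  have "Ck_on k UNIV (\<lambda>z::'a. bump (inverse \<epsilon> *\<^sub>R z + 0))"
    by (rule Ck_on_affine_compose[OF _ _ Ck_on_bump]) auto
  from Ck_on_bounded_linear_compose[OF _ bounded_linear_divide this] show ?thesis
    unfolding mollifier_def[abs_def] by simp
qed

lemma continuous_on_mollifier: "continuous_on S (mollifier \<epsilon>)"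
  using Ck_on_mollifier[of 0] by (auto intro: continuous_on_subset)

lemma borel_measurable_mollifier [measurable]: "mollifier \<epsilon> \<in> borel_measurable borel"
  by (rule borel_measurable_continuous_onI[OF continuous_on_mollifier])

lemma mollifier_integral:
  assumes "\<epsilon> > 0"
  shows "integrable lborel (mollifier \<epsilon> :: 'a::euclidean_space \<Rightarrow> real)" "integral\<^sup>L lborel (mollifier \<epsilon> :: 'a \<Rightarrow> real) = 1"
  using integrable_bump_scaled[OF assms, where 'a='a] integral_bump_scaled_pos[OF assms, where 'a='a]
  unfolding mollifier_def[abs_def] by auto

lemma nn_integral_mollifier_translate:
  fixes y :: "'a::euclidean_space"
  assumes "\<epsilon> > 0"
  shows "(\<integral>\<^sup>+x. ennreal (mollifier \<epsilon> (x - y)) \<partial>lborel) = 1"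
proof -
  have "(\<integral>\<^sup>+x. ennreal (mollifier \<epsilon> (x - y)) \<partial>lborel)
      = (\<integral>\<^sup>+x. ennreal (mollifier \<epsilon> (x - y)) \<partial>distr lborel borel ((+) y))"
    by (simp add: lborel_distr_plus)
  also have "\<dots> = nn_integral lborel (\<lambda>x::'a. ennreal (mollifier \<epsilon> x))"
    by (subst nn_integral_distr) auto
  also have "\<dots> = ennreal (integral\<^sup>L lborel (mollifier \<epsilon> :: 'a \<Rightarrow> real))"
    using mollifier_integral(1)[OF assms] by (intro nn_integral_eq_integral) (auto simp: mollifier_nonneg)
  finally show ?thesis using mollifier_integral(2)[OF assms, where 'a='a] by simp
qed

lemma mollifier_translate_lebesgue:
  assumes "\<epsilon> > 0"
  shows "integrable lebesgue (\<lambda>y. mollifier \<epsilon> (x - y))" "(\<integral>y. mollifier \<epsilon> (x - y) \<partial>lebesgue) = 1"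
proof -
  have m: "(\<lambda>y. mollifier \<epsilon> (x - y)) \<in> borel_measurable lborel" by measurable
  have nn: "(\<integral>\<^sup>+y. ennreal (mollifier \<epsilon> (x - y)) \<partial>lborel) = 1"
    using nn_integral_mollifier_translate[OF assms, of x] by (simp add: mollifier_minus_commute)
  have "integrable lborel (\<lambda>y. mollifier \<epsilon> (x - y))"
    using m nn by (intro integrableI_bounded) (auto simp: mollifier_nonneg)
  moreover from nn have "(\<integral>y. mollifier \<epsilon> (x - y) \<partial>lborel) = 1"
    by (subst integral_eq_nn_integral) (auto simp: mollifier_nonneg)
  ultimately show "integrable lebesgue (\<lambda>y. mollifier \<epsilon> (x - y))"
    "(\<integral>y. mollifier \<epsilon> (x - y) \<partial>lebesgue) = 1"
    using m by (auto simp: integral_completion integrable_completion)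
qed

lemma mollifier_integral_on:
  assumes "\<epsilon> > 0" and \<Omega>: "\<Omega> \<in> sets lebesgue"
  shows "integrable (lebesgue_on \<Omega>) (\<lambda>y. mollifier \<epsilon> (x - y))"
    "(\<integral>y. mollifier \<epsilon> (x - y) \<partial>lebesgue_on \<Omega>) \<le> 1"
    "ball x \<epsilon> \<subseteq> \<Omega> \<Longrightarrow> (\<integral>y. mollifier \<epsilon> (x - y) \<partial>lebesgue_on \<Omega>) = 1"
proof -
  note m = mollifier_translate_lebesgue[OF assms(1), of x]
  show "integrable (lebesgue_on \<Omega>) (\<lambda>y. mollifier \<epsilon> (x - y))"
    using integrable_mult_indicator[OF \<Omega> m(1)] \<Omega> by (subst integrable_restrict_space) auto
  have eq: "(\<integral>y. mollifier \<epsilon> (x - y) \<partial>lebesgue_on \<Omega>) = (\<integral>y. indicator \<Omega> y *\<^sub>R mollifier \<epsilon> (x - y) \<partial>lebesgue)"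
    using \<Omega> by (intro integral_restrict_space) auto
  also have "\<dots> \<le> (\<integral>y. mollifier \<epsilon> (x - y) \<partial>lebesgue)"
    using m(1) \<Omega>
    by (intro integral_mono integrable_mult_indicator) (auto simp: indicator_def mollifier_nonneg)
  finally show "(\<integral>y. mollifier \<epsilon> (x - y) \<partial>lebesgue_on \<Omega>) \<le> 1" using m by simp
  show "(\<integral>y. mollifier \<epsilon> (x - y) \<partial>lebesgue_on \<Omega>) = 1" if b: "ball x \<epsilon> \<subseteq> \<Omega>"
  proof -
    have "(\<lambda>y. indicator \<Omega> y *\<^sub>R mollifier \<epsilon> (x - y)) = (\<lambda>y. mollifier \<epsilon> (x - y))"
      using b mollifier_eq_0_iff[OF assms(1)] by (fastforce simp: indicator_def dist_norm)
    then show ?thesis using eq m by simp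
  qed
qed

text \<open>Convolution with f extended by zero. Near the boundary part of the mass of the kernel
  may fall outside \<Omega>: bounds hold everywhere, but constants are reproduced only where the
  ball of radius \<epsilon> fits into \<Omega>.\<close>

definition mollify :: "(real^'n) set \<Rightarrow> real \<Rightarrow> (real^'n \<Rightarrow> 'b::euclidean_space) \<Rightarrow> real^'n \<Rightarrow> 'b" where
  "mollify \<Omega> \<epsilon> f x = (\<integral>y. mollifier \<epsilon> (x - y) *\<^sub>R f y \<partial>lebesgue_on \<Omega>)"

context
  fixes \<Omega> :: "(real^'n) set"
  assumes \<Omega>: "open \<Omega>" "bounded \<Omega>"
begin

lemma open_bounded_measurable: "\<Omega> \<in> sets lebesgue" "\<Omega> \<in> lmeasurable"
  using \<Omega> lmeasurable_open by blast+

lemma integrable_mollifier_scaleR: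
  fixes f :: "real^'n \<Rightarrow> 'b::euclidean_space"
  assumes "integrable (lebesgue_on \<Omega>) f"
  shows "integrable (lebesgue_on \<Omega>) (\<lambda>y. mollifier \<epsilon> (x - y) *\<^sub>R f y)"
proof (rule integrable_translate[OF assms, where T="closure \<Omega>" and W=UNIV])
  show "(\<lambda>y. y) \<in> borel_measurable (lebesgue_on \<Omega>)"
    using open_bounded_measurable by (intro continuous_imp_measurable_on_sets_lebesgue) auto
qed (use \<Omega> closure_subset in \<open>auto simp: continuous_on_mollifier\<close>)

lemma Ck_on_mollify:
  fixes f :: "real^'n \<Rightarrow> 'b::euclidean_space"
  assumes "integrable (lebesgue_on \<Omega>) f"
  shows "Ck_on k UNIV (mollify \<Omega> \<epsilon> f)"
  unfolding mollify_def[abs_def]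
proof (rule Ck_on_integral_translate[OF assms, where T="closure \<Omega>" and W=UNIV])
  show "(\<lambda>y. y) \<in> borel_measurable (lebesgue_on \<Omega>)"
    using open_bounded_measurable by (intro continuous_imp_measurable_on_sets_lebesgue) auto
qed (use \<Omega> closure_subset in \<open>auto intro: Ck_on_mollifier\<close>)

lemma frechet_derivative_mollify:
  fixes f :: "real^'n \<Rightarrow> 'b::euclidean_space"
  assumes "integrable (lebesgue_on \<Omega>) f"
  shows "frechet_derivative (mollify \<Omega> \<epsilon> f) (at x) h =
    (\<integral>y. frechet_derivative (mollifier \<epsilon>) (at (x - y)) h *\<^sub>R f y \<partial>lebesgue_on \<Omega>)"
proof -
  have "(mollify \<Omega> \<epsilon> f has_derivative
      (\<lambda>h. \<integral>y. frechet_derivative (mollifier \<epsilon>) (at (x - y)) h *\<^sub>R f y \<partial>lebesgue_on \<Omega>)) (at x)"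
    unfolding mollify_def[abs_def]
  proof (rule has_derivative_integral_translate[OF assms, where T="closure \<Omega>" and U=UNIV and W=UNIV])
    show "(\<lambda>y. y) \<in> borel_measurable (lebesgue_on \<Omega>)"
      using open_bounded_measurable by (intro continuous_imp_measurable_on_sets_lebesgue) auto
  qed (use \<Omega> closure_subset Ck_on_mollifier in \<open>auto simp del: Ck_on.simps\<close>)
  from fun_cong[OF frechet_derivative_at[OF this]] show ?thesis by simp
qed

lemma mollify_measurable:
  fixes f :: "real^'n \<Rightarrow> 'b::euclidean_space"
  assumes "integrable (lebesgue_on \<Omega>) f"
  shows "mollify \<Omega> \<epsilon> f \<in> borel_measurable (lebesgue_on \<Omega>)"
  using Ck_on_mollify[OF assms, of 0] open_bounded_measurable
  by (intro continuous_imp_measurable_on_sets_lebesgue) (auto intro: continuous_on_subset)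

lemma mollify_diff:
  fixes f g :: "real^'n \<Rightarrow> 'b::euclidean_space"
  assumes "integrable (lebesgue_on \<Omega>) f" "integrable (lebesgue_on \<Omega>) g"
  shows "mollify \<Omega> \<epsilon> (\<lambda>x. f x - g x) x = mollify \<Omega> \<epsilon> f x - mollify \<Omega> \<epsilon> g x"
  unfolding mollify_def scaleR_diff_right
  by (intro Bochner_Integration.integral_diff integrable_mollifier_scaleR assms)

lemma norm_mollify_le:
  fixes f :: "real^'n \<Rightarrow> 'b::euclidean_space"
  assumes "integrable (lebesgue_on \<Omega>) f" "\<epsilon> > 0" "B \<ge> 0"
    "\<And>y. y \<in> \<Omega> \<Longrightarrow> norm (x - y) < \<epsilon> \<Longrightarrow> norm (f y) \<le> B"
  shows "norm (mollify \<Omega> \<epsilon> f x) \<le> B"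
proof -
  note m = mollifier_integral_on[OF assms(2) open_bounded_measurable(1), of x]
  have "norm (mollify \<Omega> \<epsilon> f x) \<le> (\<integral>y. norm (mollifier \<epsilon> (x - y) *\<^sub>R f y) \<partial>lebesgue_on \<Omega>)"
    unfolding mollify_def by (rule integral_norm_bound)
  also have "\<dots> \<le> (\<integral>y. mollifier \<epsilon> (x - y) * B \<partial>lebesgue_on \<Omega>)"
  proof (rule integral_mono)
    fix y assume "y \<in> space (lebesgue_on \<Omega>)"
    then have "mollifier \<epsilon> (x - y) = 0 \<or> norm (f y) \<le> B"
      using assms(4)[of y] mollifier_eq_0_iff[OF assms(2), of "x - y"] by force
    then show "norm (mollifier \<epsilon> (x - y) *\<^sub>R f y) \<le> mollifier \<epsilon> (x - y) * B"
      using mollifier_nonneg[of \<epsilon> "x - y"] by (auto simp: mult_left_mono)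
  qed (use m integrable_norm[OF integrable_mollifier_scaleR[OF assms(1)]] in auto)
  also have "\<dots> = (\<integral>y. mollifier \<epsilon> (x - y) \<partial>lebesgue_on \<Omega>) * B" using m by simp
  also have "\<dots> \<le> B" using m(2) assms(3) by (simp add: mult_left_le_one_le mollifier_nonneg)
  finally show ?thesis .
qed

text \<open>Once the ball around x fits into \<Omega> constants are reproduced, so the error is the
  mollification of g - g x, which is small near x by continuity.\<close>

lemma mollify_pointwise_tendsto:
  fixes g :: "real^'n \<Rightarrow> 'b::euclidean_space"
  assumes g: "continuous_on UNIV g" and gi: "integrable (lebesgue_on \<Omega>) g"
    and \<epsilon>: "\<And>k. \<epsilon> k > 0" "\<epsilon> \<longlonglongrightarrow> 0" and x: "x \<in> \<Omega>"
  shows "(\<lambda>k. mollify \<Omega> (\<epsilon> k) g x) \<longlonglongrightarrow> g x"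
proof (rule LIMSEQ_I)
  fix e :: real assume e: "e > 0"
  obtain \<rho> where \<rho>: "\<rho> > 0" "ball x \<rho> \<subseteq> \<Omega>" using \<Omega>(1) x open_contains_ball by blast
  have "isCont g x" using g by (simp add: continuous_on_eq_continuous_at)
  then obtain d where d: "d > 0" "\<And>y. dist y x < d \<Longrightarrow> dist (g y) (g x) < e / 2"
    unfolding continuous_at_eps_delta using e half_gt_zero by metis
  have "\<forall>\<^sub>F k in sequentially. \<epsilon> k < min d \<rho>"
    by (rule order_tendstoD(2)[OF \<epsilon>(2)]) (use d \<rho> in auto)
  then obtain K where K: "\<And>k. k \<ge> K \<Longrightarrow> \<epsilon> k < min d \<rho>" by (auto simp: eventually_sequentially)
  have ci: "integrable (lebesgue_on \<Omega>) (\<lambda>y. g x)"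
    using finite_measure.integrable_const[OF finite_measure_lebesgue_on[OF open_bounded_measurable(2)]] .
  show "\<exists>no. \<forall>k\<ge>no. norm (mollify \<Omega> (\<epsilon> k) g x - g x) < e"
  proof (intro exI[of _ K] allI impI)
    fix k assume k: "k \<ge> K"
    have "ball x (\<epsilon> k) \<subseteq> \<Omega>" using K[OF k] \<rho> by auto
    then have "mollify \<Omega> (\<epsilon> k) (\<lambda>y. g x) x = g x"
      unfolding mollify_def using mollifier_integral_on(1,3)[OF \<epsilon>(1)[of k] open_bounded_measurable(1), of x] by simp
    then have "mollify \<Omega> (\<epsilon> k) g x - g x = mollify \<Omega> (\<epsilon> k) (\<lambda>y. g y - g x) x"
      using mollify_diff[OF gi ci] by simp
    also have "norm \<dots> \<le> e / 2"
      using gi ci \<epsilon>(1) e d(2) K[OF k]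
      by (intro norm_mollify_le) (force simp: dist_norm norm_minus_commute intro: less_imp_le)+
    finally show "norm (mollify \<Omega> (\<epsilon> k) g x - g x) < e" using e by simp
  qed
qed

text \<open>Jensen's inequality for a kernel of mass at most one, obtained from Cauchy-Schwarz by
  splitting the kernel into two square roots.\<close>

lemma mollify_square_le:
  fixes f :: "real^'n \<Rightarrow> 'b::euclidean_space"
  assumes f: "f \<in> L2_space \<Omega>" and \<epsilon>: "\<epsilon> > 0"
  shows "integrable (lebesgue_on \<Omega>) (\<lambda>y. mollifier \<epsilon> (x - y) * (norm (f y))\<^sup>2)"
    "(norm (mollify \<Omega> \<epsilon> f x))\<^sup>2 \<le> (\<integral>y. mollifier \<epsilon> (x - y) * (norm (f y))\<^sup>2 \<partial>lebesgue_on \<Omega>)"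
proof -
  note m = mollifier_integral_on[OF \<epsilon> open_bounded_measurable(1), of x]
  show i: "integrable (lebesgue_on \<Omega>) (\<lambda>y. mollifier \<epsilon> (x - y) * (norm (f y))\<^sup>2)"
    using integrable_mollifier_scaleR[OF L2_spaceD(2)[OF f]] by simp
  define a where "a y = sqrt (mollifier \<epsilon> (x - y))" for y
  have a: "a \<in> L2_space \<Omega>" "(L2_norm \<Omega> a)\<^sup>2 \<le> 1"
  proof -
    have "a \<in> borel_measurable (lebesgue_on \<Omega>)"
      using m(1) unfolding a_def[abs_def] by auto
    then show "a \<in> L2_space \<Omega>" using m(1) by (simp add: L2_space_def a_def mollifier_nonneg)
    show "(L2_norm \<Omega> a)\<^sup>2 \<le> 1" using m(2) by (simp add: L2_norm_power2 a_def mollifier_nonneg)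
  qed
  have af: "(\<lambda>y. a y *\<^sub>R f y) \<in> L2_space \<Omega>"
    using borel_measurable_scaleR[OF L2_spaceD(1)[OF a(1)] L2_spaceD(1)[OF f]] i
    by (simp add: L2_space_def power_mult_distrib a_def mollifier_nonneg)
  have af2: "(L2_norm \<Omega> (\<lambda>y. a y *\<^sub>R f y))\<^sup>2 = (\<integral>y. mollifier \<epsilon> (x - y) * (norm (f y))\<^sup>2 \<partial>lebesgue_on \<Omega>)"
    by (simp add: L2_norm_power2 power_mult_distrib a_def mollifier_nonneg)
  have "norm (mollify \<Omega> \<epsilon> f x) \<le> (\<integral>y. norm (mollifier \<epsilon> (x - y) *\<^sub>R f y) \<partial>lebesgue_on \<Omega>)"
    unfolding mollify_def by (rule integral_norm_bound)
  also have "\<dots> = (\<integral>y. norm (a y) * norm (a y *\<^sub>R f y) \<partial>lebesgue_on \<Omega>)"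
    by (simp add: a_def mollifier_nonneg mult.assoc[symmetric])
  also have "\<dots> \<le> L2_norm \<Omega> a * L2_norm \<Omega> (\<lambda>y. a y *\<^sub>R f y)"
    by (rule L2_Cauchy_Schwarz_norm[OF a(1) af])
  finally have "(norm (mollify \<Omega> \<epsilon> f x))\<^sup>2 \<le> (L2_norm \<Omega> a)\<^sup>2 * (L2_norm \<Omega> (\<lambda>y. a y *\<^sub>R f y))\<^sup>2"
    by (metis power_mono norm_ge_zero power_mult_distrib)
  also have "\<dots> \<le> 1 * (L2_norm \<Omega> (\<lambda>y. a y *\<^sub>R f y))\<^sup>2"
    by (intro mult_right_mono a(2)) auto
  finally show "(norm (mollify \<Omega> \<epsilon> f x))\<^sup>2 \<le> (\<integral>y. mollifier \<epsilon> (x - y) * (norm (f y))\<^sup>2 \<partial>lebesgue_on \<Omega>)"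
    using af2 by simp
qed

text \<open>After the pointwise square estimate, Fubini allows the kernel to be integrated in x
  first, and each of its translates has mass one.\<close>

lemma mollify_L2:
  fixes f :: "real^'n \<Rightarrow> 'b::euclidean_space"
  assumes f: "f \<in> L2_space \<Omega>" and \<epsilon>: "\<epsilon> > 0"
  shows "mollify \<Omega> \<epsilon> f \<in> L2_space \<Omega>" "L2_norm \<Omega> (mollify \<Omega> \<epsilon> f) \<le> L2_norm \<Omega> f"
proof -
  note fi = L2_imp_integrable[OF f open_bounded_measurable(2)]
  note mm = mollify_measurable[OF fi]
  \<comment> \<open>This function is only Lebesgue measurable, while Fubini is applied to Borel
    functions; hence the passage to an almost everywhere equal Borel function
    \<open>h'\<close>.\<close>
  define h where "h y = ennreal ((norm (f y))\<^sup>2) * indicator \<Omega> y" for y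
  have "(\<lambda>y. ennreal ((norm (f y))\<^sup>2)) \<in> borel_measurable (lebesgue_on \<Omega>)"
    using L2_spaceD(1)[OF f] by auto
  then have "h \<in> borel_measurable lebesgue"
    unfolding h_def[abs_def]
    by (rule borel_measurable_restrict_space_iff_ennreal[THEN iffD1, rotated])
      (use open_bounded_measurable(1) in auto)
  from completion_ex_borel_measurable[OF this] obtain h' where
    h'[measurable]: "h' \<in> borel_measurable lborel" and hh': "AE y in lborel. h y = h' y" by auto
  have hI: "(\<integral>\<^sup>+y. h' y \<partial>lborel) = ennreal ((L2_norm \<Omega> f)\<^sup>2)"
  proof -
    have "(\<integral>\<^sup>+y. h' y \<partial>lborel) = (\<integral>\<^sup>+y. h y \<partial>lborel)"
      using hh' by (intro nn_integral_cong_AE) auto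
    also have "\<dots> = (\<integral>\<^sup>+y. h y \<partial>lebesgue)" by (simp add: nn_integral_completion)
    also have "\<dots> = (\<integral>\<^sup>+y. ennreal ((norm (f y))\<^sup>2) \<partial>lebesgue_on \<Omega>)"
      unfolding h_def using open_bounded_measurable(1) by (subst nn_integral_restrict_space) auto
    also have "\<dots> = ennreal ((L2_norm \<Omega> f)\<^sup>2)"
      unfolding L2_norm_power2 using L2_spaceD(2)[OF f] by (intro nn_integral_eq_integral) auto
    finally show ?thesis .
  qed
  have inner: "ennreal ((norm (mollify \<Omega> \<epsilon> f x))\<^sup>2) \<le> (\<integral>\<^sup>+y. ennreal (mollifier \<epsilon> (x - y)) * h' y \<partial>lborel)" for x
  proof -
    have "ennreal ((norm (mollify \<Omega> \<epsilon> f x))\<^sup>2) \<le> ennreal (\<integral>y. mollifier \<epsilon> (x - y) * (norm (f y))\<^sup>2 \<partial>lebesgue_on \<Omega>)"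
      using mollify_square_le(2)[OF f \<epsilon>] by (intro ennreal_leI)
    also have "\<dots> = (\<integral>\<^sup>+y. ennreal (mollifier \<epsilon> (x - y) * (norm (f y))\<^sup>2) \<partial>lebesgue_on \<Omega>)"
      using mollify_square_le(1)[OF f \<epsilon>] by (intro nn_integral_eq_integral[symmetric]) (auto simp: mollifier_nonneg)
    also have "\<dots> = (\<integral>\<^sup>+y. ennreal (mollifier \<epsilon> (x - y) * (norm (f y))\<^sup>2) * indicator \<Omega> y \<partial>lebesgue)"
      using open_bounded_measurable(1) by (subst nn_integral_restrict_space) auto
    also have "\<dots> = (\<integral>\<^sup>+y. ennreal (mollifier \<epsilon> (x - y)) * h y \<partial>lborel)"
      by (simp add: nn_integral_completion h_def ennreal_mult mollifier_nonneg mult.assoc)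
    also have "\<dots> = (\<integral>\<^sup>+y. ennreal (mollifier \<epsilon> (x - y)) * h' y \<partial>lborel)"
      using hh' by (intro nn_integral_cong_AE) auto
    finally show ?thesis .
  qed
  have "(\<integral>\<^sup>+x. ennreal ((norm (mollify \<Omega> \<epsilon> f x))\<^sup>2) \<partial>lebesgue_on \<Omega>)
      = (\<integral>\<^sup>+x. ennreal ((norm (mollify \<Omega> \<epsilon> f x))\<^sup>2) * indicator \<Omega> x \<partial>lborel)"
    using open_bounded_measurable(1) by (subst nn_integral_restrict_space) (auto simp: nn_integral_completion)
  also have "\<dots> \<le> (\<integral>\<^sup>+x. (\<integral>\<^sup>+y. ennreal (mollifier \<epsilon> (x - y)) * h' y \<partial>lborel) \<partial>lborel)"
    using inner by (intro nn_integral_mono) (auto simp: indicator_def)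
  also have "\<dots> = (\<integral>\<^sup>+y. (\<integral>\<^sup>+x. ennreal (mollifier \<epsilon> (x - y)) * h' y \<partial>lborel) \<partial>lborel)"
    by (rule lborel_pair.Fubini') measurable
  also have "\<dots> = (\<integral>\<^sup>+y. h' y \<partial>lborel)"
    by (subst nn_integral_multc) (auto simp: nn_integral_mollifier_translate[OF \<epsilon>])
  finally have le: "(\<integral>\<^sup>+x. ennreal ((norm (mollify \<Omega> \<epsilon> f x))\<^sup>2) \<partial>lebesgue_on \<Omega>) \<le> ennreal ((L2_norm \<Omega> f)\<^sup>2)"
    using hI by simp
  have int: "integrable (lebesgue_on \<Omega>) (\<lambda>x. (norm (mollify \<Omega> \<epsilon> f x))\<^sup>2)"
    using mm le_less_trans[OF le ennreal_less_top] by (intro integrableI_bounded) auto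
  then show "mollify \<Omega> \<epsilon> f \<in> L2_space \<Omega>" using mm by (simp add: L2_space_def)
  have "ennreal ((L2_norm \<Omega> (mollify \<Omega> \<epsilon> f))\<^sup>2) \<le> ennreal ((L2_norm \<Omega> f)\<^sup>2)"
    unfolding L2_norm_power2[of _ "mollify \<Omega> \<epsilon> f"] using le int by (subst nn_integral_eq_integral[symmetric]) auto
  then have "(L2_norm \<Omega> (mollify \<Omega> \<epsilon> f))\<^sup>2 \<le> (L2_norm \<Omega> f)\<^sup>2" by (simp add: ennreal_le_iff)
  then show "L2_norm \<Omega> (mollify \<Omega> \<epsilon> f) \<le> L2_norm \<Omega> f"
    using L2_norm_nonneg by (rule power2_le_imp_le)
qed

text \<open>Since mollification does not increase the L2 norm, a dense class suffices; for bounded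
  continuous functions the convergence is pointwise and bounded.\<close>

lemma mollify_tendsto_L2:
  fixes f :: "real^'n \<Rightarrow> 'b::euclidean_space"
  assumes f: "f \<in> L2_space \<Omega>" and \<epsilon>: "\<And>k. \<epsilon> k > 0" "\<epsilon> \<longlonglongrightarrow> 0"
  shows "(\<lambda>k. L2_norm \<Omega> (\<lambda>x. mollify \<Omega> (\<epsilon> k) f x - f x)) \<longlonglongrightarrow> 0"
proof (rule LIMSEQ_I)
  fix e :: real assume "e > 0"
  then have "e / 3 > 0" by simp
  from continuous_bounded_dense_L2[OF f open_bounded_measurable(2) this] obtain g B where
    g: "continuous_on UNIV g" "\<And>x. norm (g x) \<le> B" "g \<in> L2_space \<Omega>" "L2_norm \<Omega> (\<lambda>x. f x - g x) < e / 3" by metis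
  note int = L2_imp_integrable[OF _ open_bounded_measurable(2)]
  have B: "B \<ge> 0" using order_trans[OF norm_ge_zero g(2)] .
  have "(\<lambda>k. L2_norm \<Omega> (\<lambda>x. mollify \<Omega> (\<epsilon> k) g x - g x)) \<longlonglongrightarrow> 0"
  proof (rule L2_norm_tendsto_0[where g="\<lambda>x. 2 * B"])
    show "(\<lambda>x. mollify \<Omega> (\<epsilon> k) g x - g x) \<in> borel_measurable (lebesgue_on \<Omega>)" for k
      using mollify_measurable[OF int[OF g(3)]] L2_spaceD(1)[OF g(3)] by auto
    show "(\<lambda>x. 2 * B) \<in> L2_space \<Omega>"
      by (rule L2_bounded(1)[OF _ open_bounded_measurable(2), of _ "2 * B"]) (use B in auto)
    have "norm (mollify \<Omega> (\<epsilon> k) g x - g x) \<le> norm (2 * B)" for k x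
      using norm_triangle_ineq4[of "mollify \<Omega> (\<epsilon> k) g x" "g x"] g(2)[of x] B
        norm_mollify_le[OF int[OF g(3)] \<epsilon>(1) B, of x k, OF g(2)] by (simp del: norm_mult)
    then show "AE x in lebesgue_on \<Omega>. norm (mollify \<Omega> (\<epsilon> k) g x - g x) \<le> norm (2 * B)" for k by auto
    show "AE x in lebesgue_on \<Omega>. (\<lambda>k. mollify \<Omega> (\<epsilon> k) g x - g x) \<longlonglongrightarrow> 0"
    proof (rule AE_I2)
      fix x assume "x \<in> space (lebesgue_on \<Omega>)"
      then have "x \<in> \<Omega>" by simp
      from mollify_pointwise_tendsto[OF g(1) int[OF g(3)] \<epsilon> this]
      show "(\<lambda>k. mollify \<Omega> (\<epsilon> k) g x - g x) \<longlonglongrightarrow> 0" by (simp add: LIM_zero)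
    qed
  qed
  from order_tendstoD(2)[OF this \<open>e / 3 > 0\<close>] obtain K where
    K: "\<And>k. k \<ge> K \<Longrightarrow> L2_norm \<Omega> (\<lambda>x. mollify \<Omega> (\<epsilon> k) g x - g x) < e / 3"
    by (auto simp: eventually_sequentially)
  show "\<exists>no. \<forall>k\<ge>no. norm (L2_norm \<Omega> (\<lambda>x. mollify \<Omega> (\<epsilon> k) f x - f x) - 0) < e"
  proof (intro exI[of _ K] allI impI)
    fix k assume k: "k \<ge> K"
    have fg: "(\<lambda>x. f x - g x) \<in> L2_space \<Omega>" by (rule L2_diff(1)[OF f g(3)])
    have gf: "(\<lambda>x. g x - f x) \<in> L2_space \<Omega>" by (rule L2_diff(1)[OF g(3) f])
    have mg: "(\<lambda>x. mollify \<Omega> (\<epsilon> k) g x - g x) \<in> L2_space \<Omega>"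
      by (rule L2_diff(1)[OF mollify_L2(1)[OF g(3) \<epsilon>(1)] g(3)])
    have "(\<lambda>x. mollify \<Omega> (\<epsilon> k) f x - f x) =
        (\<lambda>x. mollify \<Omega> (\<epsilon> k) (\<lambda>x. f x - g x) x + ((mollify \<Omega> (\<epsilon> k) g x - g x) + (g x - f x)))"
      by (simp add: mollify_diff[OF int[OF f] int[OF g(3)]])
    then have "L2_norm \<Omega> (\<lambda>x. mollify \<Omega> (\<epsilon> k) f x - f x) \<le> L2_norm \<Omega> (mollify \<Omega> (\<epsilon> k) (\<lambda>x. f x - g x))
       + (L2_norm \<Omega> (\<lambda>x. mollify \<Omega> (\<epsilon> k) g x - g x) + L2_norm \<Omega> (\<lambda>x. g x - f x))"
      using L2_add(2)[OF mollify_L2(1)[OF fg \<epsilon>(1)[of k]] L2_add(1)[OF mg gf]] L2_add(2)[OF mg gf] by simp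
    then show "norm (L2_norm \<Omega> (\<lambda>x. mollify \<Omega> (\<epsilon> k) f x - f x) - 0) < e"
      using mollify_L2(2)[OF fg \<epsilon>(1)[of k]] K[OF k] g(4) L2_norm_diff_commute[of \<Omega> f g] L2_norm_nonneg
      by (simp add: L2_norm_nonneg)
  qed
qed

end

subsection \<open>Integration by parts\<close>

text \<open>Translation invariance makes the integral of every difference quotient vanish, and
  dominated convergence carries this over to the derivative.\<close>

lemma integral_directional_derivative_eq_0:
  fixes f :: "'a::euclidean_space \<Rightarrow> real"
  assumes d: "\<And>x. (f has_derivative f' x) (at x)" and c: "continuous_on UNIV (\<lambda>x. f' x e)"
    and K: "compact K" "\<And>x. x \<notin> K \<Longrightarrow> f x = 0"
  shows "(\<integral>x. f' x e \<partial>lborel) = 0"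
proof -
  have fc: "continuous_on UNIV f"
    using d by (meson has_derivative_continuous continuous_at_imp_continuous_on)
  obtain r where r: "\<And>x. x \<in> K \<Longrightarrow> norm x \<le> r" and "r > 0"
    using compact_imp_bounded[OF K(1)] by (auto simp: bounded_pos)
  \<comment> \<open>Steps are at most 1, so a difference quotient can be nonzero only for |x| <= R.
    The intermediate points of the mean value theorem then have norm at most R + |e|, which is the
    ball on which \<open>B\<close> bounds the derivative.\<close>
  define R where "R = r + norm e"
  obtain B where B: "\<And>x. norm x \<le> R + norm e \<Longrightarrow> \<bar>f' x e\<bar> \<le> B"
  proof -
    have "compact ((\<lambda>x. f' x e) ` cball 0 (R + norm e))"
      by (intro compact_continuous_image continuous_on_subset[OF c]) auto
    then show ?thesis using that compact_imp_bounded by (fastforce simp: bounded_iff)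
  qed
  have fi: "integrable lborel f"
  proof -
    have "integrable lborel (\<lambda>x. indicator K x *\<^sub>R f x)"
      by (rule borel_integrable_compact[OF K(1)]) (auto intro: continuous_on_subset[OF fc])
    moreover have "(\<lambda>x. indicator K x *\<^sub>R f x) = f" using K(2) by (intro ext) (auto simp: indicator_def)
    ultimately show ?thesis by simp
  qed
  have tr: "integrable lborel (\<lambda>x. f (t *\<^sub>R e + x))" "(\<integral>x. f (t *\<^sub>R e + x) \<partial>lborel) = (\<integral>x. f x \<partial>lborel)" for t
  proof -
    have fm: "f \<in> borel_measurable borel" using fc by (rule borel_measurable_continuous_onI)
    have "integrable (distr lborel borel ((+) (t *\<^sub>R e))) f" using fi by (simp add: lborel_distr_plus)
    then show "integrable lborel (\<lambda>x. f (t *\<^sub>R e + x))" using fm by (subst (asm) integrable_distr_eq) auto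
    have "(\<integral>x. f x \<partial>lborel) = (\<integral>x. f x \<partial>distr lborel borel ((+) (t *\<^sub>R e)))" by (simp add: lborel_distr_plus)
    also have "\<dots> = (\<integral>x. f (t *\<^sub>R e + x) \<partial>lborel)" using fm by (subst integral_distr) auto
    finally show "(\<integral>x. f (t *\<^sub>R e + x) \<partial>lborel) = (\<integral>x. f x \<partial>lborel)" by simp
  qed
  define t where "t k = inverse (real (Suc k))" for k
  have t: "t k > 0" "t k \<le> 1" for k by (auto simp: t_def field_simps)
  define F where "F k x = (f (t k *\<^sub>R e + x) - f x) / t k" for k x
  have F0: "(\<integral>x. F k x \<partial>lborel) = 0" for k
    unfolding F_def using tr fi by simp
  have dir: "((\<lambda>s. f (s *\<^sub>R e + x)) has_real_derivative f' (s *\<^sub>R e + x) e) (at s)" for s x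
  proof -
    have "((\<lambda>s. s *\<^sub>R e + x) has_derivative (\<lambda>h. h *\<^sub>R e)) (at s)" by (auto intro!: derivative_eq_intros)
    from has_derivative_compose[OF this d]
    have "((\<lambda>s. f (s *\<^sub>R e + x)) has_derivative (\<lambda>h. f' (s *\<^sub>R e + x) (h *\<^sub>R e))) (at s)" .
    moreover have "(\<lambda>h. f' (s *\<^sub>R e + x) (h *\<^sub>R e)) = (*) (f' (s *\<^sub>R e + x) e)"
      using has_derivative_linear[OF d] by (auto simp: linear_cmul mult.commute)
    ultimately show ?thesis by (simp add: has_field_derivative_def)
  qed
  have "(\<lambda>k. \<integral>x. F k x \<partial>lborel) \<longlonglongrightarrow> (\<integral>x. f' x e \<partial>lborel)"
  proof (rule integral_dominated_convergence[where w="\<lambda>x. indicator (cball 0 R) x *\<^sub>R B"])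
    show "(\<lambda>x. f' x e) \<in> borel_measurable lborel"
      using borel_measurable_continuous_onI[OF c] by simp
    have "f \<in> borel_measurable borel" using fc by (rule borel_measurable_continuous_onI)
    then show "F k \<in> borel_measurable lborel" for k unfolding F_def[abs_def] by measurable
    show "integrable lborel (\<lambda>x. indicator (cball 0 R) x *\<^sub>R B)"
      by (rule borel_integrable_compact) auto
    show "AE x in lborel. (\<lambda>k. F k x) \<longlonglongrightarrow> f' x e"
    proof (rule AE_I2)
      fix x
      have "((\<lambda>h. (f (h *\<^sub>R e + x) - f x) / h) \<longlongrightarrow> f' x e) (at 0)"
        using dir[of x 0] by (simp add: has_field_derivative_iff)
      moreover have "filterlim t (at 0) sequentially"
      proof -
        have "t \<longlonglongrightarrow> 0" unfolding t_def by (rule LIMSEQ_inverse_real_of_nat)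
        then show ?thesis using t(1) by (auto simp: filterlim_at intro!: always_eventually) (metis less_irrefl)
      qed
      ultimately show "(\<lambda>k. F k x) \<longlonglongrightarrow> f' x e"
        unfolding F_def by (rule filterlim_compose)
    qed
    show "AE x in lborel. norm (F k x) \<le> indicator (cball 0 R) x *\<^sub>R B" for k
    proof (rule AE_I2)
      fix x
      show "norm (F k x) \<le> indicator (cball 0 R) x *\<^sub>R B"
      proof (cases "norm x \<le> R")
        case False
        have te: "norm (t k *\<^sub>R e) \<le> norm e" using t[of k] by (simp add: mult_left_le_one_le)
        have "norm x \<le> norm (t k *\<^sub>R e + x) + norm (t k *\<^sub>R e)"
          using norm_triangle_ineq4[of "t k *\<^sub>R e + x" "t k *\<^sub>R e"] by simp
        then have "t k *\<^sub>R e + x \<notin> K" "x \<notin> K"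
          using r[of "t k *\<^sub>R e + x"] r[of x] False te norm_ge_zero[of e] unfolding R_def by linarith+
        then have "F k x = 0" using K(2) by (simp add: F_def)
        then show ?thesis using False by simp
      next
        case True
        obtain z where z: "0 < z" "z < t k" "f (t k *\<^sub>R e + x) - f (0 *\<^sub>R e + x) = (t k - 0) * f' (z *\<^sub>R e + x) e"
          using MVT2[OF t(1)[of k] dir[of x]] by metis
        have "norm (z *\<^sub>R e + x) \<le> R + norm e"
        proof -
          have "norm (z *\<^sub>R e) \<le> norm e" using z t(2)[of k] by (simp add: mult_left_le_one_le)
          then show ?thesis using norm_triangle_ineq[of "z *\<^sub>R e" x] True by simp
        qed
        then have "\<bar>f' (z *\<^sub>R e + x) e\<bar> \<le> B" by (rule B)
        moreover have "F k x = f' (z *\<^sub>R e + x) e" using z t(1)[of k] by (simp add: F_def)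
        ultimately show ?thesis using True by simp
      qed
    qed
  qed
  then show ?thesis using F0 LIMSEQ_unique[OF _ tendsto_const] by simp
qed

text \<open>f vanishes on the open complement of K, hence its derivative vanishes off \<Omega> and
  the integral over \<Omega> is the one over the whole space.\<close>

lemma integral_directional_derivative_eq_0_on:
  fixes f :: "'a::euclidean_space \<Rightarrow> real"
  assumes d: "\<And>x. (f has_derivative f' x) (at x)" and c: "continuous_on UNIV (\<lambda>x. f' x e)"
    and K: "compact K" "\<And>x. x \<notin> K \<Longrightarrow> f x = 0" and \<Omega>: "\<Omega> \<in> sets lebesgue" "K \<subseteq> \<Omega>"
  shows "(\<integral>x. f' x e \<partial>lebesgue_on \<Omega>) = 0"
proof -
  have 0: "f' x e = 0" if "x \<notin> \<Omega>" for x
  proof -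
    have "((\<lambda>x. 0) has_derivative (\<lambda>h. 0)) (at x)" by simp
    then have "(f has_derivative (\<lambda>h. 0)) (at x)"
      by (rule has_derivative_transform_within_open[where s="- K"])
        (use K \<Omega> that compact_imp_closed in auto)
    from has_derivative_unique[OF d this] show ?thesis by simp
  qed
  have "(\<integral>x. f' x e \<partial>lebesgue_on \<Omega>) = (\<integral>x. indicator \<Omega> x *\<^sub>R f' x e \<partial>lebesgue)"
    using \<Omega> by (intro integral_restrict_space) auto
  also have "(\<lambda>x. indicator \<Omega> x *\<^sub>R f' x e) = (\<lambda>x. f' x e)"
    using 0 by (intro ext) (auto simp: indicator_def)
  also have "(\<integral>x. f' x e \<partial>lebesgue) = (\<integral>x. f' x e \<partial>lborel)"
    using borel_measurable_continuous_onI[OF c] by (intro integral_completion) simp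
  finally show ?thesis using integral_directional_derivative_eq_0[OF d c K] by simp
qed

lemma Ck_on_1_directional:
  assumes "Ck_on (Suc 0) S f"
  shows "continuous_on S (\<lambda>x. frechet_derivative f (at x) h)"
proof -
  have "frechet_derivative f (at x) h = (\<Sum>b\<in>Basis. (h \<bullet> b) *\<^sub>R frechet_derivative f (at x) b)" if "x \<in> S" for x
  proof -
    have "linear (frechet_derivative f (at x))"
      using Ck_on_Suc_has_derivative[OF assms that] by (rule has_derivative_linear)
    then have "frechet_derivative f (at x) (\<Sum>b\<in>Basis. (h \<bullet> b) *\<^sub>R b) = (\<Sum>b\<in>Basis. (h \<bullet> b) *\<^sub>R frechet_derivative f (at x) b)"
      by (simp add: linear_sum linear_cmul)
    then show ?thesis by (simp add: euclidean_representation)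
  qed
  moreover have "continuous_on S (\<lambda>x. \<Sum>b\<in>Basis. (h \<bullet> b) *\<^sub>R frechet_derivative f (at x) b)"
    using assms by (intro continuous_intros) auto
  ultimately show ?thesis using continuous_on_cong by fastforce
qed

lemma frechet_derivative_eqI: "(f has_derivative f') (at x) \<Longrightarrow> frechet_derivative f (at x) h = f' h"
  using frechet_derivative_at[of f f' x] by simp

lemma test_functionD:
  assumes "\<phi> \<in> test_functions S"
  shows "Ck_on k UNIV \<phi>" "compact (closure {x. \<phi> x \<noteq> 0})" "closure {x. \<phi> x \<noteq> 0} \<subseteq> S"
    "x \<notin> closure {x. \<phi> x \<noteq> 0} \<Longrightarrow> \<phi> x = 0"
  using assms closure_subset[of "{x. \<phi> x \<noteq> 0}"] by (auto simp: test_functions_def)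

text \<open>Makes mollification at x a pairing with a test function in the variable y. The closed
  ball has to fit into S because it contains the closure of the support.\<close>

lemma mollifier_test_function:
  fixes x :: "real^'n"
  assumes "\<epsilon> > 0" "cball x \<epsilon> \<subseteq> S"
  shows "(\<lambda>y. mollifier \<epsilon> (x - y)) \<in> test_functions S"
proof -
  have "Ck_on k UNIV (\<lambda>y. mollifier \<epsilon> ((-1) *\<^sub>R y + x))" for k
    by (rule Ck_on_affine_compose[OF _ _ Ck_on_mollifier]) auto
  then have "Ck_on k UNIV (\<lambda>y. mollifier \<epsilon> (x - y))" for k by simp
  moreover have sub: "closure {y. mollifier \<epsilon> (x - y) \<noteq> 0} \<subseteq> cball x \<epsilon>"
    by (intro closure_minimal) (auto simp: dist_norm mollifier_eq_0_iff[OF assms(1)])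
  moreover have "compact (closure {y. mollifier \<epsilon> (x - y) \<noteq> 0})"
    using bounded_subset[OF bounded_cball sub] by (simp add: compact_eq_bounded_closed)
  ultimately show ?thesis using assms(2) by (auto simp: test_functions_def)
qed

context
  fixes \<Omega> :: "(real^'n) set"
  assumes \<Omega>: "open \<Omega>" "bounded \<Omega>"
begin

lemma continuous_L2:
  fixes f :: "real^'n \<Rightarrow> 'b::euclidean_space"
  assumes "continuous_on UNIV f"
  shows "f \<in> L2_space \<Omega>"
proof -
  have "compact (f ` closure \<Omega>)"
    using \<Omega> assms by (intro compact_continuous_image) (auto intro: continuous_on_subset)
  then obtain B where "\<And>x. x \<in> closure \<Omega> \<Longrightarrow> norm (f x) \<le> B" "B > 0"
    using compact_imp_bounded bounded_pos by (metis imageI)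
  then show ?thesis
    using closure_subset[of \<Omega>] assms open_bounded_measurable[OF \<Omega>]
    by (intro L2_bounded(1)[of _ _ B] continuous_imp_measurable_on_sets_lebesgue)
      (auto intro: continuous_on_subset)
qed

lemma test_function_L2:
  fixes \<phi> :: "real^'n \<Rightarrow> 'b::euclidean_space"
  assumes "\<phi> \<in> test_functions S"
  shows "\<phi> \<in> L2_space \<Omega>" "(\<lambda>x. frechet_derivative \<phi> (at x) h) \<in> L2_space \<Omega>"
  using Ck_on_1_directional[OF test_functionD(1)[OF assms]] Ck_on_imp_continuous_on[OF test_functionD(1)[OF assms]]
  by (auto intro!: continuous_L2)

lemma integration_by_parts:
  fixes g \<phi> :: "real^'n \<Rightarrow> real"
  assumes g: "Ck_on (Suc 0) UNIV g" and \<phi>: "Ck_on (Suc 0) UNIV \<phi>"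
    and K: "compact K" "\<And>x. x \<notin> K \<Longrightarrow> \<phi> x = 0" "K \<subseteq> \<Omega>"
  shows "(\<integral>x. g x * frechet_derivative \<phi> (at x) h \<partial>lebesgue_on \<Omega>) =
    - (\<integral>x. frechet_derivative g (at x) h * \<phi> x \<partial>lebesgue_on \<Omega>)"
proof -
  note cg = Ck_on_imp_continuous_on[OF g] Ck_on_1_directional[OF g, of h]
  note cp = Ck_on_imp_continuous_on[OF \<phi>] Ck_on_1_directional[OF \<phi>, of h]
  have i: "integrable (lebesgue_on \<Omega>) (\<lambda>x. g x * frechet_derivative \<phi> (at x) h)"
    "integrable (lebesgue_on \<Omega>) (\<lambda>x. frechet_derivative g (at x) h * \<phi> x)"
    using cg cp by (auto intro!: integrable_mult_L2 continuous_L2)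
  have "(\<integral>x. g x * frechet_derivative \<phi> (at x) h + frechet_derivative g (at x) h * \<phi> x \<partial>lebesgue_on \<Omega>) = 0"
  proof (rule integral_directional_derivative_eq_0_on[where f="\<lambda>x. g x * \<phi> x" and K=K and
        f'="\<lambda>x h. g x * frechet_derivative \<phi> (at x) h + frechet_derivative g (at x) h * \<phi> x"])
    show "((\<lambda>x. g x * \<phi> x) has_derivative
      (\<lambda>h. g x * frechet_derivative \<phi> (at x) h + frechet_derivative g (at x) h * \<phi> x)) (at x)" for x
      by (intro has_derivative_mult Ck_on_Suc_has_derivative[OF g] Ck_on_Suc_has_derivative[OF \<phi>]) auto
    show "continuous_on UNIV (\<lambda>x. g x * frechet_derivative \<phi> (at x) h + frechet_derivative g (at x) h * \<phi> x)"
      using cg cp by (intro continuous_intros)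
  qed (use K open_bounded_measurable[OF \<Omega>] in auto)
  then show ?thesis using i by simp
qed

subsection \<open>Weak gradients\<close>

lemma mollify_eq_0_of_orthogonal:
  fixes f :: "real^'n \<Rightarrow> real"
  assumes "\<And>\<phi>. \<phi> \<in> test_functions \<Omega> \<Longrightarrow> (\<integral>x. f x * \<phi> x \<partial>lebesgue_on \<Omega>) = 0"
    and "\<epsilon> > 0" "cball x \<epsilon> \<subseteq> \<Omega>"
  shows "mollify \<Omega> \<epsilon> f x = 0"
  using assms(1)[OF mollifier_test_function[OF assms(2,3)]] by (simp add: mollify_def mult.commute)

text \<open>Fundamental lemma of the calculus of variations. Where the closed ball of radius
  \<epsilon> fits into \<Omega>, the mollification of f is one of the vanishing pairings; since
  mollifications converge to f in L2, f itself vanishes in the limit.\<close>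

lemma L2_orthogonal_test_functions:
  fixes f :: "real^'n \<Rightarrow> real"
  assumes f: "f \<in> L2_space \<Omega>"
    and orth: "\<And>\<phi>. \<phi> \<in> test_functions \<Omega> \<Longrightarrow> (\<integral>x. f x * \<phi> x \<partial>lebesgue_on \<Omega>) = 0"
  shows "AE x in lebesgue_on \<Omega>. f x = 0"
proof (rule L2_norm_0_imp_AE[OF f])
  define \<epsilon> where "\<epsilon> k = inverse (real (Suc k))" for k
  have \<epsilon>: "\<And>k. \<epsilon> k > 0" "\<epsilon> \<longlonglongrightarrow> 0"
    unfolding \<epsilon>_def using LIMSEQ_inverse_real_of_nat by auto
  define A where "A k = {x. infdist x (- \<Omega>) > \<epsilon> k}" for k
  \<comment> \<open>\<open>infdist\<close> to the empty set is 0, which would make every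
    \<open>A k\<close> empty; boundedness of \<Omega> excludes this.\<close>
  have ne: "- \<Omega> \<noteq> {}" using \<Omega>(2) not_bounded_UNIV by (metis Compl_empty_eq double_complement)
  have "open (A k)" for k
    unfolding A_def by (intro open_Collect_less continuous_intros)
  then have Am: "A k \<in> sets lebesgue" for k by auto
  have A: "cball x (\<epsilon> k) \<subseteq> \<Omega>" if "x \<in> A k" for x k
  proof
    fix y assume "y \<in> cball x (\<epsilon> k)"
    then show "y \<in> \<Omega>" using infdist_le[of y "- \<Omega>" x] that by (auto simp: A_def)
  qed
  note fm = L2_spaceD(1)[OF f]
  have im: "indicat_real (A k) \<in> borel_measurable (lebesgue_on \<Omega>)" for k
    using Am by (intro borel_measurable_indicator' measurable_restrict_space1) auto
  define F where "F k x = mollify \<Omega> (\<epsilon> k) f x - f x" for k x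
  have FL: "F k \<in> L2_space \<Omega>" for k
    unfolding F_def[abs_def] by (rule L2_diff(1)[OF mollify_L2(1)[OF \<Omega> f \<epsilon>(1)] f])
  have Flim: "(\<lambda>k. L2_norm \<Omega> (F k)) \<longlonglongrightarrow> 0"
    unfolding F_def[abs_def] by (rule mollify_tendsto_L2[OF \<Omega> f \<epsilon>])
  have lim: "(\<lambda>k. L2_norm \<Omega> (\<lambda>x. (1 - indicat_real (A k) x) * f x)) \<longlonglongrightarrow> 0"
  proof (rule L2_norm_tendsto_0[OF _ f])
    show "(\<lambda>x. (1 - indicat_real (A k) x) * f x) \<in> borel_measurable (lebesgue_on \<Omega>)" for k
      using im[of k] fm by auto
    show "AE x in lebesgue_on \<Omega>. norm ((1 - indicat_real (A k) x) * f x) \<le> norm (f x)" for k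
      by (auto simp: indicator_def)
    show "AE x in lebesgue_on \<Omega>. (\<lambda>k. (1 - indicat_real (A k) x) * f x) \<longlonglongrightarrow> 0"
    proof (rule AE_I2)
      fix x assume "x \<in> space (lebesgue_on \<Omega>)"
      then have "x \<in> \<Omega>" by simp
      have "closed (- \<Omega>)" using \<Omega>(1) by auto
      then have "infdist x (- \<Omega>) > 0"
        using in_closed_iff_infdist_zero[of "- \<Omega>" x] ne \<open>x \<in> \<Omega>\<close> infdist_nonneg[of x "- \<Omega>"] by fastforce
      from order_tendstoD(2)[OF \<epsilon>(2) this]
      have "\<forall>\<^sub>F k in sequentially. 0 = (1 - indicat_real (A k) x) * f x"
        by eventually_elim (auto simp: A_def)
      from Lim_transform_eventually[OF tendsto_const this]
      show "(\<lambda>k. (1 - indicat_real (A k) x) * f x) \<longlonglongrightarrow> 0" .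
    qed
  qed
  \<comment> \<open>On \<open>A k\<close> the mollification is zero, so f = - F k there; the part of
    f off \<open>A k\<close> tends to zero in L2 because the sets \<open>A k\<close> exhaust
    \<Omega>.\<close>
  have le: "L2_norm \<Omega> f \<le> L2_norm \<Omega> (F k) + L2_norm \<Omega> (\<lambda>x. (1 - indicat_real (A k) x) * f x)" for k
  proof -
    have le: "norm (indicat_real (A k) x * f x) \<le> 1 * norm (F k x)" for x
      using mollify_eq_0_of_orthogonal[OF orth \<epsilon>(1) A] by (auto simp: F_def indicator_def)
    have "(\<lambda>x. indicat_real (A k) x * f x) \<in> borel_measurable (lebesgue_on \<Omega>)"
      using im[of k] fm by auto
    note * = L2_norm_le[OF this FL _ AE_I2[OF le]]
    have 1: "(\<lambda>x. indicat_real (A k) x * f x) \<in> L2_space \<Omega>"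
       "L2_norm \<Omega> (\<lambda>x. indicat_real (A k) x * f x) \<le> 1 * L2_norm \<Omega> (F k)"
      using * by simp_all
    have 2: "(\<lambda>x. (1 - indicat_real (A k) x) * f x) \<in> L2_space \<Omega>"
      by (intro L2_norm_le(1)[OF borel_measurable_times[OF borel_measurable_diff[OF borel_measurable_const im] fm] f, of 1])
        (auto simp: indicator_def)
    have "f = (\<lambda>x. indicat_real (A k) x * f x + (1 - indicat_real (A k) x) * f x)"
      by (simp add: algebra_simps)
    then have "L2_norm \<Omega> f = L2_norm \<Omega> (\<lambda>x. indicat_real (A k) x * f x + (1 - indicat_real (A k) x) * f x)"
      by simp
    also have "\<dots> \<le> L2_norm \<Omega> (\<lambda>x. indicat_real (A k) x * f x) + L2_norm \<Omega> (\<lambda>x. (1 - indicat_real (A k) x) * f x)"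
      by (rule L2_add(2)[OF 1(1) 2])
    finally show ?thesis using 1(2) by simp
  qed
  have "L2_norm \<Omega> f \<le> 0"
    using tendsto_add[OF Flim lim] le by (intro LIMSEQ_le_const[of _ 0]) auto
  then show "L2_norm \<Omega> f = 0" using L2_norm_nonneg[of \<Omega> f] by simp
qed

end

text \<open>Keeps the gradient as an explicit argument, in contrast to the choice in
  \<open>weak_gradient\<close>: sums, differences and smooth fields then come with a known
  representative.\<close>

definition wgrad :: "(real^'n) set \<Rightarrow> (real^'n \<Rightarrow> real^'n) \<Rightarrow> (real^'n \<Rightarrow> real^'n^'n) \<Rightarrow> bool" where
  "wgrad \<Omega> v D \<longleftrightarrow> v \<in> L2_space \<Omega> \<and> D \<in> L2_space \<Omega> \<and> is_weak_gradient \<Omega> v D"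

abbreviation jac :: "(real^'n \<Rightarrow> real^'n) \<Rightarrow> real^'n \<Rightarrow> real^'n^'n" where
  "jac g x \<equiv> matrix (frechet_derivative g (at x))"

lemma wgrad_weak_gradient: "v \<in> H1_space \<Omega> \<Longrightarrow> wgrad \<Omega> v (weak_gradient \<Omega> v)"
  unfolding H1_space_def wgrad_def weak_gradient_def
  by (auto intro: someI2_ex[of "\<lambda>D. D \<in> L2_space \<Omega> \<and> is_weak_gradient \<Omega> v D"])

lemma wgrad_H1_space: "wgrad \<Omega> v D \<Longrightarrow> v \<in> H1_space \<Omega>"
  by (auto simp: wgrad_def H1_space_def)

lemma L2_nth:
  fixes v :: "real^'n \<Rightarrow> real^'m"
  assumes "v \<in> L2_space \<Omega>" shows "(\<lambda>x. v x $ i) \<in> L2_space \<Omega>"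
  using L2_bounded_linear(1)[OF assms bounded_linear_vec_nth] .

lemma L2_norm_add_tendsto_0:
  assumes "\<And>k. f k \<in> L2_space \<Omega>" "\<And>k. g k \<in> L2_space \<Omega>"
    "(\<lambda>k. L2_norm \<Omega> (f k)) \<longlonglongrightarrow> 0" "(\<lambda>k. L2_norm \<Omega> (g k)) \<longlonglongrightarrow> 0"
  shows "(\<lambda>k. L2_norm \<Omega> (\<lambda>x. f k x + g k x)) \<longlonglongrightarrow> 0"
proof (rule tendsto_sandwich[where f="\<lambda>k. 0" and h="\<lambda>k. L2_norm \<Omega> (f k) + L2_norm \<Omega> (g k)"])
  show "(\<lambda>k. L2_norm \<Omega> (f k) + L2_norm \<Omega> (g k)) \<longlonglongrightarrow> 0"
    using tendsto_add[OF assms(3,4)] by simp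
qed (auto simp: L2_norm_nonneg L2_add(2)[OF assms(1,2)])

lemma L2_nth_nth:
  fixes D :: "real^'n \<Rightarrow> real^'m^'p"
  assumes "D \<in> L2_space \<Omega>" shows "(\<lambda>x. D x $ i $ j) \<in> L2_space \<Omega>"
  using L2_bounded_linear(1)[OF assms bounded_linear_compose[OF bounded_linear_vec_nth bounded_linear_vec_nth]] .

lemma continuous_on_jac:
  fixes g :: "real^'n \<Rightarrow> real^'n"
  assumes "Ck_on (Suc 0) S g"
  shows "continuous_on S (jac g)"
  unfolding matrix_def
  by (intro continuous_on_vec_lambda continuous_on_component Ck_on_1_directional[OF assms])

lemma frechet_derivative_nth:
  fixes g :: "real^'n \<Rightarrow> real^'n"
  assumes "Ck_on (Suc 0) S g" "x \<in> S"
  shows "frechet_derivative (\<lambda>x. g x $ i) (at x) h = frechet_derivative g (at x) h $ i"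
  using bounded_linear.has_derivative[OF bounded_linear_vec_nth Ck_on_Suc_has_derivative[OF assms]]
  by (rule frechet_derivative_eqI)

lemma test_functions_add:
  fixes \<phi> \<psi> :: "real^'n \<Rightarrow> 'b::real_normed_vector"
  assumes "\<phi> \<in> test_functions S" "\<psi> \<in> test_functions S"
  shows "(\<lambda>x. \<phi> x + \<psi> x) \<in> test_functions S"
proof -
  have sub: "closure {x. \<phi> x + \<psi> x \<noteq> 0} \<subseteq> closure {x. \<phi> x \<noteq> 0} \<union> closure {x. \<psi> x \<noteq> 0}"
    unfolding closure_Un[symmetric] by (intro closure_mono) auto
  have "compact (closure {x. \<phi> x \<noteq> 0} \<union> closure {x. \<psi> x \<noteq> 0})"
    using assms by (auto simp: test_functions_def intro: compact_Un)
  then have "compact (closure {x. \<phi> x + \<psi> x \<noteq> 0})"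
    using bounded_subset[OF compact_imp_bounded sub] by (simp add: compact_eq_bounded_closed)
  moreover have "closure {x. \<phi> x + \<psi> x \<noteq> 0} \<subseteq> S"
    using sub assms by (auto simp: test_functions_def)
  ultimately show ?thesis using assms by (auto simp: test_functions_def intro: Ck_on_add)
qed

lemma test_functions_minus:
  fixes \<phi> :: "real^'n \<Rightarrow> 'b::real_normed_vector"
  assumes "\<phi> \<in> test_functions S"
  shows "(\<lambda>x. - \<phi> x) \<in> test_functions S"
  using assms Ck_on_bounded_linear_compose[OF _ bounded_linear_minus[OF bounded_linear_ident]]
  by (auto simp: test_functions_def)

lemma jac_add:
  assumes "Ck_on (Suc 0) UNIV \<phi>" "Ck_on (Suc 0) UNIV \<psi>"
  shows "jac (\<lambda>x. \<phi> x + \<psi> x) x = jac \<phi> x + jac \<psi> x"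
  using has_derivative_add[OF Ck_on_Suc_has_derivative[OF assms(1), of x] Ck_on_Suc_has_derivative[OF assms(2), of x]]
  by (simp add: frechet_derivative_eqI matrix_def vec_eq_iff)

lemma jac_minus:
  assumes "Ck_on (Suc 0) UNIV \<phi>"
  shows "jac (\<lambda>x. - \<phi> x) x = - jac \<phi> x"
  using has_derivative_minus[OF Ck_on_Suc_has_derivative[OF assms(1), of x]]
  by (simp add: frechet_derivative_eqI matrix_def vec_eq_iff)

context
  fixes \<Omega> :: "(real^'n) set"
  assumes \<Omega>: "open \<Omega>" "bounded \<Omega>"
begin

lemma wgrad_integrable:
  fixes \<phi> :: "real^'n \<Rightarrow> real"
  assumes "wgrad \<Omega> v D" "\<phi> \<in> test_functions \<Omega>"
  shows "integrable (lebesgue_on \<Omega>) (\<lambda>x. v x $ i * frechet_derivative \<phi> (at x) h)"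
    "integrable (lebesgue_on \<Omega>) (\<lambda>x. D x $ i $ j * \<phi> x)"
  using assms test_function_L2[OF \<Omega> assms(2)]
  by (auto simp: wgrad_def intro!: integrable_mult_L2 L2_nth L2_nth_nth)

lemma wgrad_unique:
  assumes "wgrad \<Omega> v D" "wgrad \<Omega> v D'"
  shows "AE x in lebesgue_on \<Omega>. D x = D' x"
proof -
  have "AE x in lebesgue_on \<Omega>. D x $ i $ j - D' x $ i $ j = 0" for i j
  proof (rule L2_orthogonal_test_functions[OF \<Omega>])
    show "(\<lambda>x. D x $ i $ j - D' x $ i $ j) \<in> L2_space \<Omega>"
      using assms by (auto simp: wgrad_def intro!: L2_diff L2_nth_nth)
    fix \<phi> :: "real^'n \<Rightarrow> real" assume \<phi>: "\<phi> \<in> test_functions \<Omega>"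
    have "(\<integral>x. D x $ i $ j * \<phi> x \<partial>lebesgue_on \<Omega>) = (\<integral>x. D' x $ i $ j * \<phi> x \<partial>lebesgue_on \<Omega>)"
      using assms[unfolded wgrad_def is_weak_gradient_def, THEN conjunct2, THEN conjunct2,
          THEN bspec, OF \<phi>, THEN spec, of i, THEN spec, of j] by simp
    then show "(\<integral>x. (D x $ i $ j - D' x $ i $ j) * \<phi> x \<partial>lebesgue_on \<Omega>) = 0"
      using wgrad_integrable(2)[OF assms(1) \<phi>] wgrad_integrable(2)[OF assms(2) \<phi>]
      by (simp add: left_diff_distrib)
  qed
  then have "AE x in lebesgue_on \<Omega>. \<forall>i\<in>UNIV. \<forall>j\<in>UNIV. D x $ i $ j - D' x $ i $ j = 0"
    by (intro AE_finite_allI finite_class.finite_UNIV)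
  then show ?thesis by eventually_elim (auto simp: vec_eq_iff)
qed

lemma wgrad_add:
  assumes "wgrad \<Omega> v D" "wgrad \<Omega> v' D'"
  shows "wgrad \<Omega> (\<lambda>x. v x + v' x) (\<lambda>x. D x + D' x)"
proof -
  have "is_weak_gradient \<Omega> (\<lambda>x. v x + v' x) (\<lambda>x. D x + D' x)"
    unfolding is_weak_gradient_def
  proof (intro ballI allI)
    fix \<phi> :: "real^'n \<Rightarrow> real" and i j assume \<phi>: "\<phi> \<in> test_functions \<Omega>"
    show "(\<integral>x. (v x + v' x) $ i * frechet_derivative \<phi> (at x) (axis j 1) \<partial>lebesgue_on \<Omega>) =
      - (\<integral>x. (D x + D' x) $ i $ j * \<phi> x \<partial>lebesgue_on \<Omega>)"
      using wgrad_integrable[OF assms(1) \<phi>] wgrad_integrable[OF assms(2) \<phi>] assms \<phi>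
      by (simp add: wgrad_def is_weak_gradient_def distrib_right)
  qed
  then show ?thesis using assms by (auto simp: wgrad_def intro: L2_add)
qed

lemma wgrad_minus:
  assumes "wgrad \<Omega> v D"
  shows "wgrad \<Omega> (\<lambda>x. - v x) (\<lambda>x. - D x)"
  using assms by (auto simp: wgrad_def L2_space_def is_weak_gradient_def)

lemma wgrad_diff:
  assumes "wgrad \<Omega> v D" "wgrad \<Omega> v' D'"
  shows "wgrad \<Omega> (\<lambda>x. v x - v' x) (\<lambda>x. D x - D' x)"
  using wgrad_add[OF assms(1) wgrad_minus[OF assms(2)]] by simp

lemma wgrad_C1:
  fixes g :: "real^'n \<Rightarrow> real^'n"
  assumes g: "Ck_on (Suc 0) UNIV g"
  shows "wgrad \<Omega> g (jac g)"
proof -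
  have "is_weak_gradient \<Omega> g (jac g)"
    unfolding is_weak_gradient_def
  proof (intro ballI allI)
    fix \<phi> :: "real^'n \<Rightarrow> real" and i j assume \<phi>: "\<phi> \<in> test_functions \<Omega>"
    have gi: "Ck_on (Suc 0) UNIV (\<lambda>x. g x $ i)"
      by (rule Ck_on_bounded_linear_compose[OF _ bounded_linear_vec_nth g]) simp
    show "(\<integral>x. g x $ i * frechet_derivative \<phi> (at x) (axis j 1) \<partial>lebesgue_on \<Omega>) =
      - (\<integral>x. jac g x $ i $ j * \<phi> x \<partial>lebesgue_on \<Omega>)"
      using integration_by_parts[OF \<Omega> gi test_functionD(1)[OF \<phi>] test_functionD(2)[OF \<phi>]
          test_functionD(4)[OF \<phi>] test_functionD(3)[OF \<phi>], of "axis j 1"]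
      by (simp add: frechet_derivative_nth[OF g] matrix_def)
  qed
  then show ?thesis
    using continuous_L2[OF \<Omega> Ck_on_imp_continuous_on[OF g]] continuous_L2[OF \<Omega> continuous_on_jac[OF g]]
    by (simp add: wgrad_def)
qed

text \<open>Uniqueness almost everywhere makes the norm independent of the representative picked by
  \<open>weak_gradient\<close>.\<close>

lemma H1_norm_eq:
  assumes "wgrad \<Omega> v D"
  shows "H1_norm \<Omega> v = sqrt ((L2_norm \<Omega> v)\<^sup>2 + (L2_norm \<Omega> D)\<^sup>2)"
proof -
  have w: "wgrad \<Omega> v (weak_gradient \<Omega> v)"
    using wgrad_weak_gradient[OF wgrad_H1_space[OF assms]] .
  have "L2_norm \<Omega> (weak_gradient \<Omega> v) = L2_norm \<Omega> D"
    using L2_norm_cong_AE[OF _ _ wgrad_unique[OF w assms]] w assms by (auto simp: wgrad_def)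
  then show ?thesis by (simp add: H1_norm_def)
qed

text \<open>Test functions have their Jacobian as weak gradient, so convergence in
  \<open>H1_norm\<close> splits into convergence of the fields and of the Jacobians, measured
  against any known gradient D.\<close>

lemma H1_0_iff:
  assumes z: "wgrad \<Omega> z D"
  shows "z \<in> H1_0_space \<Omega> \<longleftrightarrow> (\<exists>\<phi>. (\<forall>k::nat. \<phi> k \<in> test_functions \<Omega>) \<and>
     (\<lambda>k. L2_norm \<Omega> (\<lambda>x. \<phi> k x - z x)) \<longlonglongrightarrow> 0 \<and> (\<lambda>k. L2_norm \<Omega> (\<lambda>x. jac (\<phi> k) x - D x)) \<longlonglongrightarrow> 0)"
proof -
  have eq: "(\<lambda>k. H1_norm \<Omega> (\<lambda>x. \<phi> k x - z x)) \<longlonglongrightarrow> 0 \<longleftrightarrow>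
     (\<lambda>k. L2_norm \<Omega> (\<lambda>x. \<phi> k x - z x)) \<longlonglongrightarrow> 0 \<and> (\<lambda>k. L2_norm \<Omega> (\<lambda>x. jac (\<phi> k) x - D x)) \<longlonglongrightarrow> 0"
    (is "?H \<longlonglongrightarrow> 0 \<longleftrightarrow> ?A \<longlonglongrightarrow> 0 \<and> ?B \<longlonglongrightarrow> 0")
    if \<phi>: "\<forall>k::nat. \<phi> k \<in> test_functions \<Omega>" for \<phi>
  proof -
    have H: "?H k = sqrt ((?A k)\<^sup>2 + (?B k)\<^sup>2)" for k
      using \<phi> by (intro H1_norm_eq wgrad_diff wgrad_C1 z test_functionD(1)) auto
    show ?thesis
    proof safe
      assume lim: "?H \<longlonglongrightarrow> 0"
      have "?A k \<le> ?H k" "?B k \<le> ?H k" for k unfolding H by (auto intro!: real_le_rsqrt)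
      then show "?A \<longlonglongrightarrow> 0" "?B \<longlonglongrightarrow> 0"
        by (auto intro!: tendsto_sandwich[OF _ _ tendsto_const lim] always_eventually simp: L2_norm_nonneg)
    next
      assume "?A \<longlonglongrightarrow> 0" "?B \<longlonglongrightarrow> 0"
      then have "(\<lambda>k. sqrt ((?A k)\<^sup>2 + (?B k)\<^sup>2)) \<longlonglongrightarrow> sqrt (0\<^sup>2 + 0\<^sup>2)"
        by (intro tendsto_intros)
      then show "?H \<longlonglongrightarrow> 0" unfolding H by simp
    qed
  qed
  show ?thesis
    using wgrad_H1_space[OF z] eq by (auto simp: H1_0_space_def)
qed

lemma H1_0_add:
  assumes "z \<in> H1_0_space \<Omega>" "z' \<in> H1_0_space \<Omega>"
  shows "(\<lambda>x. z x + z' x) \<in> H1_0_space \<Omega>"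
proof -
  obtain D D' where D: "wgrad \<Omega> z D" and D': "wgrad \<Omega> z' D'"
    using assms wgrad_weak_gradient by (auto simp: H1_0_space_def)
  obtain \<phi> where \<phi>: "\<And>k. \<phi> k \<in> test_functions \<Omega>" "(\<lambda>k. L2_norm \<Omega> (\<lambda>x. \<phi> k x - z x)) \<longlonglongrightarrow> 0"
     "(\<lambda>k. L2_norm \<Omega> (\<lambda>x. jac (\<phi> k) x - D x)) \<longlonglongrightarrow> 0"
    using H1_0_iff[OF D, THEN iffD1, OF assms(1)] by blast
  obtain \<phi>' where \<phi>': "\<And>k. \<phi>' k \<in> test_functions \<Omega>" "(\<lambda>k. L2_norm \<Omega> (\<lambda>x. \<phi>' k x - z' x)) \<longlonglongrightarrow> 0"
     "(\<lambda>k. L2_norm \<Omega> (\<lambda>x. jac (\<phi>' k) x - D' x)) \<longlonglongrightarrow> 0"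
    using H1_0_iff[OF D', THEN iffD1, OF assms(2)] by blast
  have c1: "Ck_on (Suc 0) UNIV (\<phi> k)" "Ck_on (Suc 0) UNIV (\<phi>' k)" for k
    using \<phi>(1) \<phi>'(1) test_functionD(1) by blast+
  have w: "wgrad \<Omega> (\<lambda>x. \<phi> k x - z x) (\<lambda>x. jac (\<phi> k) x - D x)"
    "wgrad \<Omega> (\<lambda>x. \<phi>' k x - z' x) (\<lambda>x. jac (\<phi>' k) x - D' x)" for k
    by (intro wgrad_diff wgrad_C1 c1 D D')+
  have "(\<lambda>k. L2_norm \<Omega> (\<lambda>x. (\<phi> k x - z x) + (\<phi>' k x - z' x))) \<longlonglongrightarrow> 0"
    using w by (intro L2_norm_add_tendsto_0 \<phi> \<phi>') (auto simp: wgrad_def)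
  moreover have "(\<lambda>k. L2_norm \<Omega> (\<lambda>x. (jac (\<phi> k) x - D x) + (jac (\<phi>' k) x - D' x))) \<longlonglongrightarrow> 0"
    using w by (intro L2_norm_add_tendsto_0 \<phi> \<phi>') (auto simp: wgrad_def)
  ultimately show ?thesis
    unfolding H1_0_iff[OF wgrad_add[OF D D']]
    by (intro exI[of _ "\<lambda>k x. \<phi> k x + \<phi>' k x"])
      (auto simp: jac_add[OF c1] test_functions_add[OF \<phi>(1) \<phi>'(1)] add_diff_add)
qed

lemma H1_0_minus:
  assumes "z \<in> H1_0_space \<Omega>"
  shows "(\<lambda>x. - z x) \<in> H1_0_space \<Omega>"
proof -
  obtain D where D: "wgrad \<Omega> z D"
    using assms wgrad_weak_gradient by (auto simp: H1_0_space_def)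
  obtain \<phi> where \<phi>: "\<And>k. \<phi> k \<in> test_functions \<Omega>" "(\<lambda>k. L2_norm \<Omega> (\<lambda>x. \<phi> k x - z x)) \<longlonglongrightarrow> 0"
     "(\<lambda>k. L2_norm \<Omega> (\<lambda>x. jac (\<phi> k) x - D x)) \<longlonglongrightarrow> 0"
    using H1_0_iff[OF D, THEN iffD1, OF assms] by blast
  have c1: "Ck_on (Suc 0) UNIV (\<phi> k)" for k
    using \<phi>(1) test_functionD(1) by blast
  show ?thesis
    unfolding H1_0_iff[OF wgrad_minus[OF D]]
    by (intro exI[of _ "\<lambda>k x. - \<phi> k x"])
      (use \<phi> in \<open>auto simp: jac_minus[OF c1] test_functions_minus L2_norm_diff_commute[of \<Omega> z]
        L2_norm_diff_commute[of \<Omega> D]\<close>)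
qed

text \<open>Mollifications of p at a scale small against the distance from K to the complement of
  \<Omega> are test functions. Their Jacobian is the mollification of D, because differentiating the
  kernel amounts to pairing p with the derivative of a test function; so both fields and Jacobians
  converge in L2.\<close>

lemma H1_0_vanishing_near_boundary:
  assumes p: "wgrad \<Omega> p D" and K: "compact K" "K \<subseteq> \<Omega>" "\<And>x. x \<in> \<Omega> - K \<Longrightarrow> p x = 0"
  shows "p \<in> H1_0_space \<Omega>"
proof -
  note \<Omega>m = open_bounded_measurable[OF \<Omega>]
  define \<Omega>' where "\<Omega>' = \<Omega> - K"
  have \<Omega>': "open \<Omega>'" "bounded \<Omega>'" using \<Omega> K(1) by (auto simp: \<Omega>'_def open_Diff compact_imp_closed bounded_diff)
  note \<Omega>'m = open_bounded_measurable[OF \<Omega>']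
  have pL: "p \<in> L2_space \<Omega>" and DL: "D \<in> L2_space \<Omega>" and wg: "is_weak_gradient \<Omega> p D"
    using p by (auto simp: wgrad_def)
  have restr: "(\<integral>x. f x \<partial>lebesgue_on \<Omega>) = (\<integral>x. f x \<partial>lebesgue_on \<Omega>')"
    if "\<And>x. x \<in> K \<Longrightarrow> f x = 0" for f :: "real^'n \<Rightarrow> real"
  proof -
    have "(\<lambda>x. indicator \<Omega> x *\<^sub>R f x) = (\<lambda>x. indicator \<Omega>' x *\<^sub>R f x)"
      using that by (intro ext) (auto simp: indicator_def \<Omega>'_def)
    then show ?thesis using \<Omega>m \<Omega>'m by (simp add: integral_restrict_space)
  qed
  \<comment> \<open>Test functions supported in \<Omega> - K do not see p, so D is orthogonal to all
    of them.\<close>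
  have D0: "AE x in lebesgue_on \<Omega>. x \<notin> K \<longrightarrow> D x = 0"
  proof -
    have "AE x in lebesgue_on \<Omega>'. D x $ i $ j = 0" for i j
    proof (rule L2_orthogonal_test_functions[OF \<Omega>'])
      have "(\<lambda>x. D x $ i $ j) \<in> borel_measurable (lebesgue_on \<Omega>')"
        using L2_spaceD(1)[OF L2_nth_nth[OF DL]]
        by (rule measurable_restrict_mono) (auto simp: \<Omega>'_def)
      moreover have "integrable (lebesgue_on \<Omega>') (\<lambda>x. (norm (D x $ i $ j))\<^sup>2)"
        using set_integrable_subset[of lebesgue \<Omega> "\<lambda>x. (norm (D x $ i $ j))\<^sup>2" \<Omega>']
          L2_spaceD(2)[OF L2_nth_nth[OF DL]] \<Omega>'m \<Omega>m
        by (simp add: set_integrable_def integrable_restrict_space \<Omega>'_def)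
      ultimately show "(\<lambda>x. D x $ i $ j) \<in> L2_space \<Omega>'" by (simp add: L2_space_def)
      fix \<phi> :: "real^'n \<Rightarrow> real" assume \<phi>: "\<phi> \<in> test_functions \<Omega>'"
      then have \<phi>': "\<phi> \<in> test_functions \<Omega>" by (auto simp: test_functions_def \<Omega>'_def)
      have "\<phi> x = 0" if "x \<in> K" for x using test_functionD(3)[OF \<phi>] that by (intro test_functionD(4)[OF \<phi>]) (auto simp: \<Omega>'_def)
      then have "(\<integral>x. D x $ i $ j * \<phi> x \<partial>lebesgue_on \<Omega>') = (\<integral>x. D x $ i $ j * \<phi> x \<partial>lebesgue_on \<Omega>)"
        by (intro restr[symmetric]) auto
      also have "\<dots> = - (\<integral>x. p x $ i * frechet_derivative \<phi> (at x) (axis j 1) \<partial>lebesgue_on \<Omega>)"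
        using wg \<phi>' by (simp add: is_weak_gradient_def)
      also have "(\<integral>x. p x $ i * frechet_derivative \<phi> (at x) (axis j 1) \<partial>lebesgue_on \<Omega>) = (\<integral>x. 0 \<partial>lebesgue_on \<Omega>)"
      proof (rule Bochner_Integration.integral_cong[OF refl])
        fix x assume "x \<in> space (lebesgue_on \<Omega>)"
        then have x: "x \<in> \<Omega>" by simp
        show "p x $ i * frechet_derivative \<phi> (at x) (axis j 1) = 0"
        proof (cases "x \<in> K")
          case False then show ?thesis using K(3) x by simp
        next
          case True
          have "((\<lambda>x. 0) has_derivative (\<lambda>h. 0)) (at x)" by simp
          then have "(\<phi> has_derivative (\<lambda>h. 0)) (at x)"
          proof (rule has_derivative_transform_within_open[where s="- closure {x. \<phi> x \<noteq> 0}"])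
            show "x \<in> - closure {x. \<phi> x \<noteq> 0}" using test_functionD(3)[OF \<phi>] True by (auto simp: \<Omega>'_def)
            show "0 = \<phi> y" if "y \<in> - closure {x. \<phi> x \<noteq> 0}" for y
              using that by (intro test_functionD(4)[OF \<phi>, symmetric]) simp
          qed auto
          from frechet_derivative_eqI[OF this] show ?thesis by simp
        qed
      qed
      finally show "(\<integral>x. D x $ i $ j * \<phi> x \<partial>lebesgue_on \<Omega>') = 0" by simp
    qed
    then have "AE x in lebesgue_on \<Omega>'. \<forall>i\<in>UNIV. \<forall>j\<in>UNIV. D x $ i $ j = 0"
      by (intro AE_finite_allI finite_class.finite_UNIV)
    then have "AE x in lebesgue. x \<in> \<Omega>' \<longrightarrow> (\<forall>i\<in>UNIV. \<forall>j\<in>UNIV. D x $ i $ j = 0)"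
      using \<Omega>'m by (simp add: AE_restrict_space_iff)
    then have "AE x in lebesgue. x \<in> \<Omega> \<longrightarrow> x \<notin> K \<longrightarrow> D x = 0"
      by eventually_elim (auto simp: \<Omega>'_def vec_eq_iff)
    then show ?thesis using \<Omega>m by (simp add: AE_restrict_space_iff)
  qed
  \<comment> \<open>Twice \<rho> is needed: once for the neighbourhood \<open>K'\<close> that
    contains the supports, once for the kernels centred at points of \<open>K'\<close>. A third of
    the distance leaves room for both.\<close>
  obtain \<rho> where \<rho>: "\<rho> > 0" "\<And>x y. x \<in> K \<Longrightarrow> dist x y \<le> 2 * \<rho> \<Longrightarrow> y \<in> \<Omega>"
  proof (cases "K = {} \<or> - \<Omega> = {}")
    case True then show ?thesis by (intro that[of 1]) auto
  next
    case False
    then have "setdist K (- \<Omega>) > 0"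
      using K(1,2) \<Omega>(1) by (subst setdist_gt_0_compact_closed) auto
    moreover have "y \<in> \<Omega>" if "x \<in> K" "dist x y \<le> 2 * (setdist K (- \<Omega>) / 3)" for x y
      using setdist_le_dist[of x K y "- \<Omega>"] that \<open>setdist K (- \<Omega>) > 0\<close> by force
    ultimately show ?thesis by (intro that[of "setdist K (- \<Omega>) / 3"]) auto
  qed
  define \<epsilon> where "\<epsilon> k = \<rho> * inverse (real (Suc k))" for k
  have \<epsilon>: "\<And>k. \<epsilon> k > 0" "\<epsilon> \<longlonglongrightarrow> 0" "\<And>k. \<epsilon> k \<le> \<rho>"
    unfolding \<epsilon>_def using \<rho> tendsto_mult_right_zero[OF LIMSEQ_inverse_real_of_nat] 
    by (auto simp: field_simps)
  note pi = L2_imp_integrable[OF pL \<Omega>m(2)] and Di = L2_imp_integrable[OF DL \<Omega>m(2)]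
  define \<phi> where "\<phi> k = mollify \<Omega> (\<epsilon> k) p" for k
  define K' where "K' = (\<Union>x\<in>K. cball x \<rho>)"
  have K': "compact K'" "K' \<subseteq> \<Omega>"
  proof -
    have "K' = (\<lambda>(x, y). x + y) ` (K \<times> cball 0 \<rho>)"
      unfolding K'_def
    proof (intro equalityI subsetI)
      fix y assume "y \<in> (\<Union>x\<in>K. cball x \<rho>)"
      then obtain x where "x \<in> K" "dist x y \<le> \<rho>" by auto
      then show "y \<in> (\<lambda>(x, y). x + y) ` (K \<times> cball 0 \<rho>)"
        by (intro image_eqI[of _ _ "(x, y - x)"]) (auto simp: dist_norm norm_minus_commute)
    next
      fix y assume "y \<in> (\<lambda>(x, y). x + y) ` (K \<times> cball 0 \<rho>)"
      then obtain a b where "a \<in> K" "norm b \<le> \<rho>" "y = a + b" by auto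
      then show "y \<in> (\<Union>x\<in>K. cball x \<rho>)" by (intro UN_I[of a]) (auto simp: dist_norm)
    qed
    moreover have "compact ((\<lambda>(x, y). x + y) ` (K \<times> cball 0 \<rho>))"
      by (intro compact_continuous_image compact_Times K(1) compact_cball)
        (auto simp: case_prod_unfold intro!: continuous_intros)
    ultimately show "compact K'" by simp
    show "K' \<subseteq> \<Omega>" using \<rho> by (fastforce simp: K'_def)
  qed
  have far: "norm (x - y) \<ge> \<epsilon> k" if "x \<notin> K'" "y \<in> K" for x y k
    using that \<epsilon>(3)[of k] by (force simp: K'_def dist_norm norm_minus_commute)
  have mol0: "mollifier (\<epsilon> k) (x - y) = 0" if "x \<notin> K'" "y \<in> K" for x y k
    using far[OF that, of k] by (simp add: mollifier_eq_0_iff[OF \<epsilon>(1)])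
  have \<phi>0: "\<phi> k x = 0" if "x \<notin> K'" for k x
  proof -
    have "(\<integral>y. mollifier (\<epsilon> k) (x - y) *\<^sub>R p y \<partial>lebesgue_on \<Omega>) = (\<integral>y. 0 \<partial>lebesgue_on \<Omega>)"
      by (rule Bochner_Integration.integral_cong) (use mol0[OF that] K(3) in auto)
    then show ?thesis by (simp add: \<phi>_def mollify_def)
  qed
  have C: "Ck_on j UNIV (\<phi> k)" for j k
    unfolding \<phi>_def by (rule Ck_on_mollify[OF \<Omega> pi])
  have test: "\<phi> k \<in> test_functions \<Omega>" for k
  proof -
    have sub: "closure {x. \<phi> k x \<noteq> 0} \<subseteq> K'"
      using \<phi>0 K'(1) by (intro closure_minimal) (auto intro: compact_imp_closed)
    have "compact (closure {x. \<phi> k x \<noteq> 0})"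
      using bounded_subset[OF compact_imp_bounded[OF K'(1)] sub] by (simp add: compact_eq_bounded_closed)
    with sub K'(2) C show ?thesis unfolding test_functions_def by blast
  qed
  \<comment> \<open>Off \<open>K'\<close> both sides vanish, the right-hand one because D = 0 almost
    everywhere off K. On \<open>K'\<close> the kernel around x is a test function of \<Omega>, so
    the definition of the weak gradient applies.\<close>
  have jac: "jac (\<phi> k) x = mollify \<Omega> (\<epsilon> k) D x" for k x
  proof (cases "x \<in> K'")
    case False
    have "((\<lambda>x. 0) has_derivative (\<lambda>h. 0)) (at x)" by simp
    then have "(\<phi> k has_derivative (\<lambda>h. 0)) (at x)"
      by (rule has_derivative_transform_within_open[where s="- K'"])
        (use False K'(1) \<phi>0 in \<open>auto intro: compact_imp_closed\<close>)
    then have "jac (\<phi> k) x = 0" by (simp add: frechet_derivative_eqI matrix_def vec_eq_iff)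
    moreover have "mollify \<Omega> (\<epsilon> k) D x = 0"
      unfolding mollify_def
    proof (rule integral_eq_zero_AE)
      show "AE y in lebesgue_on \<Omega>. mollifier (\<epsilon> k) (x - y) *\<^sub>R D y = 0"
        using D0 by eventually_elim (use mol0[OF False] in auto)
    qed
    ultimately show ?thesis by simp
  next
    case True
    then obtain a where a: "a \<in> K" "dist a x \<le> \<rho>" by (auto simp: K'_def)
    have "cball x (\<epsilon> k) \<subseteq> \<Omega>"
    proof
      fix y assume "y \<in> cball x (\<epsilon> k)"
      then have "dist a y \<le> 2 * \<rho>" using dist_triangle[of a y x] a(2) \<epsilon>(3)[of k] by simp
      then show "y \<in> \<Omega>" by (rule \<rho>(2)[OF a(1)])
    qed
    from mollifier_test_function[OF \<epsilon>(1) this]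
    have \<psi>: "(\<lambda>y. mollifier (\<epsilon> k) (x - y)) \<in> test_functions \<Omega>" .
    \<comment> \<open>The kernel is differentiated in y instead of x; the resulting sign cancels the
      one in the definition of the weak gradient.\<close>
    have d\<psi>: "frechet_derivative (\<lambda>y. mollifier (\<epsilon> k) (x - y)) (at y) h =
        - frechet_derivative (mollifier (\<epsilon> k)) (at (x - y)) h" for y h
    proof -
      have md: "(mollifier (\<epsilon> k) has_derivative frechet_derivative (mollifier (\<epsilon> k)) (at (x - y))) (at (x - y))"
        using Ck_on_Suc_has_derivative[OF Ck_on_mollifier] by simp
      have "((\<lambda>y. x - y) has_derivative (\<lambda>h. - h)) (at y)" by (auto intro!: derivative_eq_intros)
      from has_derivative_compose[OF this md] have "((\<lambda>y. mollifier (\<epsilon> k) (x - y)) has_derivative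
          (\<lambda>h. frechet_derivative (mollifier (\<epsilon> k)) (at (x - y)) (- h))) (at y)" .
      then show ?thesis
        using linear_neg[OF has_derivative_linear[OF md]] by (simp add: frechet_derivative_eqI)
    qed
    have "jac (\<phi> k) x $ i $ j = mollify \<Omega> (\<epsilon> k) D x $ i $ j" for i j
    proof -
      have int: "integrable (lebesgue_on \<Omega>) (\<lambda>y. frechet_derivative (mollifier (\<epsilon> k)) (at (x - y)) (axis j 1) *\<^sub>R p y)"
      proof (rule integrable_translate[where g="\<lambda>z. frechet_derivative (mollifier (\<epsilon> k)) (at z) (axis j 1)", OF pi,
            where T="closure \<Omega>" and W=UNIV])
        show "(\<lambda>y. y) \<in> borel_measurable (lebesgue_on \<Omega>)"
          using \<Omega>m by (intro continuous_imp_measurable_on_sets_lebesgue) auto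
        show "continuous_on UNIV (\<lambda>z. frechet_derivative (mollifier (\<epsilon> k)) (at z) (axis j 1))"
          by (rule Ck_on_1_directional[OF Ck_on_mollifier])
      qed (use \<Omega> closure_subset in auto)
      have "jac (\<phi> k) x $ i $ j = (\<integral>y. frechet_derivative (mollifier (\<epsilon> k)) (at (x - y)) (axis j 1) *\<^sub>R p y \<partial>lebesgue_on \<Omega>) $ i"
        by (simp add: matrix_def \<phi>_def frechet_derivative_mollify[OF \<Omega> pi])
      also have "\<dots> = (\<integral>y. (frechet_derivative (mollifier (\<epsilon> k)) (at (x - y)) (axis j 1) *\<^sub>R p y) $ i \<partial>lebesgue_on \<Omega>)"
        by (rule integral_bounded_linear[OF bounded_linear_vec_nth int, symmetric])
      also have "\<dots> = - (\<integral>y. p y $ i * frechet_derivative (\<lambda>y. mollifier (\<epsilon> k) (x - y)) (at y) (axis j 1) \<partial>lebesgue_on \<Omega>)"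
        by (simp add: d\<psi> mult.commute)
      also have "\<dots> = (\<integral>y. D y $ i $ j * mollifier (\<epsilon> k) (x - y) \<partial>lebesgue_on \<Omega>)"
        using wg \<psi> by (simp add: is_weak_gradient_def)
      also have "\<dots> = (\<integral>y. (mollifier (\<epsilon> k) (x - y) *\<^sub>R D y) $ i $ j \<partial>lebesgue_on \<Omega>)"
        by (simp add: mult.commute)
      also have "\<dots> = mollify \<Omega> (\<epsilon> k) D x $ i $ j"
        unfolding mollify_def
        by (rule integral_bounded_linear[OF bounded_linear_compose[OF bounded_linear_vec_nth bounded_linear_vec_nth]
              integrable_mollifier_scaleR[OF \<Omega> Di]])
      finally show ?thesis .
    qed
    then show ?thesis by (simp add: vec_eq_iff)
  qed
  show ?thesis
    unfolding H1_0_iff[OF p]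
  proof (intro exI[of _ \<phi>] conjI allI test)
    show "(\<lambda>k. L2_norm \<Omega> (\<lambda>x. \<phi> k x - p x)) \<longlonglongrightarrow> 0"
      unfolding \<phi>_def by (rule mollify_tendsto_L2[OF \<Omega> pL \<epsilon>(1,2)])
    show "(\<lambda>k. L2_norm \<Omega> (\<lambda>x. jac (\<phi> k) x - D x)) \<longlonglongrightarrow> 0"
      unfolding jac by (rule mollify_tendsto_L2[OF \<Omega> DL \<epsilon>(1,2)])
  qed
qed

end

subsection \<open>A Poincare inequality and stability of the elasticity problem\<close>

lemma L2_norm_nth_le:
  fixes v :: "real^'n \<Rightarrow> real^'m"
  assumes "v \<in> L2_space \<Omega>" shows "L2_norm \<Omega> (\<lambda>x. v x $ i) \<le> L2_norm \<Omega> v"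
  using L2_norm_le(2)[OF L2_spaceD(1)[OF L2_nth[OF assms]] assms, of 1 i] component_le_norm_cart by auto

lemma L2_norm_nth_nth_le:
  fixes D :: "real^'n \<Rightarrow> real^'m^'p"
  assumes "D \<in> L2_space \<Omega>" shows "L2_norm \<Omega> (\<lambda>x. D x $ i $ j) \<le> L2_norm \<Omega> D"
proof -
  have "norm (D x $ i $ j) \<le> 1 * norm (D x)" for x
    using component_le_norm_cart[of "D x $ i" j] Finite_Cartesian_Product.norm_nth_le[of "D x" i] by simp
  then show ?thesis
    using L2_norm_le(2)[OF L2_spaceD(1)[OF L2_nth_nth[OF assms]] assms, of 1 i j] by auto
qed

lemma L2_norm_le_sum_nth:
  fixes v :: "real^'n \<Rightarrow> real^'m"
  assumes "v \<in> L2_space \<Omega>"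
  shows "L2_norm \<Omega> v \<le> (\<Sum>i\<in>UNIV. L2_norm \<Omega> (\<lambda>x. v x $ i))"
proof -
  have "(\<lambda>x. \<Sum>i\<in>I. \<bar>v x $ i\<bar>) \<in> L2_space \<Omega> \<and>
      L2_norm \<Omega> (\<lambda>x. \<Sum>i\<in>I. \<bar>v x $ i\<bar>) \<le> (\<Sum>i\<in>I. L2_norm \<Omega> (\<lambda>x. v x $ i))" if "finite I" for I
    using that
  proof (induction I rule: finite_induct)
    case empty
    then show ?case by (simp add: L2_space_def L2_norm_def)
  next
    case (insert i I)
    have a: "(\<lambda>x. \<bar>v x $ i\<bar>) \<in> L2_space \<Omega>" "L2_norm \<Omega> (\<lambda>x. \<bar>v x $ i\<bar>) = L2_norm \<Omega> (\<lambda>x. v x $ i)"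
      using L2_nth[OF assms, of i] by (auto simp: L2_space_def L2_norm_def)
    show ?case
      using insert L2_add[OF a(1), of "\<lambda>x. \<Sum>i\<in>I. \<bar>v x $ i\<bar>"] a(2) by auto
  qed
  from this[of UNIV] have s: "(\<lambda>x. \<Sum>i\<in>UNIV. \<bar>v x $ i\<bar>) \<in> L2_space \<Omega>"
      "L2_norm \<Omega> (\<lambda>x. \<Sum>i\<in>UNIV. \<bar>v x $ i\<bar>) \<le> (\<Sum>i\<in>UNIV. L2_norm \<Omega> (\<lambda>x. v x $ i))" by auto
  have "L2_norm \<Omega> v \<le> 1 * L2_norm \<Omega> (\<lambda>x. \<Sum>i\<in>UNIV. \<bar>v x $ i\<bar>)"
    using L2_spaceD(1)[OF assms]
    by (intro L2_norm_le(2)[OF _ s(1)]) (auto simp: norm_le_l1_cart sum_nonneg)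
  then show ?thesis using s(2) by simp
qed

context
  fixes \<Omega> :: "(real^'n) set"
  assumes \<Omega>: "open \<Omega>" "bounded \<Omega>"
begin

text \<open>Integrating \<open>\<partial>\<^sub>i (x\<^sub>i \<phi>\<^sup>2)\<close> gives the inequality with only the \<open>i\<close>-th partial derivative. Applied to the
  \<open>i\<close>-th component of a field it involves only diagonal entries of the strain, so that no Korn
  inequality is needed.\<close>

lemma poincare_test_function:
  fixes \<phi> :: "real^'n \<Rightarrow> real"
  assumes \<phi>: "Ck_on (Suc 0) UNIV \<phi>" and K: "compact K" "\<And>x. x \<notin> K \<Longrightarrow> \<phi> x = 0" "K \<subseteq> \<Omega>"
    and R: "\<And>x. x \<in> \<Omega> \<Longrightarrow> norm x \<le> R" "R \<ge> 0"
  shows "L2_norm \<Omega> \<phi> \<le> 2 * R * L2_norm \<Omega> (\<lambda>x. frechet_derivative \<phi> (at x) (axis i 1))"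
proof -
  define d where "d x = frechet_derivative \<phi> (at x) (axis i 1)" for x
  have \<phi>L: "\<phi> \<in> L2_space \<Omega>" and dL: "d \<in> L2_space \<Omega>"
    using continuous_L2[OF \<Omega> Ck_on_imp_continuous_on[OF \<phi>]] continuous_L2[OF \<Omega> Ck_on_1_directional[OF \<phi>]]
    by (auto simp: d_def[abs_def])
  have x1: "Ck_on (Suc 0) UNIV (\<lambda>x::real^'n. x $ i)"
    by (intro Ck_on_bounded_linear_compose[OF _ bounded_linear_vec_nth] Ck_on_ident) auto
  have dx: "frechet_derivative (\<lambda>x::real^'n. x $ i) (at x) h = h $ i" for x h
    by (rule frechet_derivative_eqI[OF bounded_linear_imp_has_derivative[OF bounded_linear_vec_nth]])
  have d2: "frechet_derivative (\<lambda>x. \<phi> x * \<phi> x) (at x) (axis i 1) = 2 * (\<phi> x * d x)" for x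
  proof -
    have "((\<lambda>x. \<phi> x * \<phi> x) has_derivative (\<lambda>h. \<phi> x * frechet_derivative \<phi> (at x) h
       + frechet_derivative \<phi> (at x) h * \<phi> x)) (at x)"
      by (intro has_derivative_mult Ck_on_Suc_has_derivative[OF \<phi>]) auto
    from frechet_derivative_eqI[OF this] show ?thesis by (simp add: d_def)
  qed
  have "(\<integral>x. x $ i * (2 * (\<phi> x * d x)) \<partial>lebesgue_on \<Omega>) = - (\<integral>x. \<phi> x * \<phi> x \<partial>lebesgue_on \<Omega>)"
    using integration_by_parts[OF \<Omega> x1 Ck_on_mult[OF _ \<phi> \<phi>] K(1) _ K(3), of "axis i 1"] K(2)
    by (simp add: dx d2)
  then have "(L2_norm \<Omega> \<phi>)\<^sup>2 = - (\<integral>x. x $ i * (2 * (\<phi> x * d x)) \<partial>lebesgue_on \<Omega>)"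
    unfolding L2_norm_power2 by (simp add: power2_eq_square)
  also have "\<dots> \<le> (\<integral>x. 2 * R * (norm (\<phi> x) * norm (d x)) \<partial>lebesgue_on \<Omega>)"
  proof -
    have le: "\<bar>x $ i * (2 * (\<phi> x * d x))\<bar> \<le> 2 * R * (norm (\<phi> x) * norm (d x))" if "x \<in> \<Omega>" for x
    proof -
      have "\<bar>x $ i\<bar> \<le> R" using component_le_norm_cart[of x i] R(1)[OF that] by simp
      then have "\<bar>x $ i\<bar> * (2 * (\<bar>\<phi> x\<bar> * \<bar>d x\<bar>)) \<le> R * (2 * (\<bar>\<phi> x\<bar> * \<bar>d x\<bar>))" by (intro mult_right_mono) auto
      then show ?thesis by (simp add: abs_mult)
    qed
    have i1: "integrable (lebesgue_on \<Omega>) (\<lambda>x. 2 * R * (norm (\<phi> x) * norm (d x)))"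
      using integrable_norm_mult_L2[OF \<phi>L dL] by auto
    have "\<bar>\<integral>x. x $ i * (2 * (\<phi> x * d x)) \<partial>lebesgue_on \<Omega>\<bar> \<le> (\<integral>x. \<bar>x $ i * (2 * (\<phi> x * d x))\<bar> \<partial>lebesgue_on \<Omega>)"
      using integral_norm_bound[of "lebesgue_on \<Omega>" "\<lambda>x. x $ i * (2 * (\<phi> x * d x))"] by simp
    also have "\<dots> \<le> (\<integral>x. 2 * R * (norm (\<phi> x) * norm (d x)) \<partial>lebesgue_on \<Omega>)"
      by (rule integral_mono_AE') (use i1 le R(2) in \<open>auto intro!: AE_I2 simp: mult_nonneg_nonneg\<close>)
    finally show ?thesis by linarith
  qed
  also have "\<dots> = 2 * R * (\<integral>x. norm (\<phi> x) * norm (d x) \<partial>lebesgue_on \<Omega>)" by simp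
  also have "\<dots> \<le> 2 * R * (L2_norm \<Omega> \<phi> * L2_norm \<Omega> d)"
    using R(2) by (intro mult_left_mono L2_Cauchy_Schwarz_norm \<phi>L dL) auto
  finally have *: "L2_norm \<Omega> \<phi> * L2_norm \<Omega> \<phi> \<le> L2_norm \<Omega> \<phi> * (2 * R * L2_norm \<Omega> d)"
    by (simp add: power2_eq_square mult_ac)
  show ?thesis
  proof (cases "L2_norm \<Omega> \<phi> = 0")
    case True
    then show ?thesis using R(2) by (simp add: mult_nonneg_nonneg L2_norm_nonneg)
  next
    case False
    then have "L2_norm \<Omega> \<phi> > 0" using L2_norm_nonneg[of \<Omega> \<phi>] by simp
    with * show ?thesis by (simp add: d_def[abs_def])
  qed
qed

text \<open>Both sides are continuous along the approximating test functions: the left involves only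
  values, the right only one entry of the Jacobian.\<close>

lemma poincare_H1_0:
  assumes z: "z \<in> H1_0_space \<Omega>" "wgrad \<Omega> z D" and R: "\<And>x. x \<in> \<Omega> \<Longrightarrow> norm x \<le> R" "R \<ge> 0"
  shows "L2_norm \<Omega> (\<lambda>x. z x $ i) \<le> 2 * R * L2_norm \<Omega> (\<lambda>x. D x $ i $ i)"
proof -
  obtain \<phi> where \<phi>: "\<And>k. \<phi> k \<in> test_functions \<Omega>" "(\<lambda>k. L2_norm \<Omega> (\<lambda>x. \<phi> k x - z x)) \<longlonglongrightarrow> 0"
     "(\<lambda>k. L2_norm \<Omega> (\<lambda>x. jac (\<phi> k) x - D x)) \<longlonglongrightarrow> 0"
    using H1_0_iff[OF \<Omega> z(2), THEN iffD1, OF z(1)] by blast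
  let ?A = "\<lambda>k. L2_norm \<Omega> (\<lambda>x. \<phi> k x - z x)" and ?B = "\<lambda>k. L2_norm \<Omega> (\<lambda>x. jac (\<phi> k) x - D x)"
  have L: "z \<in> L2_space \<Omega>" "D \<in> L2_space \<Omega>" using z(2) by (auto simp: wgrad_def)
  have le: "L2_norm \<Omega> (\<lambda>x. z x $ i) \<le> ?A k + 2 * R * (L2_norm \<Omega> (\<lambda>x. D x $ i $ i) + ?B k)" for k
  proof -
    have C: "Ck_on (Suc 0) UNIV (\<phi> k)" by (rule test_functionD(1)[OF \<phi>(1)])
    have \<phi>L: "\<phi> k \<in> L2_space \<Omega>" "jac (\<phi> k) \<in> L2_space \<Omega>"
      using wgrad_C1[OF \<Omega> C] by (auto simp: wgrad_def)
    have Ci: "Ck_on (Suc 0) UNIV (\<lambda>x. \<phi> k x $ i)"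
      by (rule Ck_on_bounded_linear_compose[OF _ bounded_linear_vec_nth C]) simp
    have "L2_norm \<Omega> (\<lambda>x. \<phi> k x $ i) \<le> 2 * R * L2_norm \<Omega> (\<lambda>x. frechet_derivative (\<lambda>x. \<phi> k x $ i) (at x) (axis i 1))"
    proof (rule poincare_test_function[OF Ci test_functionD(2)[OF \<phi>(1)[of k]] _ test_functionD(3)[OF \<phi>(1)] R])
      show "\<phi> k x $ i = 0" if "x \<notin> closure {x. \<phi> k x \<noteq> 0}" for x
        using test_functionD(4)[OF \<phi>(1) that] by simp
    qed
    also have "(\<lambda>x. frechet_derivative (\<lambda>x. \<phi> k x $ i) (at x) (axis i 1)) = (\<lambda>x. jac (\<phi> k) x $ i $ i)"
      by (simp add: frechet_derivative_nth[OF C] matrix_def)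
    finally have 1: "L2_norm \<Omega> (\<lambda>x. \<phi> k x $ i) \<le> 2 * R * L2_norm \<Omega> (\<lambda>x. jac (\<phi> k) x $ i $ i)" .
    have "L2_norm \<Omega> (\<lambda>x. jac (\<phi> k) x $ i $ i)
        = L2_norm \<Omega> (\<lambda>x. D x $ i $ i + (jac (\<phi> k) x - D x) $ i $ i)" by simp
    also have "\<dots> \<le> L2_norm \<Omega> (\<lambda>x. D x $ i $ i) + L2_norm \<Omega> (\<lambda>x. (jac (\<phi> k) x - D x) $ i $ i)"
      by (intro L2_add(2) L2_nth_nth L2_diff(1) L \<phi>L)
    also have "L2_norm \<Omega> (\<lambda>x. (jac (\<phi> k) x - D x) $ i $ i) \<le> ?B k"
      by (intro L2_norm_nth_nth_le L2_diff(1) L \<phi>L)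
    finally have "2 * R * L2_norm \<Omega> (\<lambda>x. jac (\<phi> k) x $ i $ i) \<le> 2 * R * (L2_norm \<Omega> (\<lambda>x. D x $ i $ i) + ?B k)"
      using R(2) by (intro mult_left_mono) auto
    moreover have "L2_norm \<Omega> (\<lambda>x. z x $ i) \<le> L2_norm \<Omega> (\<lambda>x. \<phi> k x $ i) + ?A k"
    proof -
      have "L2_norm \<Omega> (\<lambda>x. z x $ i) = L2_norm \<Omega> (\<lambda>x. \<phi> k x $ i - (\<phi> k x - z x) $ i)" by simp
      also have "\<dots> \<le> L2_norm \<Omega> (\<lambda>x. \<phi> k x $ i) + L2_norm \<Omega> (\<lambda>x. (\<phi> k x - z x) $ i)"
        by (intro L2_diff L2_nth L \<phi>L)
      also have "L2_norm \<Omega> (\<lambda>x. (\<phi> k x - z x) $ i) \<le> ?A k"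
        by (intro L2_norm_nth_le L2_diff(1) L \<phi>L)
      finally show ?thesis by simp
    qed
    ultimately show ?thesis using 1 by linarith
  qed
  have "(\<lambda>k. ?A k + 2 * R * (L2_norm \<Omega> (\<lambda>x. D x $ i $ i) + ?B k))
     \<longlonglongrightarrow> 0 + 2 * R * (L2_norm \<Omega> (\<lambda>x. D x $ i $ i) + 0)"
    by (intro tendsto_intros \<phi>)
  then show ?thesis
    using le by (intro LIMSEQ_le_const[of _ "2 * R * L2_norm \<Omega> (\<lambda>x. D x $ i $ i)"]) auto
qed

end

section \<open>Pointwise algebra of Hooke's law\<close>

definition symm :: "real^'n^'n \<Rightarrow> real^'n^'n" where
  "symm A = (1/2) *\<^sub>R (A + transpose A)"

text \<open>Hooke's law on matrices, detached from the chosen weak gradient, so that it applies to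
  any representative and can be estimated by linear algebra.\<close>

definition hooke :: "real \<Rightarrow> real \<Rightarrow> real^'n^'n \<Rightarrow> real^'n^'n" where
  "hooke E \<nu> S = (E / (1 + \<nu>)) *\<^sub>R (S + (\<nu> / (1 - 2 * \<nu>) * trace S) *\<^sub>R mat 1)"

lemma strain_eq_symm: "strain \<Omega> v x = symm (weak_gradient \<Omega> v x)"
  by (simp add: strain_def symm_def)

lemma stress_eq_hooke: "stress E \<nu> \<Omega> v x = hooke E \<nu> (symm (weak_gradient \<Omega> v x))"
  by (simp add: stress_def hooke_def strain_eq_symm)

lemma bounded_linear_symm: "bounded_linear (symm :: real^'n^'n \<Rightarrow> _)"
proof -
  have "linear (symm :: real^'n^'n \<Rightarrow> _)"
    by (rule linearI) (auto simp: symm_def transpose_def vec_eq_iff field_simps)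
  then show ?thesis by (simp add: linear_conv_bounded_linear)
qed

lemma bounded_linear_hooke: "bounded_linear (hooke E \<nu> :: real^'n^'n \<Rightarrow> _)"
proof -
  have "linear (hooke E \<nu> :: real^'n^'n \<Rightarrow> _)"
    by (rule linearI)
      (auto simp: hooke_def trace_def sum.distrib sum_distrib_left[symmetric] algebra_simps
        scaleR_add_left scaleR_add_right)
  then show ?thesis by (simp add: linear_conv_bounded_linear)
qed

lemma inner_mat_1: "A \<bullet> mat 1 = trace (A :: real^'n^'n)"
proof -
  have "A $ i \<bullet> mat 1 $ i = A $ i $ i" for i
    by (simp add: inner_vec_def mat_def if_distrib cong: if_cong)
  then show ?thesis by (simp add: inner_vec_def[of A] trace_def)
qed

lemma hooke_coercive:
  assumes "CARD('n) = 2 \<or> CARD('n) = 3" "E > 0" "-1 < \<nu>" "\<nu> < 1/2"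
  obtains c where "c > 0" "\<And>S::real^'n^'n. c * (S \<bullet> S) \<le> hooke E \<nu> S \<bullet> S"
proof -
  define d where "d = real CARD('n)"
  define m where "m = min 1 (1 + d * (\<nu> / (1 - 2 * \<nu>)))"
  \<comment> \<open>This is the numerator of 1 + d \<nu> / (1 - 2 \<nu>), the second candidate in
    \<open>m\<close>. For d = 2 it equals 1, for d = 3 it equals 1 + \<nu>.\<close>
  have d: "1 + (d - 2) * \<nu> > 0" using assms by (auto simp: d_def)
  have m: "m > 0" "m \<le> 1" "m \<le> 1 + d * (\<nu> / (1 - 2 * \<nu>))"
    using d assms by (auto simp: m_def field_simps)
  have tr: "(trace S)\<^sup>2 \<le> d * (S \<bullet> S)" for S :: "real^'n^'n"
  proof -
    have "(S \<bullet> mat 1)\<^sup>2 \<le> (S \<bullet> S) * ((mat 1 :: real^'n^'n) \<bullet> mat 1)" by (rule Cauchy_Schwarz_ineq)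
    moreover have "(mat 1 :: real^'n^'n) \<bullet> mat 1 = d" by (simp only: inner_mat_1) (simp add: trace_def mat_def d_def)
    ultimately show ?thesis by (simp add: inner_mat_1 mult.commute)
  qed
  show ?thesis
  proof (rule that[of "E / (1 + \<nu>) * m"])
    show "E / (1 + \<nu>) * m > 0" using assms m by auto
    fix S :: "real^'n^'n"
    define l where "l = \<nu> / (1 - 2 * \<nu>)"
    have "m * (S \<bullet> S) \<le> S \<bullet> S + l * (trace S)\<^sup>2"
    proof (cases "\<nu> \<ge> 0")
      case True
      then have "l \<ge> 0" using assms by (simp add: l_def)
      then have "l * (trace S)\<^sup>2 \<ge> 0" by simp
      moreover have "m * (S \<bullet> S) \<le> 1 * (S \<bullet> S)" using m by (intro mult_right_mono) auto
      ultimately show ?thesis by linarith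
    next
      case False
      then have "l \<le> 0" using assms by (simp add: l_def divide_nonpos_nonneg)
      then have "l * (d * (S \<bullet> S)) \<le> l * (trace S)\<^sup>2" using tr by (intro mult_left_mono_neg)
      moreover have "m * (S \<bullet> S) \<le> (1 + d * l) * (S \<bullet> S)"
        using m(3) by (intro mult_right_mono) (auto simp: l_def)
      ultimately show ?thesis by (simp add: algebra_simps)
    qed
    then have "E / (1 + \<nu>) * (m * (S \<bullet> S)) \<le> E / (1 + \<nu>) * (S \<bullet> S + l * (trace S)\<^sup>2)"
      using assms by (intro mult_left_mono) auto
    also have "\<dots> = hooke E \<nu> S \<bullet> S"
      by (simp add: hooke_def inner_add_left l_def inner_commute[of "mat 1"] inner_mat_1 power2_eq_square)
    finally show "E / (1 + \<nu>) * m * (S \<bullet> S) \<le> hooke E \<nu> S \<bullet> S" by (simp add: mult.assoc)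
  qed
qed

text \<open>Energy estimate through a C1 field g that carries the difference of the boundary data
  near the boundary. The constant depends on \<Omega>, E and \<nu> only and is obtained before the
  solutions are given, so it serves all quadrature rules at once.\<close>

lemma elastic_stability:
  fixes \<Omega> :: "(real^'n) set"
  assumes \<Omega>: "open \<Omega>" "bounded \<Omega>"
    and par: "CARD('n) = 2 \<or> CARD('n) = 3" "E > 0" "-1 < \<nu>" "\<nu> < 1/2"
  obtains C where "C > 0"
    "\<And>g\<^sub>1 g\<^sub>2 v\<^sub>1 v\<^sub>2 g \<eta> U. \<lbrakk>elastic_weak_solution E \<nu> \<Omega> g\<^sub>1 v\<^sub>1; elastic_weak_solution E \<nu> \<Omega> g\<^sub>2 v\<^sub>2;
       Ck_on (Suc 0) UNIV g; open U; frontier \<Omega> \<subseteq> U; \<forall>x\<in>U \<inter> \<Omega>. g x = g\<^sub>2 x - g\<^sub>1 x;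
       \<eta> \<ge> 0; \<forall>x\<in>\<Omega>. norm (g x) \<le> \<eta>; \<forall>x\<in>\<Omega>. norm (jac g x) \<le> \<eta>\<rbrakk> \<Longrightarrow>
     (\<lambda>x. v\<^sub>2 x - v\<^sub>1 x) \<in> L2_space \<Omega> \<and> L2_norm \<Omega> (\<lambda>x. v\<^sub>2 x - v\<^sub>1 x) \<le> C * \<eta>"
proof -
  obtain R where R: "R > 0" "\<And>x. x \<in> \<Omega> \<Longrightarrow> norm x \<le> R" using \<Omega>(2) by (auto simp: bounded_pos)
  obtain c where c: "c > 0" "\<And>S::real^'n^'n. c * (S \<bullet> S) \<le> hooke E \<nu> S \<bullet> S"
    using hooke_coercive[OF par] by metis
  let ?\<sigma> = "\<lambda>A::real^'n^'n. hooke E \<nu> (symm A)"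
  have bl: "bounded_linear ?\<sigma>" by (rule bounded_linear_compose[OF bounded_linear_hooke bounded_linear_symm])
  define B where "B = onorm ?\<sigma>"
  have B: "B \<ge> 0" unfolding B_def by (rule onorm_pos_le[OF bl])
  define V where "V = sqrt (measure lebesgue \<Omega>)"
  have V: "V \<ge> 0" by (simp add: V_def)
  \<comment> \<open>Poincare contributes 2 R for each component, boundedness and coercivity of
    Hooke's law contribute B / c, and V turns sup bounds into L2 bounds. The 1 inside the bracket
    accounts for g itself, the last 1 makes C positive.\<close>
  define C where "C = (real CARD('n) * (2 * R) * (B / c) + 1) * V + 1"
  have "C > 0" using R B c V by (auto simp: C_def intro!: add_nonneg_pos mult_nonneg_nonneg add_nonneg_nonneg)
  note \<Omega>m = open_bounded_measurable[OF \<Omega>]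
  show ?thesis
  proof (rule that[OF \<open>C > 0\<close>])
    fix g\<^sub>1 g\<^sub>2 v\<^sub>1 v\<^sub>2 g :: "real^'n \<Rightarrow> real^'n" and \<eta> :: real and U
    assume s1: "elastic_weak_solution E \<nu> \<Omega> g\<^sub>1 v\<^sub>1" and s2: "elastic_weak_solution E \<nu> \<Omega> g\<^sub>2 v\<^sub>2"
      and g: "Ck_on (Suc 0) UNIV g" and U: "open U" "frontier \<Omega> \<subseteq> U" "\<forall>x\<in>U \<inter> \<Omega>. g x = g\<^sub>2 x - g\<^sub>1 x"
      and "\<eta> \<ge> 0" "\<forall>x\<in>\<Omega>. norm (g x) \<le> \<eta>" "\<forall>x\<in>\<Omega>. norm (jac g x) \<le> \<eta>"
    then have \<eta>: "\<eta> \<ge> 0" "\<And>x. x \<in> \<Omega> \<Longrightarrow> norm (g x) \<le> \<eta>" "\<And>x. x \<in> \<Omega> \<Longrightarrow> norm (jac g x) \<le> \<eta>"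
      by auto
    define D\<^sub>1 D\<^sub>2 where "D\<^sub>1 = weak_gradient \<Omega> v\<^sub>1" and "D\<^sub>2 = weak_gradient \<Omega> v\<^sub>2"
    have w1: "wgrad \<Omega> v\<^sub>1 D\<^sub>1" and w2: "wgrad \<Omega> v\<^sub>2 D\<^sub>2"
      using s1 s2 by (auto simp: elastic_weak_solution_def D\<^sub>1_def D\<^sub>2_def intro: wgrad_weak_gradient)
    note wg = wgrad_C1[OF \<Omega> g]
    define z where "z x = (v\<^sub>2 x - v\<^sub>1 x) - g x" for x
    define D where "D x = (D\<^sub>2 x - D\<^sub>1 x) - jac g x" for x
    have wz: "wgrad \<Omega> z D"
      unfolding z_def[abs_def] D_def[abs_def] by (intro wgrad_diff[OF \<Omega>] w1 w2 wg)
    have z0: "z \<in> H1_0_space \<Omega>"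
    proof -
      obtain g\<^sub>1' U\<^sub>1 where g1: "g\<^sub>1' \<in> H1_space \<Omega>" "open U\<^sub>1" "frontier \<Omega> \<subseteq> U\<^sub>1" "\<And>x. x \<in> U\<^sub>1 \<inter> \<Omega> \<Longrightarrow> g\<^sub>1' x = g\<^sub>1 x"
         "(\<lambda>x. v\<^sub>1 x - g\<^sub>1' x) \<in> H1_0_space \<Omega>"
        using s1 by (auto simp: elastic_weak_solution_def has_boundary_values_def)
      obtain g\<^sub>2' U\<^sub>2 where g2: "g\<^sub>2' \<in> H1_space \<Omega>" "open U\<^sub>2" "frontier \<Omega> \<subseteq> U\<^sub>2" "\<And>x. x \<in> U\<^sub>2 \<inter> \<Omega> \<Longrightarrow> g\<^sub>2' x = g\<^sub>2 x"
         "(\<lambda>x. v\<^sub>2 x - g\<^sub>2' x) \<in> H1_0_space \<Omega>"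
        using s2 by (auto simp: elastic_weak_solution_def has_boundary_values_def)
      \<comment> \<open>Near the boundary both extensions and g agree with their data, so
        \<open>g\<^sub>2' - g\<^sub>1' - g\<close> can be nonzero in \<Omega> only on this compact
        subset.\<close>
      define K where "K = closure \<Omega> - (U \<inter> U\<^sub>1 \<inter> U\<^sub>2)"
      have "compact K" unfolding K_def using \<Omega> U(1) g1(2) g2(2) by (intro compact_diff) auto
      moreover have "K \<subseteq> \<Omega>" using U(2) g1(3) g2(3) \<Omega>(1)
        by (auto simp: K_def frontier_def interior_open)
      moreover have "(g\<^sub>2' x - g\<^sub>1' x) - g x = 0" if "x \<in> \<Omega> - K" for x
      proof -
        have "x \<in> U \<inter> \<Omega>" "x \<in> U\<^sub>1 \<inter> \<Omega>" "x \<in> U\<^sub>2 \<inter> \<Omega>"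
          using that closure_subset[of \<Omega>] by (auto simp: K_def)
        then show ?thesis using U(3) g1(4) g2(4) by simp
      qed
      ultimately have "(\<lambda>x. (g\<^sub>2' x - g\<^sub>1' x) - g x) \<in> H1_0_space \<Omega>"
        using H1_0_vanishing_near_boundary[OF \<Omega> wgrad_diff[OF \<Omega> wgrad_diff[OF \<Omega>
              wgrad_weak_gradient[OF g2(1)] wgrad_weak_gradient[OF g1(1)]] wg]] by blast
      from H1_0_add[OF \<Omega> H1_0_add[OF \<Omega> g2(5) H1_0_minus[OF \<Omega> g1(5)]] this]
      have "(\<lambda>x. (v\<^sub>2 x - g\<^sub>2' x + - (v\<^sub>1 x - g\<^sub>1' x)) + (g\<^sub>2' x - g\<^sub>1' x - g x)) \<in> H1_0_space \<Omega>" .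
      moreover have "(\<lambda>x. (v\<^sub>2 x - g\<^sub>2' x + - (v\<^sub>1 x - g\<^sub>1' x)) + (g\<^sub>2' x - g\<^sub>1' x - g x)) = z"
        by (simp add: z_def[abs_def] algebra_simps)
      ultimately show ?thesis by simp
    qed
    have L: "D \<in> L2_space \<Omega>" "D\<^sub>1 \<in> L2_space \<Omega>" "D\<^sub>2 \<in> L2_space \<Omega>" "jac g \<in> L2_space \<Omega>" "g \<in> L2_space \<Omega>"
      "z \<in> L2_space \<Omega>"
      using wz w1 w2 wg by (auto simp: wgrad_def)
    have sL: "(\<lambda>x. symm (D x)) \<in> L2_space \<Omega>" by (rule L2_bounded_linear(1)[OF L(1) bounded_linear_symm])
    have \<sigma>L: "(\<lambda>x. ?\<sigma> (A x)) \<in> L2_space \<Omega>" if "A \<in> L2_space \<Omega>" for A by (rule L2_bounded_linear(1)[OF that bl])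
    \<comment> \<open>The weak equation tested with z involves the strain formed from the chosen
      gradient of z, which equals \<open>symm (D x)\<close> almost everywhere.\<close>
    have ortho: "(\<integral>x. ?\<sigma> (weak_gradient \<Omega> v x) \<bullet> symm (D x) \<partial>lebesgue_on \<Omega>) = 0"
      if s: "elastic_weak_solution E \<nu> \<Omega> g' v" for v g'
    proof -
      have wv: "weak_gradient \<Omega> v \<in> L2_space \<Omega>"
        using s wgrad_weak_gradient by (auto simp: elastic_weak_solution_def wgrad_def)
      have wz': "wgrad \<Omega> z (weak_gradient \<Omega> z)" using wgrad_weak_gradient[OF wgrad_H1_space[OF wz]] .
      then have Lz: "(\<lambda>x. symm (weak_gradient \<Omega> z x)) \<in> L2_space \<Omega>"
        by (intro L2_bounded_linear(1)[OF _ bounded_linear_symm]) (auto simp: wgrad_def)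
      have "(\<integral>x. ?\<sigma> (weak_gradient \<Omega> v x) \<bullet> symm (D x) \<partial>lebesgue_on \<Omega>) =
        (\<integral>x. ?\<sigma> (weak_gradient \<Omega> v x) \<bullet> symm (weak_gradient \<Omega> z x) \<partial>lebesgue_on \<Omega>)"
      proof (rule integral_cong_AE)
        show "AE x in lebesgue_on \<Omega>. ?\<sigma> (weak_gradient \<Omega> v x) \<bullet> symm (D x)
            = ?\<sigma> (weak_gradient \<Omega> v x) \<bullet> symm (weak_gradient \<Omega> z x)"
          using wgrad_unique[OF \<Omega> wz wz'] by eventually_elim simp
      qed (use integrable_inner_L2[OF \<sigma>L[OF wv] sL] integrable_inner_L2[OF \<sigma>L[OF wv] Lz] in auto)
      also have "\<dots> = 0"
        using s z0 by (simp add: elastic_weak_solution_def strain_eq_symm stress_eq_hooke)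
      finally show ?thesis .
    qed
    have lin: "?\<sigma> (D x) = ?\<sigma> (D\<^sub>2 x) - ?\<sigma> (D\<^sub>1 x) - ?\<sigma> (jac g x)" for x
      unfolding D_def by (simp add: linear_diff[OF bounded_linear.linear[OF bl]])
    have int: "integrable (lebesgue_on \<Omega>) (\<lambda>x. ?\<sigma> (A x) \<bullet> symm (D x))" if "A \<in> L2_space \<Omega>" for A
      by (rule integrable_inner_L2[OF \<sigma>L[OF that] sL])
    \<comment> \<open>Energy identity: the stresses of both solutions are orthogonal to the strain
      of z, so after coercivity only the stress of g remains.\<close>
    have "c * (L2_norm \<Omega> (\<lambda>x. symm (D x)))\<^sup>2 = (\<integral>x. c * (symm (D x) \<bullet> symm (D x)) \<partial>lebesgue_on \<Omega>)"
      by (simp add: L2_norm_power2 dot_square_norm)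
    also have "\<dots> \<le> (\<integral>x. ?\<sigma> (D x) \<bullet> symm (D x) \<partial>lebesgue_on \<Omega>)"
      using integrable_inner_L2[OF sL sL] int[OF L(1)] c(2) by (intro integral_mono) auto
    also have "\<dots> = (\<integral>x. ?\<sigma> (D\<^sub>2 x) \<bullet> symm (D x) \<partial>lebesgue_on \<Omega>) - (\<integral>x. ?\<sigma> (D\<^sub>1 x) \<bullet> symm (D x) \<partial>lebesgue_on \<Omega>)
        - (\<integral>x. ?\<sigma> (jac g x) \<bullet> symm (D x) \<partial>lebesgue_on \<Omega>)"
      unfolding lin inner_diff_left using int[OF L(2)] int[OF L(3)] int[OF L(4)] by simp
    also have "\<dots> = - (\<integral>x. ?\<sigma> (jac g x) \<bullet> symm (D x) \<partial>lebesgue_on \<Omega>)"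
      using ortho[OF s1] ortho[OF s2] by (simp add: D\<^sub>1_def D\<^sub>2_def)
    also have "\<dots> \<le> L2_norm \<Omega> (\<lambda>x. ?\<sigma> (jac g x)) * L2_norm \<Omega> (\<lambda>x. symm (D x))"
      using L2_Cauchy_Schwarz[OF \<sigma>L[OF L(4)] sL] by linarith
    also have "\<dots> \<le> (B * L2_norm \<Omega> (jac g)) * L2_norm \<Omega> (\<lambda>x. symm (D x))"
      unfolding B_def by (intro mult_right_mono L2_bounded_linear(2)[OF L(4) bl] L2_norm_nonneg)
    finally have en: "c * (L2_norm \<Omega> (\<lambda>x. symm (D x)))\<^sup>2 \<le> B * L2_norm \<Omega> (jac g) * L2_norm \<Omega> (\<lambda>x. symm (D x))" .
    have jg: "L2_norm \<Omega> (jac g) \<le> \<eta> * V" "L2_norm \<Omega> g \<le> \<eta> * V"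
      unfolding V_def by (intro L2_bounded(2)[OF L2_spaceD(1) \<Omega>m(2)] L \<eta>; assumption)+
    have sD: "L2_norm \<Omega> (\<lambda>x. symm (D x)) \<le> (B / c) * (\<eta> * V)"
    proof (cases "L2_norm \<Omega> (\<lambda>x. symm (D x)) = 0")
      case True
      then show ?thesis using B c \<eta>(1) V by simp
    next
      case False
      then have pos: "L2_norm \<Omega> (\<lambda>x. symm (D x)) > 0" using L2_norm_nonneg[of \<Omega> "\<lambda>x. symm (D x)"] by simp
      have "(c * L2_norm \<Omega> (\<lambda>x. symm (D x))) * L2_norm \<Omega> (\<lambda>x. symm (D x)) \<le> (B * L2_norm \<Omega> (jac g)) * L2_norm \<Omega> (\<lambda>x. symm (D x))"
        using en by (simp add: power2_eq_square mult.assoc)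
      then have "c * L2_norm \<Omega> (\<lambda>x. symm (D x)) \<le> B * L2_norm \<Omega> (jac g)" using pos by simp
      also have "\<dots> \<le> B * (\<eta> * V)" by (intro mult_left_mono jg B)
      finally show ?thesis using c(1) by (simp add: field_simps)
    qed
    have zi: "L2_norm \<Omega> (\<lambda>x. z x $ i) \<le> 2 * R * ((B / c) * (\<eta> * V))" for i
    proof -
      have "L2_norm \<Omega> (\<lambda>x. z x $ i) \<le> 2 * R * L2_norm \<Omega> (\<lambda>x. D x $ i $ i)"
        using R by (intro poincare_H1_0[OF \<Omega> z0 wz]) auto
      \<comment> \<open>Symmetrising leaves the diagonal unchanged, so the strain bound feeds the
        Poincare inequality directly.\<close>
      also have "(\<lambda>x. D x $ i $ i) = (\<lambda>x. symm (D x) $ i $ i)"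
        by (simp add: symm_def transpose_def)
      also have "2 * R * L2_norm \<Omega> (\<lambda>x. symm (D x) $ i $ i) \<le> 2 * R * ((B / c) * (\<eta> * V))"
        using L2_norm_nth_nth_le[OF sL, of i i] sD R by (intro mult_left_mono) auto
      finally show ?thesis .
    qed
    have "L2_norm \<Omega> z \<le> (\<Sum>i\<in>UNIV. L2_norm \<Omega> (\<lambda>x. z x $ i))" by (rule L2_norm_le_sum_nth[OF L(6)])
    also have "\<dots> \<le> (\<Sum>i\<in>(UNIV::'n set). 2 * R * ((B / c) * (\<eta> * V)))" by (intro sum_mono zi)
    finally have zn: "L2_norm \<Omega> z \<le> real CARD('n) * (2 * R * ((B / c) * (\<eta> * V)))" by simp
    have "(\<lambda>x. v\<^sub>2 x - v\<^sub>1 x) = (\<lambda>x. z x + g x)" by (simp add: z_def)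
    moreover have "real CARD('n) * (2 * R * ((B / c) * (\<eta> * V))) + \<eta> * V \<le> C * \<eta>"
      using \<eta>(1) by (simp add: C_def algebra_simps)
    ultimately show "(\<lambda>x. v\<^sub>2 x - v\<^sub>1 x) \<in> L2_space \<Omega> \<and> L2_norm \<Omega> (\<lambda>x. v\<^sub>2 x - v\<^sub>1 x) \<le> C * \<eta>"
      using L2_add[OF L(6) L(5)] zn jg(2) by auto
  qed
qed

subsection \<open>A gliding hump argument\<close>

text \<open>The constants in the quadrature hypothesis depend on the integrand. Uniformity over a family of
  integrands is the uniform boundedness principle on \<open>\<ell>\<^sup>1\<close>: absolutely convergent series of members of
  the family are again admissible integrands.\<close>

lemma gliding_hump:
  fixes a :: "'q \<Rightarrow> 'x \<Rightarrow> real"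
  assumes A: "\<And>q. q \<in> Q \<Longrightarrow> \<exists>M. \<forall>x\<in>X. \<bar>a q x\<bar> \<le> M"
    and B: "\<And>x. x \<in> X \<Longrightarrow> \<exists>M. \<forall>q\<in>Q. \<bar>a q x\<bar> \<le> M"
    and C: "\<And>\<xi>::nat \<Rightarrow> 'x. (\<And>m. \<xi> m \<in> X) \<Longrightarrow> \<exists>M. \<forall>q\<in>Q. \<bar>\<Sum>m. (1/8)^m * a q (\<xi> m)\<bar> \<le> M"
  shows "\<exists>M. \<forall>q\<in>Q. \<forall>x\<in>X. \<bar>a q x\<bar> \<le> M"
proof (rule ccontr)
  assume unb: "\<not> ?thesis"
  obtain b where b: "\<And>x q. x \<in> X \<Longrightarrow> q \<in> Q \<Longrightarrow> \<bar>a q x\<bar> \<le> b x" using B by metis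
  \<comment> \<open>Unboundedness gives a q whose supremum over X is huge, and a near-maximiser x
    reaches more than half of it. The maximum with 1 keeps the supremum positive, so that its half
    is strictly smaller.\<close>
  have pick: "\<exists>q\<in>Q. \<exists>x\<in>X. \<bar>a q x\<bar> \<ge> N \<and> (\<forall>y\<in>X. \<bar>a q y\<bar> \<le> 2 * \<bar>a q x\<bar>)" for N
  proof -
    from unb obtain q x0 where q: "q \<in> Q" and x0: "x0 \<in> X" and big: "\<bar>a q x0\<bar> > 2 * max N 1"
      by (meson not_le)
    obtain M where M: "\<And>x. x \<in> X \<Longrightarrow> \<bar>a q x\<bar> \<le> M" using A[OF q] by auto
    define S where "S = (SUP x\<in>X. \<bar>a q x\<bar>)"
    have bdd: "bdd_above ((\<lambda>x. \<bar>a q x\<bar>) ` X)" using M by (auto simp: bdd_above_def)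
    have S: "\<bar>a q y\<bar> \<le> S" if "y \<in> X" for y unfolding S_def by (rule cSUP_upper[OF that bdd])
    have "S > 2 * max N 1" using S[OF x0] big by simp
    then have "S / 2 < S" by simp
    then obtain x where x: "x \<in> X" "\<bar>a q x\<bar> > S / 2"
      using less_cSUP_iff[OF _ bdd, of "S / 2"] x0 by (auto simp: S_def)
    show ?thesis
    proof (intro bexI conjI ballI)
      show "\<bar>a q x\<bar> \<ge> N" using x(2) \<open>S > 2 * max N 1\<close> by simp
      show "\<bar>a q y\<bar> \<le> 2 * \<bar>a q x\<bar>" if "y \<in> X" for y using S[OF that] x(2) by simp
    qed (use q x in auto)
  qed
  have b0: "b x \<ge> 0" if "x \<in> X" for x
    using b[OF that] pick[of 0] by fastforce
  \<comment> \<open>The third component s accumulates the bounds \<open>b\<close> at the points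
    chosen so far; up to a fixed constant it controls the earlier terms of the series for every
    q.\<close>
  define P where "P m = (\<lambda>(q, x, s). q \<in> Q \<and> x \<in> X \<and> (\<forall>y\<in>X. \<bar>a q y\<bar> \<le> 2 * \<bar>a q x\<bar>) \<and> (s::real) \<ge> 0)" for m :: nat
  \<comment> \<open>After the weight (1/8)^(m+1) the new term is at least 2 (m + 1 + s), which beats
    the earlier terms with a margin growing in m.\<close>
  define R where "R m = (\<lambda>(q::'q, x::'x, s) (q', x', s'). s' = s + b x' \<and> \<bar>a q' x'\<bar> \<ge> 8 ^ Suc m * (2 * (real (Suc m) + s)))"
    for m :: nat
  have "\<exists>f. \<forall>m. P m (f m) \<and> R m (f m) (f (Suc m))"
  proof (rule dependent_nat_choice)
    obtain q x where "q \<in> Q" "x \<in> X" "\<forall>y\<in>X. \<bar>a q y\<bar> \<le> 2 * \<bar>a q x\<bar>" using pick[of 0] by blast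
    then show "\<exists>t. P 0 t" by (intro exI[of _ "(q, x, b x)"]) (auto simp: P_def b0)
  next
    fix t m assume "P m t"
    then obtain q x s where t: "t = (q, x, s)" "s \<ge> 0" by (cases t) (auto simp: P_def)
    obtain q' x' where "q' \<in> Q" "x' \<in> X" "\<bar>a q' x'\<bar> \<ge> 8 ^ Suc m * (2 * (real (Suc m) + s))"
       "\<forall>y\<in>X. \<bar>a q' y\<bar> \<le> 2 * \<bar>a q' x'\<bar>" using pick by blast
    then show "\<exists>t'. P (Suc m) t' \<and> R m t t'"
      using t b0 by (intro exI[of _ "(q', x', s + b x')"]) (auto simp: P_def R_def)
  qed
  then obtain f where f: "\<And>m. P m (f m)" "\<And>m. R m (f m) (f (Suc m))" by auto
  define q x s where "q m = fst (f m)" and "x m = fst (snd (f m))" and "s m = snd (snd (f m))" for m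
  have fm: "f m = (q m, x m, s m)" for m by (simp add: q_def x_def s_def)
  have qQ: "q m \<in> Q" and xX: "x m \<in> X" and near: "\<And>y. y \<in> X \<Longrightarrow> \<bar>a (q m) y\<bar> \<le> 2 * \<bar>a (q m) (x m)\<bar>" for m
    using f(1)[of m] by (auto simp: P_def fm)
  have sS: "s (Suc m) = s m + b (x (Suc m))"
    and large: "\<bar>a (q (Suc m)) (x (Suc m))\<bar> \<ge> 8 ^ Suc m * (2 * (real (Suc m) + s m))" for m
    using f(2)[of m] by (auto simp: R_def fm)
  obtain M where M: "\<And>p. p \<in> Q \<Longrightarrow> \<bar>\<Sum>m. (1/8)^m * a p (x m)\<bar> \<le> M" using C[of x] xX by blast
  \<comment> \<open>Dependent choice records nothing about the initial accumulator but its sign, so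
    D corrects for its unknown value.\<close>
  define D where "D = b (x 0) - s 0"
  have ssum: "s m + D = (\<Sum>i\<le>m. b (x i))" for m
    by (induction m) (auto simp: D_def sS)
  have key: "real (Suc m) - \<bar>D\<bar> \<le> M" for m
  proof -
    define p where "p = q (Suc m)"
    define A where "A = \<bar>a p (x (Suc m))\<bar>"
    have summ: "summable (\<lambda>i. (1/8)^i * a p (x i))"
    proof (rule summable_comparison_test')
      show "summable (\<lambda>i. (1/8)^i * (2 * A))" by (intro summable_mult2 summable_geometric) simp
      show "norm ((1/8)^i * a p (x i)) \<le> (1/8)^i * (2 * A)" if "i \<ge> 0" for i
        using near[of "x i" "Suc m"] xX by (simp add: abs_mult p_def A_def)
    qed
    have split: "(\<Sum>i. (1/8)^i * a p (x i)) =
       (\<Sum>i. (1/8)^(i + Suc (Suc m)) * a p (x (i + Suc (Suc m)))) + (\<Sum>i<Suc (Suc m). (1/8)^i * a p (x i))"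
      by (rule suminf_split_initial_segment[OF summ])
    \<comment> \<open>By the near-maximality of the chosen point every later value is at most 2 A;
      the geometric series with ratio 1/8 then sums to 2/7 of the weighted main term.\<close>
    have tail: "\<bar>\<Sum>i. (1/8)^(i + Suc (Suc m)) * a p (x (i + Suc (Suc m)))\<bar> \<le> (1/8) ^ Suc m * (2 / 7 * A)"
    proof -
      have le: "norm ((1/8)^(i + Suc (Suc m)) * a p (x (i + Suc (Suc m)))) \<le> (1/8) ^ i * ((1/8) ^ Suc (Suc m) * (2 * A))" for i
        using near[of "x (i + Suc (Suc m))" "Suc m"] xX
        by (simp add: abs_mult p_def A_def power_add mult.assoc)
      have "(\<lambda>i. (1/8) ^ i * ((1/8) ^ Suc (Suc m) * (2 * A))) sums ((1 / (1 - 1/8)) * ((1/8) ^ Suc (Suc m) * (2 * A)))"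
        by (intro sums_mult2 geometric_sums) simp
      from norm_suminf_le[OF le sums_summable[OF this]] sums_unique[OF this]
      show ?thesis by simp
    qed
    have head: "\<bar>\<Sum>i<Suc m. (1/8)^i * a p (x i)\<bar> \<le> s m + \<bar>D\<bar>"
    proof -
      have "\<bar>\<Sum>i<Suc m. (1/8)^i * a p (x i)\<bar> \<le> (\<Sum>i<Suc m. b (x i))"
      proof (rule order_trans[OF sum_abs], rule sum_mono)
        fix i
        have "\<bar>(1/8)^i * a p (x i)\<bar> = (1/8)^i * \<bar>a p (x i)\<bar>" by (simp add: abs_mult)
        also have "\<dots> \<le> 1 * b (x i)"
          using b[OF xX, of p i] qQ by (intro mult_mono) (auto simp: p_def power_le_one)
        finally show "\<bar>(1/8)^i * a p (x i)\<bar> \<le> b (x i)" by simp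
      qed
      also have "\<dots> = s m + D" using ssum[of m] by (simp add: lessThan_Suc_atMost)
      finally show ?thesis by linarith
    qed
    have sm: "s m \<ge> 0" using f(1)[of m] by (simp add: P_def fm)
    have eq: "2 * (real (Suc m) + s m) = (1/8) ^ Suc m * (8 ^ Suc m * (2 * (real (Suc m) + s m)))"
      by (simp add: mult.assoc[symmetric] power_mult_distrib[symmetric])
    have big: "2 * (real (Suc m) + s m) \<le> (1/8) ^ Suc m * A"
      by (subst eq, rule mult_left_mono) (use large[of m] in \<open>auto simp: A_def p_def\<close>)
    define h where "h = (1/8) ^ Suc m * a p (x (Suc m))"
    have h: "\<bar>h\<bar> = (1/8) ^ Suc m * A" by (simp add: h_def A_def abs_mult)
    have "(\<Sum>i<Suc (Suc m). (1/8)^i * a p (x i)) = (\<Sum>i<Suc m. (1/8)^i * a p (x i)) + h"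
      unfolding h_def by (rule sum.lessThan_Suc)
    then have "\<bar>h\<bar> \<le> \<bar>\<Sum>i. (1/8)^i * a p (x i)\<bar> + (1/8) ^ Suc m * (2 / 7 * A) + (s m + \<bar>D\<bar>)"
      using split tail head by linarith
    moreover have "\<bar>\<Sum>i. (1/8)^i * a p (x i)\<bar> \<le> M" using M[of p] qQ[of "Suc m"] by (simp add: p_def)
    moreover have "(1/8) ^ Suc m * (2 / 7 * A) = 2 / 7 * ((1/8) ^ Suc m * A)" by simp
    \<comment> \<open>Main term minus tail leaves 5/7 of the main term. Since the main term is at
      least 2 (m + 1 + s) and 10/7 > 1, the accumulated s is absorbed and m + 1 stays below a fixed
      constant.\<close>
    ultimately have "5 / 7 * ((1/8) ^ Suc m * A) \<le> M + s m + \<bar>D\<bar>" using h by linarith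
    moreover have "N - d \<le> M" if "5 / 7 * Z \<le> M + s m + d" "2 * (N + s m) \<le> Z" "N \<ge> 0" for Z N d :: real
      using that sm by (simp add: field_simps)
    ultimately show ?thesis using big of_nat_0_le_iff by blast
  qed
  obtain m :: nat where "real m > M + \<bar>D\<bar>" using reals_Archimedean2 by blast
  then show False using key[of m] by simp
qed

subsection \<open>Smoothness of the Green's tensor\<close>

lemma Ck_on_norm:
  assumes "open S" "0 \<notin> S"
  shows "Ck_on k S (norm :: 'a::euclidean_space \<Rightarrow> real)"
proof -
  have "Ck_on k S (\<lambda>x. sqrt (x \<bullet> x))"
    using assms by (intro Ck_on_sqrt Ck_on_inner Ck_on_ident) auto
  then show ?thesis by (simp add: norm_eq_sqrt_inner[abs_def])
qed

text \<open>Turns the tensor into a convolution kernel of the single variable x - x', so that one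
  kernel serves all field points.\<close>

lemma green_translate: "green E \<nu> x x' = green E \<nu> (x - x') 0"
  by (simp add: green_def green_2d_def green_3d_def)

text \<open>Negative powers of the norm are written as products of \<open>inverse (norm z)\<close>,
  so that sums and products of smooth factors exhaust both formulas.\<close>

lemma Ck_on_green:
  "Ck_on k (- {0}) (\<lambda>z::real^'n. green E \<nu> z 0 $ i $ j)"
proof -
  have o: "open (- {0::real^'n})" by auto
  have n: "Ck_on k (- {0}) (norm :: real^'n \<Rightarrow> real)" by (rule Ck_on_norm) auto
  have inv: "Ck_on k (- {0}) (\<lambda>z::real^'n. inverse (norm z))"
    by (rule Ck_on_inverse[OF o n]) auto
  have ln: "Ck_on k (- {0}) (\<lambda>z::real^'n. ln (norm z))"
    by (rule Ck_on_ln[OF o n]) auto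
  have c: "Ck_on k (- {0}) (\<lambda>z::real^'n. z $ l)" for l
    by (rule Ck_on_bounded_linear_compose[OF o bounded_linear_vec_nth Ck_on_ident[OF o]])
  note rules = Ck_on_mult[OF o] Ck_on_add[OF o] Ck_on_const[OF o] inv ln c
  show ?thesis
  proof (cases "CARD('n) = 2")
    case True
    have "Ck_on k (- {0}) (\<lambda>z::real^'n. (1 / (8 * pi * shear_modulus E \<nu> * (1 - \<nu>))) *
        ((- (3 - 4 * \<nu>) * ln (norm z)) * (mat 1 :: real^'n^'n) $ i $ j
         + inverse (norm z) * inverse (norm z) * (z $ i * z $ j)))"
      by (intro rules)
    moreover have "1 / (norm z)\<^sup>2 = inverse (norm z) * inverse (norm z)" for z :: "real^'n"
      by (simp add: power2_eq_square field_simps)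
    ultimately show ?thesis using True by (simp add: green_def green_2d_def tensor_def)
  next
    case False
    have "Ck_on k (- {0}) (\<lambda>z::real^'n. ((1 + \<nu>) / (8 * pi * E * (1 - \<nu>))) *
        ((3 - 4 * \<nu>) * inverse (norm z) * (mat 1 :: real^'n^'n) $ i $ j
         + inverse (norm z) * inverse (norm z) * inverse (norm z) * (z $ i * z $ j)))"
      by (intro rules)
    moreover have "1 / norm z ^ 3 = inverse (norm z) * inverse (norm z) * inverse (norm z)"
      "(3 - 4 * \<nu>) / norm z = (3 - 4 * \<nu>) * inverse (norm z)" for z :: "real^'n"
      by (simp_all add: power3_eq_cube field_simps)
    ultimately show ?thesis using False by (simp add: green_def green_3d_def tensor_def)
  qed
qed

subsection \<open>Faces\<close>

lemma orthogonal_to_hyperplane: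
  fixes a y :: "'a::euclidean_space"
  assumes "a \<noteq> 0" "\<And>z. a \<bullet> z = 0 \<Longrightarrow> y \<bullet> z = 0"
  shows "y = ((a \<bullet> y) / (a \<bullet> a)) *\<^sub>R a"
proof -
  define z where "z = y - ((a \<bullet> y) / (a \<bullet> a)) *\<^sub>R a"
  have az: "a \<bullet> z = 0" using assms(1) by (simp add: z_def inner_diff_right)
  then have "y \<bullet> z = 0" by (rule assms(2))
  then have "z \<bullet> z = 0" using az by (simp add: z_def inner_diff_left inner_diff_right inner_commute)
  then show ?thesis by (simp add: z_def)
qed

lemma polyhedral_face_hyperplane:
  fixes F :: "(real^'n) set"
  assumes "polyhedral_face F"
  obtains a b where "norm a = 1" "affine hull F = {x. a \<bullet> x = b}"
proof -
  have "aff_dim F = int (DIM(real^'n)) - 1" using assms by (simp add: polyhedral_face_def)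
  then obtain a b where ab: "a \<noteq> 0" "affine hull F = {x. a \<bullet> x = b}"
    using aff_dim_eq_hyperplane[of F] by (auto simp: of_nat_diff)
  show ?thesis
  proof (rule that[of "inverse (norm a) *\<^sub>R a" "b / norm a"])
    show "norm (inverse (norm a) *\<^sub>R a) = 1" using ab(1) by simp
    show "affine hull F = {x. (inverse (norm a) *\<^sub>R a) \<bullet> x = b / norm a}"
      using ab by (auto simp: field_simps)
  qed
qed

lemma polyhedral_face_compact: "polyhedral_face F \<Longrightarrow> compact F"
  unfolding polyhedral_face_def using polytope_imp_compact by (auto intro!: compact_Union)

text \<open>A unit normal of the affine hull shows that the choice is possible; orthogonality to F
  extends to the hull, since a hyperplane containing F contains its affine hull.\<close>

lemma face_normal:
  assumes "polyhedral_face F"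
  shows "norm (face_normal F) = 1" "x \<in> affine hull F \<Longrightarrow> y \<in> affine hull F \<Longrightarrow> face_normal F \<bullet> (x - y) = 0"
proof -
  obtain a b where ab: "norm a = 1" "affine hull F = {x. a \<bullet> x = b}"
    using polyhedral_face_hyperplane[OF assms] by metis
  have "\<forall>x\<in>F. \<forall>y\<in>F. a \<bullet> (x - y) = 0"
    using hull_subset[of F affine] ab(2) by (auto simp: inner_diff_right)
  with ab(1) have *: "norm (face_normal F) = 1 \<and> (\<forall>x\<in>F. \<forall>y\<in>F. face_normal F \<bullet> (x - y) = 0)"
    unfolding face_normal_def by (intro someI[of "\<lambda>e. norm e = 1 \<and> (\<forall>x\<in>F. \<forall>y\<in>F. e \<bullet> (x - y) = 0)"]) auto
  then show "norm (face_normal F) = 1" by simp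
  let ?e = "face_normal F"
  show "?e \<bullet> (x - y) = 0" if x: "x \<in> affine hull F" and y: "y \<in> affine hull F"
  proof -
    obtain p where p: "p \<in> F" using x by (metis affine_hull_empty empty_iff ex_in_conv)
    have "affine hull F \<subseteq> {z. ?e \<bullet> z = ?e \<bullet> p}"
    proof (rule hull_minimal)
      show "F \<subseteq> {z. ?e \<bullet> z = ?e \<bullet> p}"
      proof
        fix z assume "z \<in> F"
        then have "?e \<bullet> (z - p) = 0" using * p by blast
        then show "z \<in> {z. ?e \<bullet> z = ?e \<bullet> p}" by (simp add: inner_diff_right)
      qed
    qed (rule affine_hyperplane)
    then have "?e \<bullet> x = ?e \<bullet> p" "?e \<bullet> y = ?e \<bullet> p" using x y by blast+
    then show ?thesis by (simp add: inner_diff_right)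
  qed
qed

text \<open>By Pythagoras every other point of the hull is farther away because of its tangential
  offset. Hence the projection in \<open>face_integral\<close> recovers the base point on the
  face.\<close>

lemma closest_point_prism:
  assumes "polyhedral_face F" "x \<in> affine hull F"
  shows "closest_point (affine hull F) (x + t *\<^sub>R face_normal F) = x"
proof (rule closest_point_unique[symmetric])
  show "\<forall>z\<in>affine hull F. dist (x + t *\<^sub>R face_normal F) x \<le> dist (x + t *\<^sub>R face_normal F) z"
  proof
    fix z assume "z \<in> affine hull F"
    then have "face_normal F \<bullet> (x - z) = 0" using face_normal(2)[OF assms] by simp
    then have "(norm ((x - z) + t *\<^sub>R face_normal F))\<^sup>2 = (norm (x - z))\<^sup>2 + (norm (t *\<^sub>R face_normal F))\<^sup>2"
      by (intro norm_add_Pythagorean) (simp add: orthogonal_def inner_commute)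
    then have "(norm (t *\<^sub>R face_normal F))\<^sup>2 \<le> (norm ((x - z) + t *\<^sub>R face_normal F))\<^sup>2" by simp
    then have "norm (t *\<^sub>R face_normal F) \<le> norm ((x - z) + t *\<^sub>R face_normal F)"
      by (rule power2_le_imp_le) simp
    then show "dist (x + t *\<^sub>R face_normal F) x \<le> dist (x + t *\<^sub>R face_normal F) z"
      by (simp add: dist_norm algebra_simps)
  qed
qed (use assms in \<open>auto simp: affine_imp_convex\<close>)

lemma unit_prism_compact:
  assumes "polyhedral_face F"
  shows "compact (unit_prism F)"
proof -
  have "unit_prism F = (\<lambda>(x, t). x + t *\<^sub>R face_normal F) ` (F \<times> {0..1})"
    unfolding unit_prism_def by force
  also have "compact \<dots>"
    using polyhedral_face_compact[OF assms]
    by (intro compact_continuous_image compact_Times) (auto simp: case_prod_unfold intro!: continuous_intros)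
  finally show ?thesis .
qed

lemma closest_point_unit_prism:
  assumes "polyhedral_face F" "y \<in> unit_prism F"
  shows "closest_point (affine hull F) y \<in> F"
  using assms closest_point_prism[OF assms(1)] hull_subset[of F affine]
  by (auto simp: unit_prism_def subset_iff)

lemma continuous_on_closest_point_face:
  assumes "polyhedral_face F"
  shows "continuous_on S (closest_point (affine hull F))"
proof -
  obtain a b where ab: "norm a = 1" "affine hull F = {x. a \<bullet> x = b}"
    using polyhedral_face_hyperplane[OF assms] by metis
  have "b *\<^sub>R a \<in> affine hull F" using ab by (simp add: norm_eq_1)
  then have "affine hull F \<noteq> {}" by blast
  then show ?thesis by (intro continuous_on_closest_point) (auto simp: affine_imp_convex)
qed

text \<open>The set lies in the frontier of the convex cylinder \<open>P + span {e}\<close>, and the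
  frontier of a convex set is a null set.\<close>

lemma negligible_prism_over_rel_frontier:
  assumes "convex P" "norm e = 1" "\<And>x y. x \<in> P \<Longrightarrow> y \<in> P \<Longrightarrow> e \<bullet> (x - y) = 0"
  shows "negligible {x + t *\<^sub>R e | x t. x \<in> P - rel_interior P}"
proof (rule negligible_subset)
  let ?W = "P + span {e}"
  have cW: "convex ?W" using assms(1) by (intro convex_set_plus) (auto simp: subspace_imp_convex)
  show "negligible (frontier ?W)" by (rule negligible_convex_frontier[OF cW])
  show "{x + t *\<^sub>R e | x t. x \<in> P - rel_interior P} \<subseteq> frontier ?W"
  proof safe
    fix x t assume x: "x \<in> P" "x \<notin> rel_interior P"
    have "x + t *\<^sub>R e \<in> ?W" using x by (intro set_plus_intro) (auto simp: span_base span_mul)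
    then have "x + t *\<^sub>R e \<in> closure ?W" using closure_subset by blast
    moreover have "x + t *\<^sub>R e \<notin> interior ?W"
    proof
      assume "x + t *\<^sub>R e \<in> interior ?W"
      then have "x + t *\<^sub>R e \<in> rel_interior ?W" using interior_subset_rel_interior by blast
      also have "rel_interior ?W = rel_interior P + span {e}"
        using rel_interior_sum[OF assms(1), of "span {e}"]
        by (simp add: subspace_imp_convex subspace_imp_affine rel_interior_affine)
      finally obtain p v where p: "p \<in> rel_interior P" "v \<in> span {e}" "x + t *\<^sub>R e = p + v"
        by (auto elim: set_plus_elim)
      then obtain s where s: "v = s *\<^sub>R e" by (auto simp: span_singleton)
      have "p \<in> P" using p(1) rel_interior_subset by blast
      have "e \<bullet> (x - p) + t * (e \<bullet> e) = s * (e \<bullet> e)"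
      proof -
        have "e \<bullet> (x + t *\<^sub>R e) = e \<bullet> (p + s *\<^sub>R e)" using p(3) s by simp
        then show ?thesis by (simp add: inner_add_right inner_diff_right)
      qed
      then have "t = s" using assms(2) assms(3)[OF x(1) \<open>p \<in> P\<close>] by (simp add: dot_square_norm)
      then have "x = p" using p(3) s by simp
      then show False using p(1) x(2) by simp
    qed
    ultimately show "x + t *\<^sub>R e \<in> frontier ?W" by (simp add: frontier_def)
  qed
qed

text \<open>Faces may be non-convex, so the edges are covered by the relative boundaries of the
  polytopes composing F. Each nonempty piece has the affine hull of F, so its relative interior lies
  in that of F. Normals and densities are prescribed only over the relative interior, so this null
  set has to be discarded in integrals.\<close>

lemma negligible_prism_edges:
  assumes "polyhedral_face F"
  shows "negligible {y \<in> unit_prism F. closest_point (affine hull F) y \<notin> rel_interior F}"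
proof -
  obtain \<P> where \<P>: "finite \<P>" "F = \<Union>\<P>" "\<And>P. P \<in> \<P> \<Longrightarrow> polytope P"
      "\<And>P. P \<in> \<P> \<Longrightarrow> aff_dim P = aff_dim F"
    using assms unfolding polyhedral_face_def by auto
  note e = face_normal[OF assms]
  have ri: "rel_interior P \<subseteq> rel_interior F" if "P \<in> \<P>" for P
  proof (cases "P = {}")
    case False
    have sub: "P \<subseteq> F" using that \<P>(2) by blast
    have "affine hull P = affine hull F"
      using False sub hull_mono[OF sub, of affine] \<P>(4)[OF that] by (intro affine_dim_equal) auto
    then show ?thesis using subset_rel_interior[OF sub] by simp
  qed simp
  have "negligible (\<Union>P\<in>\<P>. {x + t *\<^sub>R face_normal F | x t. x \<in> P - rel_interior P})"
  proof (rule negligible_Union[OF finite_imageI[OF \<P>(1)]], safe)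
    fix P assume P: "P \<in> \<P>"
    show "negligible {x + t *\<^sub>R face_normal F | x t. x \<in> P - rel_interior P}"
    proof (rule negligible_prism_over_rel_frontier)
      show "convex P" using \<P>(3)[OF P] by (rule polytope_imp_convex)
      have "P \<subseteq> affine hull F" using P \<P>(2) hull_subset[of F affine] by blast
      then show "face_normal F \<bullet> (x - y) = 0" if "x \<in> P" "y \<in> P" for x y
        using e(2) that by blast
    qed (rule e(1))
  qed
  then show ?thesis
  proof (rule negligible_subset, safe)
    fix y assume y: "y \<in> unit_prism F" "closest_point (affine hull F) y \<notin> rel_interior F"
    then obtain x t where x: "y = x + t *\<^sub>R face_normal F" "x \<in> F" by (auto simp: unit_prism_def)
    then have "closest_point (affine hull F) y = x"
      using closest_point_prism[OF assms] hull_subset[of F affine] by (simp add: subset_iff)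
    then have "x \<notin> rel_interior F" using y by simp
    obtain P where P: "P \<in> \<P>" "x \<in> P" using x(2) \<P>(2) by blast
    have "x \<notin> rel_interior P" using ri[OF P(1)] \<open>x \<notin> rel_interior F\<close> by blast
    then show "y \<in> (\<Union>P\<in>\<P>. {x + t *\<^sub>R face_normal F | x t. x \<in> P - rel_interior P})"
      using P x(1) by blast
  qed
qed

subsection \<open>Surface potentials\<close>

abbreviation foot :: "(real^'n) set \<Rightarrow> real^'n \<Rightarrow> real^'n" where
  "foot F \<equiv> closest_point (affine hull F)"

lemma unit_prism_sets: "polyhedral_face F \<Longrightarrow> unit_prism F \<in> sets lebesgue"
  by (intro fmeasurableD lmeasurable_compact unit_prism_compact)

lemma face_integral_eq:
  fixes f :: "real^'n \<Rightarrow> 'b::euclidean_space"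
  assumes "polyhedral_face F"
  shows "face_integral F f = (\<integral>y. f (foot F y) \<partial>lebesgue_on (unit_prism F))"
  unfolding face_integral_def set_lebesgue_integral_def
  using unit_prism_sets[OF assms] by (subst integral_restrict_space) auto

lemma foot_measurable:
  assumes "polyhedral_face F"
  shows "foot F \<in> borel_measurable (lebesgue_on (unit_prism F))"
  by (intro continuous_imp_measurable_on_sets_lebesgue continuous_on_closest_point_face[OF assms]
      unit_prism_sets[OF assms])

text \<open>Except over the edges, a null set in the prism, the density agrees with a function that
  is continuous up to the boundary of the face.\<close>

lemma integrable_piecewise:
  fixes \<theta> :: "real^'n \<Rightarrow> real"
  assumes "piecewise_Ck k \<F> \<theta>" "F \<in> \<F>" and F: "polyhedral_face F"
  shows "integrable (lebesgue_on (unit_prism F)) (\<lambda>y. \<theta> (foot F y))"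
proof -
  obtain U g where g: "open U" "F \<subseteq> U" "Ck_on k U g" "\<And>x. x \<in> rel_interior F \<Longrightarrow> \<theta> x = g x"
    using assms by (auto simp: piecewise_Ck_def)
  note cpt = unit_prism_compact[OF F]
  have "continuous_on (unit_prism F) (\<lambda>y. g (foot F y))"
    by (rule continuous_on_compose2[OF Ck_on_imp_continuous_on[OF g(3)] continuous_on_closest_point_face[OF F]])
      (use closest_point_unit_prism[OF F] g(2) in auto)
  from borel_integrable_compact[OF cpt this]
  have "integrable lborel (\<lambda>y. indicator (unit_prism F) y *\<^sub>R g (foot F y))" .
  then have "integrable lebesgue (\<lambda>y. indicator (unit_prism F) y *\<^sub>R g (foot F y))"
    by (subst integrable_completion) auto
  then have "(\<lambda>y. g (foot F y)) absolutely_integrable_on unit_prism F"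
    by (simp add: set_integrable_def)
  then have "(\<lambda>y. \<theta> (foot F y)) absolutely_integrable_on unit_prism F"
    by (rule absolutely_integrable_spike[OF _ negligible_prism_edges[OF F]]) (use g(4) in auto)
  then show ?thesis
    using unit_prism_sets[OF F] by (simp add: set_integrable_def integrable_restrict_space)
qed

lemma piecewise_Ck_mult:
  assumes "piecewise_Ck k \<F> \<theta>" "open V" "\<Union>\<F> \<subseteq> V" "Ck_on k V H"
  shows "piecewise_Ck k \<F> (\<lambda>x. \<theta> x * H x)"
  unfolding piecewise_Ck_def
proof
  fix F assume F: "F \<in> \<F>"
  then obtain U g where g: "open U" "F \<subseteq> U" "Ck_on k U g" "\<And>x. x \<in> rel_interior F \<Longrightarrow> \<theta> x = g x"
    using assms(1) by (auto simp: piecewise_Ck_def)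
  have "Ck_on k (U \<inter> V) (\<lambda>x. g x * H x)"
    using g(1,3) assms(2,4) by (intro Ck_on_mult) (auto intro: Ck_on_subset)
  then show "\<exists>U g. open U \<and> F \<subseteq> U \<and> Ck_on k U g \<and> (\<forall>x\<in>rel_interior F. \<theta> x * H x = g x)"
    using g F assms(2,3) by (intro exI[of _ "U \<inter> V"] exI[of _ "\<lambda>x. g x * H x"]) auto
qed

text \<open>The series is an integral of translates over counting measure with weights (1/8)^m, so
  the general result on superpositions applies. The kernel is reflected there because x', the
  variable of differentiation, is the one subtracted.\<close>

lemma Ck_on_kernel_series:
  fixes \<xi> :: "nat \<Rightarrow> 'a::euclidean_space" and K :: "'a \<Rightarrow> real"
  assumes K: "Ck_on k (- {0}) K" and T: "compact T" "\<And>m. \<xi> m \<in> T"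
    and V: "open V" "V \<inter> T = {}"
  shows "Ck_on k V (\<lambda>x'. \<Sum>m. (1/8)^m * K (\<xi> m - x'))"
proof -
  let ?M = "count_space (UNIV :: nat set)"
  let ?g = "\<lambda>z. K ((-1) *\<^sub>R z + 0)"
  have g: "Ck_on k (- {0}) ?g" by (rule Ck_on_affine_compose[OF _ _ K]) auto
  have w: "integrable ?M (\<lambda>m. (1/8)^m :: real)"
    by (simp add: integrable_count_space_nat_iff summable_geometric)
  have ne: "x' - t \<in> - {0}" if "x' \<in> V" "t \<in> T" for x' t using V(2) that by auto
  have "Ck_on k V (\<lambda>x'. \<integral>m. ?g (x' - \<xi> m) *\<^sub>R ((1/8)^m :: real) \<partial>?M)"
    by (rule Ck_on_integral_translate[OF w _ T(1) T(2) V(1) ne g]) auto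
  then show ?thesis
  proof (rule Ck_on_cong[OF V(1)])
    fix x' assume x': "x' \<in> V"
    have "integrable ?M (\<lambda>m. ?g (x' - \<xi> m) *\<^sub>R ((1/8)^m :: real))"
      by (rule integrable_translate[OF w _ T(1) T(2) Ck_on_imp_continuous_on[OF g] ne[OF x']]) auto
    from integral_count_space_nat[OF this]
    show "(\<integral>m. ?g (x' - \<xi> m) *\<^sub>R ((1/8)^m :: real) \<partial>?M) = (\<Sum>m. (1/8)^m * K (\<xi> m - x'))"
      by (simp add: mult.commute)
  qed
qed

text \<open>Single layer potential of the polyhedral surface with scalar density \<theta> and
  convolution kernel K.\<close>

definition potential :: "(real^'n) set set \<Rightarrow> (real^'n \<Rightarrow> real) \<Rightarrow> (real^'n \<Rightarrow> real) \<Rightarrow> real^'n \<Rightarrow> real" where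
  "potential \<F> \<theta> K x = surface_integral \<F> (\<lambda>x'. \<theta> x' * K (x - x'))"

definition quadrature_error ::
  "(real^'n) set set \<Rightarrow> (real^'n) quadrature \<Rightarrow> (real^'n \<Rightarrow> real) \<Rightarrow> (real^'n \<Rightarrow> real) \<Rightarrow> real^'n \<Rightarrow> real" where
  "quadrature_error \<F> q \<theta> K x = potential \<F> \<theta> K x - quadrature_sum q (\<lambda>x'. \<theta> x' * K (x - x'))"

text \<open>The argument of the kernel is written as c x + a to match the pattern of
  \<open>Ck_on_affine_compose\<close>.\<close>

lemma quadrature_sum_kernel_eq:
  "quadrature_sum q (\<lambda>x'. \<theta> x' * K (x - x')) =
     (\<Sum>j=1..num_elems q. (weight q j * \<theta> (node q j)) * K (1 *\<^sub>R x + - node q j))"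
  by (simp add: quadrature_sum_def mult.assoc)

context
  fixes \<F> :: "(real^'n) set set"
  assumes \<F>: "closed_polyhedral_surface \<F>"
begin

lemma surface_finite: "finite \<F>" and surface_face: "F \<in> \<F> \<Longrightarrow> polyhedral_face F"
  using \<F> by (auto simp: closed_polyhedral_surface_def)

lemma surface_compact: "compact (\<Union>\<F>)"
  using surface_finite surface_face polyhedral_face_compact by (intro compact_Union) auto

lemma surface_nonempty: "\<Union>\<F> \<noteq> {}"
proof -
  obtain F where F: "F \<in> \<F>" using \<F> by (auto simp: closed_polyhedral_surface_def)
  obtain a b where "norm a = 1" "affine hull F = {x. a \<bullet> x = b}"
    using polyhedral_face_hyperplane[OF surface_face[OF F]] by metis
  then have "b *\<^sub>R a \<in> affine hull F" by (simp add: norm_eq_1)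
  then have "F \<noteq> {}" by auto
  then show ?thesis using F by blast
qed

lemma potential_eq:
  "potential \<F> \<theta> K x = (\<Sum>F\<in>\<F>. \<integral>y. K (x - foot F y) *\<^sub>R \<theta> (foot F y) \<partial>lebesgue_on (unit_prism F))"
  by (simp add: potential_def surface_integral_def face_integral_eq surface_face mult.commute)

lemma foot_in_face: "F \<in> \<F> \<Longrightarrow> y \<in> space (lebesgue_on (unit_prism F)) \<Longrightarrow> foot F y \<in> F"
  using closest_point_unit_prism[OF surface_face] by auto

lemma not_in_surface: "x \<in> - \<Union>\<F> \<Longrightarrow> F \<in> \<F> \<Longrightarrow> t \<in> F \<Longrightarrow> x - t \<in> - {0}"
  by auto

lemma open_compl_surface: "open (- \<Union>\<F>)"
  using compact_imp_closed[OF surface_compact] by auto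

context
  fixes \<theta> :: "real^'n \<Rightarrow> real" and k\<^sub>0 :: nat
  assumes \<theta>: "piecewise_Ck k\<^sub>0 \<F> \<theta>"
begin

lemma integrable_potential:
  assumes "continuous_on (- {0}) K" "x \<notin> \<Union>\<F>" "F \<in> \<F>"
  shows "integrable (lebesgue_on (unit_prism F)) (\<lambda>y. K (x - foot F y) *\<^sub>R \<theta> (foot F y))"
  using integrable_translate[OF integrable_piecewise[OF \<theta> assms(3) surface_face[OF assms(3)]]
      foot_measurable[OF surface_face[OF assms(3)]] polyhedral_face_compact[OF surface_face[OF assms(3)]]
      foot_in_face[OF assms(3)] assms(1)] assms(2,3) by auto

lemma Ck_on_potential:
  assumes "Ck_on k (- {0}) K"
  shows "Ck_on k (- \<Union>\<F>) (potential \<F> \<theta> K)"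
proof -
  have "Ck_on k (- \<Union>\<F>) (\<lambda>x. \<Sum>F\<in>\<F>. \<integral>y. K (x - foot F y) *\<^sub>R \<theta> (foot F y) \<partial>lebesgue_on (unit_prism F))"
  proof (rule Ck_on_sum[OF open_compl_surface surface_finite])
    fix F assume F: "F \<in> \<F>"
    show "Ck_on k (- \<Union>\<F>) (\<lambda>x. \<integral>y. K (x - foot F y) *\<^sub>R \<theta> (foot F y) \<partial>lebesgue_on (unit_prism F))"
      by (rule Ck_on_integral_translate[OF integrable_piecewise[OF \<theta> F surface_face[OF F]]
            foot_measurable[OF surface_face[OF F]] polyhedral_face_compact[OF surface_face[OF F]]
            foot_in_face[OF F] open_compl_surface not_in_surface[OF _ F] assms])
  qed
  then show ?thesis by (simp add: potential_eq[abs_def])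
qed

lemma has_derivative_potential:
  assumes "Ck_on (Suc 0) (- {0}) K" "x \<notin> \<Union>\<F>"
  shows "(potential \<F> \<theta> K has_derivative (\<lambda>h. potential \<F> \<theta> (\<lambda>z. frechet_derivative K (at z) h) x)) (at x)"
  unfolding potential_eq[abs_def]
proof (rule has_derivative_sum)
  fix F assume F: "F \<in> \<F>"
  show "((\<lambda>x. \<integral>y. K (x - foot F y) *\<^sub>R \<theta> (foot F y) \<partial>lebesgue_on (unit_prism F)) has_derivative
    (\<lambda>h. \<integral>y. frechet_derivative K (at (x - foot F y)) h *\<^sub>R \<theta> (foot F y) \<partial>lebesgue_on (unit_prism F))) (at x)"
    by (rule has_derivative_integral_translate[OF integrable_piecewise[OF \<theta> F surface_face[OF F]]
          foot_measurable[OF surface_face[OF F]] polyhedral_face_compact[OF surface_face[OF F]]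
          foot_in_face[OF F] open_compl_surface not_in_surface[OF _ F] assms(1)]) (use assms in auto)
qed

lemma Ck_on_quadrature_error:
  assumes "Ck_on k (- {0}) K" "quadrature_on \<F> q"
  shows "Ck_on k (- \<Union>\<F>) (quadrature_error \<F> q \<theta> K)"
proof -
  have "Ck_on k (- \<Union>\<F>) (\<lambda>x. K (1 *\<^sub>R x + - node q j))" if "j \<in> {1..num_elems q}" for j
  proof (rule Ck_on_affine_compose[OF open_compl_surface _ assms(1)])
    have "node q j \<in> \<Union>\<F>" using assms(2) that by (auto simp: quadrature_on_def)
    then show "1 *\<^sub>R x + - node q j \<in> - {0}" if "x \<in> - \<Union>\<F>" for x using that by auto
  qed auto
  then have "Ck_on k (- \<Union>\<F>) (\<lambda>x. \<Sum>j=1..num_elems q. (weight q j * \<theta> (node q j)) * K (1 *\<^sub>R x + - node q j))"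
    by (intro Ck_on_sum Ck_on_mult Ck_on_const open_compl_surface) auto
  then have "Ck_on k (- \<Union>\<F>) (\<lambda>x. potential \<F> \<theta> K x + (- 1) * quadrature_sum q (\<lambda>x'. \<theta> x' * K (x - x')))"
    unfolding quadrature_sum_kernel_eq
    by (intro Ck_on_add Ck_on_potential Ck_on_mult Ck_on_const open_compl_surface assms)
  then show ?thesis by (simp add: quadrature_error_def[abs_def])
qed

text \<open>Differentiation in the field point passes to the kernel in both the integral and the
  sum. The derivative of an error is thus an error for the differentiated kernel and falls under the
  same quadrature hypothesis.\<close>

lemma has_derivative_quadrature_error:
  assumes K: "Ck_on (Suc 0) (- {0}) K" and q: "quadrature_on \<F> q" and x: "x \<notin> \<Union>\<F>"
  shows "(quadrature_error \<F> q \<theta> K has_derivative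
     (\<lambda>h. quadrature_error \<F> q \<theta> (\<lambda>z. frechet_derivative K (at z) h) x)) (at x)"
  unfolding quadrature_error_def[abs_def] quadrature_sum_kernel_eq
proof (intro has_derivative_diff has_derivative_potential[OF K x] has_derivative_sum has_derivative_mult_right)
  fix j assume j: "j \<in> {1..num_elems q}"
  have "node q j \<in> \<Union>\<F>" using q j by (auto simp: quadrature_on_def)
  then have "1 *\<^sub>R x + - node q j \<in> - {0}" using x by auto
  from Ck_on_Suc_has_derivative[OF K this]
  have d: "(K has_derivative frechet_derivative K (at (1 *\<^sub>R x + - node q j))) (at (1 *\<^sub>R x + - node q j))" .
  have "((\<lambda>x. 1 *\<^sub>R x + - node q j) has_derivative (\<lambda>h. h)) (at x)" by (auto intro!: derivative_eq_intros)
  from has_derivative_compose[OF this d]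
  show "((\<lambda>x. K (1 *\<^sub>R x + - node q j)) has_derivative (\<lambda>h. frechet_derivative K (at (1 *\<^sub>R x + - node q j)) h)) (at x)"
    by simp
qed

text \<open>A weighted series of errors is the error of one series integrand: the uniform bound B on
  the kernel makes all interchanges absolutely convergent. This supplies the third condition of
  \<open>gliding_hump\<close>.\<close>

lemma quadrature_error_series:
  fixes \<xi> :: "nat \<Rightarrow> real^'n"
  assumes K: "continuous_on (- {0}) K" and q: "quadrature_on \<F> q"
    and \<xi>: "\<And>m. \<xi> m \<notin> \<Union>\<F>" and B: "\<And>m x'. x' \<in> \<Union>\<F> \<Longrightarrow> \<bar>K (\<xi> m - x')\<bar> \<le> B"
  shows "(\<lambda>m. (1/8)^m * quadrature_error \<F> q \<theta> K (\<xi> m)) sums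
     (surface_integral \<F> (\<lambda>x'. \<theta> x' * (\<Sum>m. (1/8)^m * K (\<xi> m - x')))
        - quadrature_sum q (\<lambda>x'. \<theta> x' * (\<Sum>m. (1/8)^m * K (\<xi> m - x'))))"
proof -
  have geo: "summable (\<lambda>m. (1/8::real)^m * c)" for c by (intro summable_mult2 summable_geometric) simp
  have s: "summable (\<lambda>m. norm ((1/8)^m * K (\<xi> m - x')))" if "x' \<in> \<Union>\<F>" for x'
    by (rule summable_comparison_test'[OF geo[of B], of 0]) (use B[OF that] in \<open>auto simp: abs_mult\<close>)
  have face: "(\<lambda>m. (1/8)^m * (\<integral>y. K (\<xi> m - foot F y) *\<^sub>R \<theta> (foot F y) \<partial>lebesgue_on (unit_prism F))) sums
      (\<integral>y. \<theta> (foot F y) * (\<Sum>m. (1/8)^m * K (\<xi> m - foot F y)) \<partial>lebesgue_on (unit_prism F))"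
    if F: "F \<in> \<F>" for F
  proof -
    let ?M = "lebesgue_on (unit_prism F)"
    let ?f = "\<lambda>m y. (1/8)^m * (K (\<xi> m - foot F y) * \<theta> (foot F y))"
    note fi = integrable_potential[OF K \<xi> F]
    have inF: "foot F y \<in> \<Union>\<F>" if "y \<in> space ?M" for y using foot_in_face[OF F that] F by blast
    have \<theta>i: "integrable ?M (\<lambda>y. \<theta> (foot F y))" by (rule integrable_piecewise[OF \<theta> F surface_face[OF F]])
    have bound: "(\<integral>y. norm (?f m y) \<partial>?M) \<le> (1/8)^m * (\<integral>y. B * \<bar>\<theta> (foot F y)\<bar> \<partial>?M)" for m
    proof -
      have "(\<integral>y. norm (?f m y) \<partial>?M) \<le> (\<integral>y. (1/8)^m * (B * \<bar>\<theta> (foot F y)\<bar>) \<partial>?M)"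
      proof (rule integral_mono)
        show "integrable ?M (\<lambda>y. norm (?f m y))" using fi[of m] by auto
        show "integrable ?M (\<lambda>y. (1/8)^m * (B * \<bar>\<theta> (foot F y)\<bar>))" using \<theta>i by auto
        show "norm (?f m y) \<le> (1/8)^m * (B * \<bar>\<theta> (foot F y)\<bar>)" if "y \<in> space ?M" for y
          using B[OF inF[OF that], of m] by (simp add: abs_mult mult_right_mono)
      qed
      then show ?thesis by simp
    qed
    have "(\<lambda>m. integral\<^sup>L ?M (?f m)) sums (\<integral>y. (\<Sum>m. ?f m y) \<partial>?M)"
    proof (rule sums_integral)
      show "integrable ?M (?f m)" for m using fi[of m] by auto
      have "summable (\<lambda>m. norm (?f m y))" if "y \<in> space ?M" for y
        using summable_mult2[OF s[OF inF[OF that]], of "\<bar>\<theta> (foot F y)\<bar>"] by (simp add: abs_mult mult.assoc)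
      then show "AE y in ?M. summable (\<lambda>m. norm (?f m y))" by (intro AE_I2)
      show "summable (\<lambda>m. \<integral>y. norm (?f m y) \<partial>?M)"
        by (rule summable_comparison_test'[OF geo, of 0]) (use bound in auto)
    qed
    moreover have "(\<integral>y. (\<Sum>m. ?f m y) \<partial>?M) = (\<integral>y. \<theta> (foot F y) * (\<Sum>m. (1/8)^m * K (\<xi> m - foot F y)) \<partial>?M)"
    proof (rule Bochner_Integration.integral_cong[OF refl])
      fix y assume "y \<in> space ?M"
      from suminf_mult2[OF summable_norm_cancel[OF s[OF inF[OF this]]], of "\<theta> (foot F y)"]
      show "(\<Sum>m. ?f m y) = \<theta> (foot F y) * (\<Sum>m. (1/8)^m * K (\<xi> m - foot F y))"
        by (simp add: mult_ac)
    qed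
    ultimately show ?thesis by simp
  qed
  have "(\<lambda>m. \<Sum>F\<in>\<F>. (1/8)^m * (\<integral>y. K (\<xi> m - foot F y) *\<^sub>R \<theta> (foot F y) \<partial>lebesgue_on (unit_prism F))) sums
     (\<Sum>F\<in>\<F>. \<integral>y. \<theta> (foot F y) * (\<Sum>m. (1/8)^m * K (\<xi> m - foot F y)) \<partial>lebesgue_on (unit_prism F))"
    by (rule sums_sum[OF face])
  then have surf: "(\<lambda>m. (1/8)^m * potential \<F> \<theta> K (\<xi> m)) sums
      surface_integral \<F> (\<lambda>x'. \<theta> x' * (\<Sum>m. (1/8)^m * K (\<xi> m - x')))"
    by (simp add: potential_eq surface_integral_def face_integral_eq surface_face sum_distrib_left)
  have "(\<lambda>m. \<Sum>j=1..num_elems q. weight q j * (\<theta> (node q j) * ((1/8)^m * K (\<xi> m - node q j)))) sums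
     (\<Sum>j=1..num_elems q. weight q j * (\<theta> (node q j) * (\<Sum>m. (1/8)^m * K (\<xi> m - node q j))))"
  proof (intro sums_sum sums_mult)
    fix j assume "j \<in> {1..num_elems q}"
    then have "node q j \<in> \<Union>\<F>" using q by (auto simp: quadrature_on_def)
    from summable_sums[OF summable_norm_cancel[OF s[OF this]]]
    show "(\<lambda>m. (1/8)^m * K (\<xi> m - node q j)) sums (\<Sum>m. (1/8)^m * K (\<xi> m - node q j))" .
  qed
  moreover have "(\<Sum>j=1..num_elems q. weight q j * (\<theta> (node q j) * ((1/8)^m * K (\<xi> m - node q j))))
      = (1/8)^m * quadrature_sum q (\<lambda>x'. \<theta> x' * K (\<xi> m - x'))" for m
    by (simp add: quadrature_sum_def sum_distrib_left mult.left_commute)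
  ultimately have quad: "(\<lambda>m. (1/8)^m * quadrature_sum q (\<lambda>x'. \<theta> x' * K (\<xi> m - x'))) sums
      quadrature_sum q (\<lambda>x'. \<theta> x' * (\<Sum>m. (1/8)^m * K (\<xi> m - x')))"
    by (simp add: quadrature_sum_def)
  from sums_diff[OF surf quad] show ?thesis
    by (simp add: quadrature_error_def right_diff_distrib)
qed

text \<open>The errors divided by the mesh power satisfy the three conditions of
  \<open>gliding_hump\<close>: for a single rule the kernel is bounded on the relevant differences,
  for a single point the hypothesis applies to the integrand, and for a sequence of points it
  applies to the series integrand.\<close>

lemma quadrature_error_uniform:
  assumes K: "Ck_on k\<^sub>0 (- {0}) K" and q: "\<And>q. q \<in> \<Q> \<Longrightarrow> quadrature_on \<F> q"
    and order: "quadrature_order k\<^sub>0 r \<F> \<Q>"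
    and X: "bounded X" "\<And>x. x \<in> X \<Longrightarrow> infdist x (\<Union>\<F>) \<ge> \<delta>" "\<delta> > 0"
  shows "\<exists>C. \<forall>q\<in>\<Q>. \<forall>x\<in>X. \<bar>quadrature_error \<F> q \<theta> K x\<bar> \<le> C * mesh_size q powr r"
proof -
  let ?\<Gamma> = "\<Union>\<F>"
  note Kc = Ck_on_imp_continuous_on[OF K]
  have dist: "norm (x - x') \<ge> \<delta>" if "x \<in> X" "x' \<in> ?\<Gamma>" for x x'
    using infdist_le[OF that(2), of x] X(2)[OF that(1)] by (simp add: dist_norm)
  obtain R1 where R1: "\<And>x. x \<in> X \<Longrightarrow> norm x \<le> R1" using X(1) by (auto simp: bounded_iff)
  obtain R2 where R2: "\<And>x. x \<in> ?\<Gamma> \<Longrightarrow> norm x \<le> R2"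
    using compact_imp_bounded[OF surface_compact] by (auto simp: bounded_iff)
  \<comment> \<open>All differences x - x' lie in this shell, which is compact and avoids the
    origin.\<close>
  define A where "A = cball 0 (R1 + R2) - ball (0::real^'n) \<delta>"
  have "compact A" unfolding A_def by (intro compact_diff) auto
  moreover have "A \<subseteq> - {0}" using X(3) by (auto simp: A_def)
  ultimately have "compact (K ` A)" by (intro compact_continuous_image continuous_on_subset[OF Kc])
  then obtain B where B: "\<And>z. z \<in> A \<Longrightarrow> \<bar>K z\<bar> \<le> B"
    using compact_imp_bounded by (fastforce simp: bounded_iff)
  have inA: "x - x' \<in> A" if "x \<in> X" "x' \<in> ?\<Gamma>" for x x'
    using dist[OF that] R1[OF that(1)] R2[OF that(2)] norm_triangle_ineq4[of x x'] by (auto simp: A_def)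
  have BX: "\<bar>K (x - x')\<bar> \<le> B" if "x \<in> X" "x' \<in> ?\<Gamma>" for x x' using B[OF inA[OF that]] .
  have X\<Gamma>: "x \<notin> ?\<Gamma>" if "x \<in> X" for x using dist[OF that, of x] X(3) by auto
  define a where "a q x = quadrature_error \<F> q \<theta> K x / mesh_size q powr r" for q x
  have ord: "\<exists>C>0. \<forall>q\<in>\<Q>. \<bar>surface_integral \<F> f - quadrature_sum q f\<bar> \<le> C * mesh_size q powr r"
    if "piecewise_Ck k\<^sub>0 \<F> f" for f using order that by (simp add: quadrature_order_def)
  \<comment> \<open>Division by 0 gives 0, so the bound holds also when the mesh power
    vanishes.\<close>
  have div: "\<bar>e / h\<bar> \<le> C" if "\<bar>e\<bar> \<le> C * h" "h \<ge> 0" "C > 0" for e h C :: real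
    using that by (cases "h = 0") (auto simp: abs_divide field_simps)
  have adm: "piecewise_Ck k\<^sub>0 \<F> (\<lambda>x'. \<theta> x' * (\<Sum>m. (1/8)^m * K (\<xi> m - x')))" if "\<And>m. \<xi> m \<in> X" for \<xi> :: "nat \<Rightarrow> real^'n"
  proof (rule piecewise_Ck_mult[OF \<theta>])
    \<comment> \<open>Half of \<delta> keeps this neighbourhood of the surface disjoint from the
      closure of X, so the series is smooth on an open set containing all faces.\<close>
    let ?V = "{x'. infdist x' ?\<Gamma> < \<delta> / 2}"
    show oV: "open ?V" by (intro open_Collect_less continuous_intros)
    show "?\<Gamma> \<subseteq> ?V"
    proof
      fix x' assume "x' \<in> ?\<Gamma>"
      from infdist_le[OF this, of x'] X(3) show "x' \<in> ?V" by simp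
    qed
    show "Ck_on k\<^sub>0 ?V (\<lambda>x'. \<Sum>m. (1/8)^m * K (\<xi> m - x'))"
    proof (rule Ck_on_kernel_series[OF K _ _ oV])
      show "compact (closure X)" using X(1) by simp
      show "\<xi> m \<in> closure X" for m using that[of m] closure_subset by blast
      have "closure X \<subseteq> {x. \<delta> \<le> infdist x ?\<Gamma>}"
        using X(2) by (intro closure_minimal closed_Collect_le continuous_intros) auto
      then show "?V \<inter> closure X = {}" using X(3) by force
    qed
  qed
  have adm1: "piecewise_Ck k\<^sub>0 \<F> (\<lambda>x'. \<theta> x' * K (x - x'))" if x: "x \<in> X" for x
  proof (rule piecewise_Ck_mult[OF \<theta>])
    show "open (- {x})" by auto
    show "?\<Gamma> \<subseteq> - {x}" using X\<Gamma>[OF x] by auto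
    have "Ck_on k\<^sub>0 (- {x}) (\<lambda>x'. K ((-1) *\<^sub>R x' + x))" by (rule Ck_on_affine_compose[OF _ _ K]) auto
    then show "Ck_on k\<^sub>0 (- {x}) (\<lambda>x'. K (x - x'))" by simp
  qed
  have "\<exists>M. \<forall>q\<in>\<Q>. \<forall>x\<in>X. \<bar>a q x\<bar> \<le> M"
  proof (rule gliding_hump)
    fix q assume qQ: "q \<in> \<Q>"
    define M where "M = (\<Sum>F\<in>\<F>. B * (\<integral>y. norm (\<theta> (foot F y)) \<partial>lebesgue_on (unit_prism F)))
       + (\<Sum>j=1..num_elems q. \<bar>weight q j * \<theta> (node q j)\<bar> * B)"
    have "\<bar>quadrature_error \<F> q \<theta> K x\<bar> \<le> M" if x: "x \<in> X" for x
    proof -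
      have "\<bar>potential \<F> \<theta> K x\<bar> \<le> (\<Sum>F\<in>\<F>. B * (\<integral>y. norm (\<theta> (foot F y)) \<partial>lebesgue_on (unit_prism F)))"
        unfolding potential_eq
      proof (rule order_trans[OF sum_abs], rule sum_mono)
        fix F assume F: "F \<in> \<F>"
        show "\<bar>\<integral>y. K (x - foot F y) *\<^sub>R \<theta> (foot F y) \<partial>lebesgue_on (unit_prism F)\<bar>
          \<le> B * (\<integral>y. norm (\<theta> (foot F y)) \<partial>lebesgue_on (unit_prism F))"
          using norm_integral_scaleR_le[OF integrable_piecewise[OF \<theta> F surface_face[OF F]]
              integrable_potential[OF Kc X\<Gamma>[OF x] F], of B] BX[OF x] foot_in_face[OF F] F by auto
      qed
      moreover have "\<bar>quadrature_sum q (\<lambda>x'. \<theta> x' * K (x - x'))\<bar> \<le> (\<Sum>j=1..num_elems q. \<bar>weight q j * \<theta> (node q j)\<bar> * B)"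
        unfolding quadrature_sum_kernel_eq
      proof (rule order_trans[OF sum_abs], rule sum_mono)
        fix j assume "j \<in> {1..num_elems q}"
        then have "node q j \<in> ?\<Gamma>" using q[OF qQ] by (auto simp: quadrature_on_def)
        then show "\<bar>weight q j * \<theta> (node q j) * K (1 *\<^sub>R x + - node q j)\<bar> \<le> \<bar>weight q j * \<theta> (node q j)\<bar> * B"
          using BX[OF x] by (simp add: abs_mult mult_left_mono)
      qed
      ultimately show ?thesis unfolding quadrature_error_def M_def by linarith
    qed
    then have "\<forall>x\<in>X. \<bar>a q x\<bar> \<le> M / mesh_size q powr r"
      by (auto simp: a_def abs_divide intro!: divide_right_mono)
    then show "\<exists>M. \<forall>x\<in>X. \<bar>a q x\<bar> \<le> M" by blast
  next
    fix x assume x: "x \<in> X"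
    obtain C where "C > 0" "\<forall>q\<in>\<Q>. \<bar>quadrature_error \<F> q \<theta> K x\<bar> \<le> C * mesh_size q powr r"
      using ord[OF adm1[OF x]] by (auto simp: quadrature_error_def potential_def)
    then have "\<forall>q\<in>\<Q>. \<bar>a q x\<bar> \<le> C" unfolding a_def by (intro ballI div) auto
    then show "\<exists>M. \<forall>q\<in>\<Q>. \<bar>a q x\<bar> \<le> M" by blast
  next
    fix \<xi> :: "nat \<Rightarrow> real^'n" assume \<xi>: "\<And>m. \<xi> m \<in> X"
    let ?f = "\<lambda>x'. \<theta> x' * (\<Sum>m. (1/8)^m * K (\<xi> m - x'))"
    obtain C where C: "C > 0" "\<forall>q\<in>\<Q>. \<bar>surface_integral \<F> ?f - quadrature_sum q ?f\<bar> \<le> C * mesh_size q powr r"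
      using ord[OF adm[of \<xi>, OF \<xi>]] by blast
    have "\<bar>\<Sum>m. (1/8)^m * a q (\<xi> m)\<bar> \<le> C" if qQ: "q \<in> \<Q>" for q
    proof -
      have "(\<lambda>m. (1/8)^m * quadrature_error \<F> q \<theta> K (\<xi> m)) sums (surface_integral \<F> ?f - quadrature_sum q ?f)"
        by (rule quadrature_error_series[OF Kc q[OF qQ] X\<Gamma>[OF \<xi>] BX[OF \<xi>]])
      from sums_divide[OF this, of "mesh_size q powr r"]
      have "(\<lambda>m. (1/8)^m * a q (\<xi> m)) sums ((surface_integral \<F> ?f - quadrature_sum q ?f) / mesh_size q powr r)"
        by (simp add: a_def)
      from sums_unique[OF this] show ?thesis using C qQ div[of "surface_integral \<F> ?f - quadrature_sum q ?f" C "mesh_size q powr r"] by simp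
    qed
    then show "\<exists>M. \<forall>q\<in>\<Q>. \<bar>\<Sum>m. (1/8)^m * a q (\<xi> m)\<bar> \<le> M" by blast
  qed
  then obtain M where M: "\<And>q x. q \<in> \<Q> \<Longrightarrow> x \<in> X \<Longrightarrow> \<bar>a q x\<bar> \<le> M" by blast
  show ?thesis
  proof (intro exI[of _ M] ballI)
    fix q x assume qx: "q \<in> \<Q>" "x \<in> X"
    show "\<bar>quadrature_error \<F> q \<theta> K x\<bar> \<le> M * mesh_size q powr r"
    \<comment> \<open>In the zero case the quotient \<open>a\<close> carries no information, but the
      hypothesis at the single point x already gives a zero error.\<close>
    proof (cases "mesh_size q powr r = 0")
      case True
      obtain C where "\<forall>q\<in>\<Q>. \<bar>quadrature_error \<F> q \<theta> K x\<bar> \<le> C * mesh_size q powr r"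
        using ord[OF adm1[OF qx(2)]] by (auto simp: quadrature_error_def potential_def)
      then show ?thesis using True qx(1) by fastforce
    next
      case False
      then have "mesh_size q powr r > 0" by simp
      then show ?thesis using M[OF qx] by (simp add: a_def abs_divide field_simps)
    qed
  qed
qed

end

end

subsection \<open>The normal is constant on each face\<close>

text \<open>On a face the normal is one of two opposite vectors. It cannot flip locally: a small
  half ball on one side of the face is connected and misses the surface, so it cannot meet both the
  inside and the outside. Connectedness of the relative interior then makes it constant.\<close>

lemma inward_normal_constant:
  fixes \<F> :: "(real^'n) set set"
  assumes \<F>: "closed_polyhedral_surface \<F>" and n: "inward_unit_normal \<F> n" and F: "F \<in> \<F>"
  obtains e where "\<And>x. x \<in> rel_interior F \<Longrightarrow> n x = e"
proof -
  let ?\<Gamma> = "\<Union>\<F>"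
  have face: "polyhedral_face F'" if "F' \<in> \<F>" for F' using \<F> that by (auto simp: closed_polyhedral_surface_def)
  have fin: "finite \<F>" using \<F> by (auto simp: closed_polyhedral_surface_def)
  obtain a b where ab: "norm a = 1" "affine hull F = {x. a \<bullet> x = b}"
    using polyhedral_face_hyperplane[OF face[OF F]] by metis
  have n1: "norm (n x) = 1" and n2: "\<And>y. y \<in> F \<Longrightarrow> n x \<bullet> (y - x) = 0"
    and n3: "\<exists>\<epsilon>>0. \<forall>t\<in>{0<..<\<epsilon>}. x + t *\<^sub>R n x \<in> inside ?\<Gamma> \<and> x - t *\<^sub>R n x \<in> outside ?\<Gamma>"
    if "x \<in> rel_interior F" for x
    using n F that by (auto simp: inward_unit_normal_def)
  have pm: "n x = a \<or> n x = - a" and aff: "\<And>y. y \<in> affine hull F \<Longrightarrow> n x \<bullet> y = n x \<bullet> x"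
    if x: "x \<in> rel_interior F" for x
  proof -
    have "affine hull F \<subseteq> {y. n x \<bullet> y = n x \<bullet> x}"
    proof (rule hull_minimal)
      show "F \<subseteq> {y. n x \<bullet> y = n x \<bullet> x}" using n2[OF x] by (auto simp: inner_diff_right)
    qed (rule affine_hyperplane)
    then show aff: "n x \<bullet> y = n x \<bullet> x" if "y \<in> affine hull F" for y using that by blast
    have "a \<bullet> x = b" using x rel_interior_subset hull_subset[of F affine] ab(2) by blast
    have "n x \<bullet> z = 0" if "a \<bullet> z = 0" for z
    proof -
      have "x + z \<in> affine hull F" using ab(2) \<open>a \<bullet> x = b\<close> that by (simp add: inner_add_right)
      from aff[OF this] show ?thesis by (simp add: inner_add_right)
    qed
    moreover have "a \<noteq> 0" using ab(1) by auto
    ultimately have "n x = ((a \<bullet> n x) / (a \<bullet> a)) *\<^sub>R a" by (intro orthogonal_to_hyperplane)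
    then have eq: "n x = (a \<bullet> n x) *\<^sub>R a" using ab(1) by (simp add: norm_eq_1)
    then have "norm (n x) = \<bar>a \<bullet> n x\<bar> * norm a" by (metis norm_scaleR)
    then have "\<bar>a \<bullet> n x\<bar> = 1" using n1[OF x] ab(1) by simp
    then show "n x = a \<or> n x = - a" using eq by (metis abs_eq_iff' abs_one scaleR_minus1_left scaleR_one)
  qed
  have loc: "\<exists>\<rho>>0. \<forall>y\<in>ball x \<rho> \<inter> rel_interior F. n y = n x" if x: "x \<in> rel_interior F" for x
  proof -
    \<comment> \<open>The other faces form a closed set that misses x, so a small ball around x
      meets no face but F.\<close>
    define C where "C = \<Union>(\<F> - {F})"
    have "closed C" unfolding C_def
      using fin face polyhedral_face_compact compact_imp_closed by (intro closed_Union) auto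
    moreover have "x \<notin> C"
      using \<F> F x unfolding C_def closed_polyhedral_surface_def by blast
    ultimately obtain \<rho> where \<rho>: "\<rho> > 0" "ball x \<rho> \<subseteq> - C"
      using open_contains_ball[of "- C"] by auto
    \<comment> \<open>The open half ball on the side of \<open>n x\<close>; it misses F because F
      lies in the bounding hyperplane.\<close>
    define B where "B = ball x \<rho> \<inter> {y. n x \<bullet> y > n x \<bullet> x}"
    have "convex B" unfolding B_def by (intro convex_Int convex_ball convex_halfspace_gt)
    have "B \<subseteq> - ?\<Gamma>"
    proof
      fix y assume y: "y \<in> B"
      have "y \<notin> F" using y aff[OF x, of y] hull_subset[of F affine] by (auto simp: B_def)
      moreover have "y \<notin> C" using y \<rho>(2) by (auto simp: B_def)
      ultimately show "y \<in> - ?\<Gamma>" by (auto simp: C_def)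
    qed
    have inB: "y + t *\<^sub>R n x \<in> B" if "y \<in> affine hull F" "0 < t" "t < \<rho> - dist x y" for y t
    proof -
      have "dist x (y + t *\<^sub>R n x) \<le> dist x y + norm (t *\<^sub>R n x)"
        using dist_triangle[of x "y + t *\<^sub>R n x" y] by (simp add: dist_norm)
      also have "\<dots> < \<rho>" using that n1[OF x] by simp
      finally show ?thesis
        using that aff[OF x that(1)] n1[OF x] by (simp add: B_def inner_add_right norm_eq_1)
    qed
    have "n y = n x" if y: "y \<in> ball x \<rho>" "y \<in> rel_interior F" for y
    proof (rule ccontr)
      assume "n y \<noteq> n x"
      then have ny: "n y = - n x" using pm[OF x] pm[OF y(2)] by auto
      have xa: "x \<in> affine hull F" and ya: "y \<in> affine hull F"
        using x y rel_interior_subset hull_subset[of F affine] by blast+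
      obtain \<epsilon> where \<epsilon>: "\<epsilon> > 0" "\<And>t. t \<in> {0<..<\<epsilon>} \<Longrightarrow> x + t *\<^sub>R n x \<in> inside ?\<Gamma>" using n3[OF x] by auto
      obtain \<epsilon>' where \<epsilon>': "\<epsilon>' > 0" "\<And>t. t \<in> {0<..<\<epsilon>'} \<Longrightarrow> y + t *\<^sub>R n x \<in> outside ?\<Gamma>"
        using n3[OF y(2)] ny by auto
      \<comment> \<open>Small enough to lie both in the half ball and in the range where inside and
        outside are prescribed.\<close>
      define t t' where "t = min \<epsilon> \<rho> / 2" and "t' = min \<epsilon>' (\<rho> - dist x y) / 2"
      have p: "x + t *\<^sub>R n x \<in> inside ?\<Gamma>" "x + t *\<^sub>R n x \<in> B"
        using \<epsilon> \<rho>(1) by (auto simp: t_def intro!: inB xa)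
      have p': "y + t' *\<^sub>R n x \<in> outside ?\<Gamma>" "y + t' *\<^sub>R n x \<in> B"
        using \<epsilon>' y(1) by (auto simp: t'_def intro!: inB ya)
      have "connected_component (- ?\<Gamma>) (x + t *\<^sub>R n x) (y + t' *\<^sub>R n x)"
        unfolding connected_component_def
        using \<open>convex B\<close> \<open>B \<subseteq> - ?\<Gamma>\<close> p p' convex_connected by blast
      from inside_same_component[OF this p(1)] show False
        using p'(1) inside_Int_outside[of ?\<Gamma>] by blast
    qed
    then show ?thesis using \<rho>(1) by blast
  qed
  have conn: "connected (rel_interior F)" using face[OF F] by (simp add: polyhedral_face_def)
  have const: "n x = n y" if "x \<in> rel_interior F" "y \<in> rel_interior F" for x y
  proof (rule connected_local_const[OF conn that])
    show "\<forall>a\<in>rel_interior F. \<forall>\<^sub>F b in at a within rel_interior F. n a = n b"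
    proof
      fix a assume "a \<in> rel_interior F"
      from loc[OF this] obtain \<rho> where \<rho>: "\<rho> > 0" "\<And>y. y \<in> ball a \<rho> \<inter> rel_interior F \<Longrightarrow> n y = n a" by blast
      then show "\<forall>\<^sub>F b in at a within rel_interior F. n a = n b"
        unfolding eventually_at by (intro exI[of _ \<rho>]) (auto simp: dist_commute)
    qed
  qed
  show ?thesis
  proof (cases "rel_interior F = {}")
    case True then show ?thesis using that by auto
  next
    case False
    then obtain p where "p \<in> rel_interior F" by blast
    then show ?thesis using that[of "n p"] const by blast
  qed
qed

text \<open>Since the normal is constant on each face, multiplying the smooth extension of Q by that
  constant extends the product past the face.\<close>

lemma piecewise_Ck_mult_normal:
  assumes "closed_polyhedral_surface \<F>" "inward_unit_normal \<F> n" "piecewise_Ck k \<F> Q"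
  shows "piecewise_Ck k \<F> (\<lambda>x. Q x * n x $ j)"
  unfolding piecewise_Ck_def
proof
  fix F assume F: "F \<in> \<F>"
  then obtain U g where g: "open U" "F \<subseteq> U" "Ck_on k U g" "\<And>x. x \<in> rel_interior F \<Longrightarrow> Q x = g x"
    using assms(3) by (auto simp: piecewise_Ck_def)
  obtain e where e: "\<And>x. x \<in> rel_interior F \<Longrightarrow> n x = e" using inward_normal_constant[OF assms(1,2) F] by metis
  have "Ck_on k U (\<lambda>x. g x * e $ j)" by (intro Ck_on_mult Ck_on_const g)
  then show "\<exists>U g. open U \<and> F \<subseteq> U \<and> Ck_on k U g \<and> (\<forall>x\<in>rel_interior F. Q x * n x $ j = g x)"
    using g e by (intro exI[of _ U] exI[of _ "\<lambda>x. g x * e $ j"]) auto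
qed

subsection \<open>Uniform bounds for the field error\<close>

lemma field_solution_nth:
  fixes \<F> :: "(real^'n) set set"
  assumes \<F>: "closed_polyhedral_surface \<F>" and \<theta>: "\<And>j. piecewise_Ck k \<F> (\<lambda>x'. Q x' * n x' $ j)"
    and x: "x \<notin> \<Union>\<F>"
  shows "field_solution E \<nu> \<F> Q n x $ i =
    (\<Sum>j\<in>UNIV. potential \<F> (\<lambda>x'. Q x' * n x' $ j) (\<lambda>z. green E \<nu> z 0 $ i $ j) x)"
proof -
  define f where "f x' = Q x' *\<^sub>R (green E \<nu> x x' *v n x')" for x'
  define G where "G i j z = green E \<nu> z 0 $ i $ j" for i j and z :: "real^'n"
  have fi: "f x' $ i = (\<Sum>j\<in>UNIV. G i j (x - x') *\<^sub>R (Q x' * n x' $ j))" for x' i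
    unfolding f_def G_def green_translate[of E \<nu> x]
    by (simp add: matrix_vector_mult_def sum_distrib_left mult_ac)
  have face: "polyhedral_face F" if "F \<in> \<F>" for F using surface_face[OF \<F> that] .
  have int: "integrable (lebesgue_on (unit_prism F)) (\<lambda>y. G i j (x - foot F y) *\<^sub>R (Q (foot F y) * n (foot F y) $ j))"
    if "F \<in> \<F>" for F i j
    unfolding G_def
    by (rule integrable_potential[OF \<F> \<theta> Ck_on_imp_continuous_on[OF Ck_on_green] x that])
  have "face_integral F f $ i = (\<Sum>j\<in>UNIV. \<integral>y. G i j (x - foot F y) *\<^sub>R (Q (foot F y) * n (foot F y) $ j) \<partial>lebesgue_on (unit_prism F))"
    if F: "F \<in> \<F>" for F
  proof -
    let ?M = "lebesgue_on (unit_prism F)"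
    \<comment> \<open>Taking a component of the vector-valued integral is justified by integrability
      of the field, which is assembled from its scalar components.\<close>
    have comp: "integrable ?M (\<lambda>y. f (foot F y) $ i)" for i
      unfolding fi by (intro Bochner_Integration.integrable_sum int F)
    have "f (foot F y) = (\<Sum>i\<in>UNIV. f (foot F y) $ i *\<^sub>R axis i 1)" for y
      by (simp add: vec_eq_iff axis_def if_distrib cong: if_cong)
    moreover have "integrable ?M (\<lambda>y. \<Sum>i\<in>UNIV. f (foot F y) $ i *\<^sub>R axis i (1::real))"
      by (intro Bochner_Integration.integrable_sum integrable_scaleR_left comp)
    ultimately have "integrable ?M (\<lambda>y. f (foot F y))" by simp
    from integral_bounded_linear[OF bounded_linear_vec_nth this, of i]
    have "face_integral F f $ i = (\<integral>y. f (foot F y) $ i \<partial>?M)"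
      by (simp add: face_integral_eq[OF face[OF F]])
    then show ?thesis
      unfolding fi using int[OF F] by (simp add: Bochner_Integration.integral_sum)
  qed
  then have "(\<Sum>F\<in>\<F>. face_integral F f $ i) = (\<Sum>j\<in>UNIV. potential \<F> (\<lambda>x'. Q x' * n x' $ j) (G i j) x)"
    by (subst sum.swap[of _ \<F>] | simp add: potential_eq[OF \<F>])+
  then show ?thesis
    unfolding field_solution_def surface_integral_def f_def[symmetric] G_def[symmetric] by simp
qed

lemma discrete_field_solution_nth:
  "discrete_field_solution E \<nu> q Q n x $ i =
    (\<Sum>j\<in>UNIV. quadrature_sum q (\<lambda>x'. (Q x' * n x' $ j) * green E \<nu> (x - x') 0 $ i $ j))"
proof -
  have "discrete_field_solution E \<nu> q Q n x $ i =
     (\<Sum>m=1..num_elems q. \<Sum>j\<in>UNIV. weight q m * (Q (node q m) * n (node q m) $ j * green E \<nu> (x - node q m) 0 $ i $ j))"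
    unfolding discrete_field_solution_def green_translate[of E \<nu> x]
    by (simp add: quadrature_sum_def matrix_vector_mult_def sum_distrib_left mult_ac)
  then show ?thesis by (subst (asm) sum.swap) (simp add: quadrature_sum_def)
qed

lemma uniform_bound_finite:
  fixes f :: "'i::finite \<Rightarrow> 'q \<Rightarrow> 'x \<Rightarrow> real"
  assumes "\<And>i. \<exists>C. \<forall>q\<in>Q. \<forall>x\<in>X. \<bar>f i q x\<bar> \<le> C * h q" "\<And>q. h q \<ge> 0"
  shows "\<exists>C\<ge>0. \<forall>i. \<forall>q\<in>Q. \<forall>x\<in>X. \<bar>f i q x\<bar> \<le> C * h q"
proof -
  obtain C where C: "\<And>i q x. q \<in> Q \<Longrightarrow> x \<in> X \<Longrightarrow> \<bar>f i q x\<bar> \<le> C i * h q" using assms(1) by metis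
  show ?thesis
  proof (intro exI[of _ "\<Sum>i\<in>UNIV. \<bar>C i\<bar>"] conjI allI ballI)
    fix i q x assume "q \<in> Q" "x \<in> X"
    then have "\<bar>f i q x\<bar> \<le> C i * h q" by (rule C)
    also have "C i \<le> (\<Sum>i\<in>UNIV. \<bar>C i\<bar>)"
      using member_le_sum[of i UNIV "\<lambda>i. \<bar>C i\<bar>"] by simp
    then have "C i * h q \<le> (\<Sum>i\<in>UNIV. \<bar>C i\<bar>) * h q" using assms(2) by (intro mult_right_mono)
    finally show "\<bar>f i q x\<bar> \<le> (\<Sum>i\<in>UNIV. \<bar>C i\<bar>) * h q" .
  qed (simp add: sum_nonneg)
qed

lemma Ck_on_Un:
  assumes "open S" "open T" "Ck_on k S f" "Ck_on k T f"
  shows "Ck_on k (S \<union> T) f"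
  using assms(3,4) by (induction k arbitrary: f) (auto intro: continuous_on_open_Un assms)

lemma Ck_on_vec_lambda:
  fixes f :: "'i::finite \<Rightarrow> 'a::euclidean_space \<Rightarrow> real"
  assumes "open S" "\<And>i. Ck_on k S (f i)"
  shows "Ck_on k S (\<lambda>x. \<chi> i. f i x)"
proof -
  have "Ck_on k S (\<lambda>x. \<Sum>i\<in>UNIV. f i x *\<^sub>R axis i (1::real))"
    by (intro Ck_on_sum Ck_on_scaleR Ck_on_const assms) auto
  moreover have "(\<Sum>i\<in>UNIV. f i x *\<^sub>R axis i 1) = (\<chi> i. f i x)" for x
    by (simp add: vec_eq_iff axis_def if_distrib cong: if_cong)
  ultimately show ?thesis by simp
qed

lemma has_derivative_vec_lambda:
  fixes f :: "'i::finite \<Rightarrow> 'a::euclidean_space \<Rightarrow> real"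
  assumes "\<And>i. (f i has_derivative f' i) (at x)"
  shows "((\<lambda>x. \<chi> i. f i x) has_derivative (\<lambda>h. \<chi> i. f' i h)) (at x)"
proof -
  have "((\<lambda>x. \<Sum>i\<in>UNIV. f i x *\<^sub>R axis i (1::real)) has_derivative (\<lambda>h. \<Sum>i\<in>UNIV. f' i h *\<^sub>R axis i 1)) (at x)"
    by (intro has_derivative_sum has_derivative_scaleR_left assms)
  moreover have "(\<Sum>i\<in>UNIV. g i *\<^sub>R axis i 1) = (\<chi> i. g i)" for g :: "'i \<Rightarrow> real"
    by (simp add: vec_eq_iff axis_def if_distrib cong: if_cong)
  ultimately show ?thesis by simp
qed

text \<open>One minus the mollified indicator of the d/2-neighbourhood: \<open>mollify\<close>
  integrates over \<open>S\<close>, so applying it to the constant 1 mollifies that indicator. The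
  radius d/4 leaves the values 0 below d/4 and 1 from 3 d/4 on.\<close>

lemma smooth_cutoff:
  fixes \<Gamma> :: "(real^'n) set"
  assumes \<Gamma>: "compact \<Gamma>" "\<Gamma> \<noteq> {}" and d: "d > 0"
  obtains \<zeta> :: "real^'n \<Rightarrow> real" where "\<And>k. Ck_on k UNIV \<zeta>"
    "\<And>x. infdist x \<Gamma> < d / 4 \<Longrightarrow> \<zeta> x = 0" "\<And>x. infdist x \<Gamma> \<ge> 3 * d / 4 \<Longrightarrow> \<zeta> x = 1"
proof -
  define S where "S = {x. infdist x \<Gamma> < d / 2}"
  have S: "open S" unfolding S_def by (intro open_Collect_less continuous_intros)
  have S': "bounded S"
  proof -
    obtain R where R: "\<And>y. y \<in> \<Gamma> \<Longrightarrow> norm y \<le> R" using compact_imp_bounded[OF \<Gamma>(1)] by (auto simp: bounded_iff)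
    have "norm x \<le> R + d" if "x \<in> S" for x
    proof -
      obtain y where y: "y \<in> \<Gamma>" "infdist x \<Gamma> = dist x y"
        using infdist_attains_inf[OF compact_imp_closed[OF \<Gamma>(1)] \<Gamma>(2)] by metis
      have "norm x \<le> norm y + dist x y" using norm_triangle_ineq2[of x y] by (simp add: dist_norm)
      then show ?thesis using R[OF y(1)] y(2) that d by (simp add: S_def)
    qed
    then show ?thesis by (auto simp: bounded_iff)
  qed
  have tri: "infdist y \<Gamma> \<le> infdist x \<Gamma> + dist x y" for x y
    using infdist_triangle[of y \<Gamma> x] by (simp add: dist_commute)
  have i1: "integrable (lebesgue_on S) (\<lambda>y. 1::real)"
    using finite_measure.integrable_const[OF finite_measure_lebesgue_on[OF open_bounded_measurable(2)[OF S S']]] .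
  define m where "m = mollify S (d / 4) (\<lambda>y. 1::real)"
  show ?thesis
  proof (rule that[of "\<lambda>x. 1 + (- 1) * m x"])
    show "Ck_on k UNIV (\<lambda>x. 1 + (- 1) * m x)" for k
      unfolding m_def by (intro Ck_on_add Ck_on_mult Ck_on_const Ck_on_mollify[OF S S' i1]) auto
    fix x
    show "1 + (- 1) * m x = 0" if "infdist x \<Gamma> < d / 4"
    proof -
      have "ball x (d / 4) \<subseteq> S"
      proof
        fix y assume "y \<in> ball x (d / 4)"
        then show "y \<in> S" using tri[of y x] that by (simp add: S_def)
      qed
      then have "m x = 1" unfolding m_def mollify_def
        using mollifier_integral_on(3)[of "d / 4" S x] d open_bounded_measurable(1)[OF S S'] by simp
      then show ?thesis by simp
    qed
    show "1 + (- 1) * m x = 1" if "infdist x \<Gamma> \<ge> 3 * d / 4"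
    proof -
      have False if y: "y \<in> S" "norm (x - y) < d / 4" for y
        using tri[of x y] y \<open>infdist x \<Gamma> \<ge> 3 * d / 4\<close> by (simp add: S_def dist_norm norm_minus_commute)
      then have "norm (m x) \<le> 0" unfolding m_def
        using d by (intro norm_mollify_le[OF S S' i1]) auto
      then show ?thesis by simp
    qed
  qed
qed

lemma norm_matrix_le:
  fixes A :: "real^'n^'m"
  assumes "\<And>i j. \<bar>A $ i $ j\<bar> \<le> c"
  shows "norm A \<le> real CARD('m) * (real CARD('n) * c)"
proof -
  have "norm (A $ i) \<le> real CARD('n) * c" for i
    using norm_le_l1_cart[of "A $ i"] sum_mono[of UNIV "\<lambda>j. \<bar>A $ i $ j\<bar>" "\<lambda>j. c"] assms by simp
  moreover have "norm A \<le> (\<Sum>i\<in>UNIV. norm (A $ i))"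
    unfolding norm_vec_def by (rule L2_set_le_sum) auto
  ultimately show ?thesis
    using sum_mono[of UNIV "\<lambda>i. norm (A $ i)" "\<lambda>i. real CARD('n) * c"] by simp
qed

lemma norm_vec_le:
  fixes v :: "real^'n"
  assumes "\<And>i. \<bar>v $ i\<bar> \<le> c"
  shows "norm v \<le> real CARD('n) * c"
  using norm_le_l1_cart[of v] sum_mono[of UNIV "\<lambda>j. \<bar>v $ j\<bar>" "\<lambda>j. c"] assms by simp

lemma L2_cong:
  assumes "\<And>x. x \<in> \<Omega> \<Longrightarrow> f x = g x"
  shows "f \<in> L2_space \<Omega> \<longleftrightarrow> g \<in> L2_space \<Omega>" "L2_norm \<Omega> f = L2_norm \<Omega> g"
proof -
  have "f \<in> borel_measurable (lebesgue_on \<Omega>) \<longleftrightarrow> g \<in> borel_measurable (lebesgue_on \<Omega>)"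
    using assms by (intro measurable_cong) auto
  moreover have "integrable (lebesgue_on \<Omega>) (\<lambda>x. (norm (f x))\<^sup>2) \<longleftrightarrow> integrable (lebesgue_on \<Omega>) (\<lambda>x. (norm (g x))\<^sup>2)"
    using assms by (intro Bochner_Integration.integrable_cong) auto
  ultimately show "f \<in> L2_space \<Omega> \<longleftrightarrow> g \<in> L2_space \<Omega>" by (simp add: L2_space_def)
  show "L2_norm \<Omega> f = L2_norm \<Omega> g"
    unfolding L2_norm_def using assms by (intro arg_cong[of _ _ sqrt] Bochner_Integration.integral_cong) auto
qed

lemma L2_restrict:
  assumes f: "f \<in> L2_space \<Omega>" and W: "W \<subseteq> \<Omega>" "W \<in> sets lebesgue" "\<Omega> \<in> sets lebesgue"
  shows "f \<in> L2_space W" "L2_norm W f \<le> L2_norm \<Omega> f"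
proof -
  have i: "integrable lebesgue (\<lambda>x. indicator \<Omega> x *\<^sub>R (norm (f x))\<^sup>2)"
    using L2_spaceD(2)[OF f] W(3) by (simp add: integrable_restrict_space)
  have i': "integrable lebesgue (\<lambda>x. indicator W x *\<^sub>R (norm (f x))\<^sup>2)"
    using set_integrable_subset[OF i[folded set_integrable_def] W(2,1)] by (simp add: set_integrable_def)
  have "f \<in> borel_measurable (lebesgue_on W)"
    using L2_spaceD(1)[OF f] W(1) by (rule measurable_restrict_mono)
  then show "f \<in> L2_space W" using i' W(2) by (simp add: L2_space_def integrable_restrict_space)
  have "(\<integral>x. indicator W x *\<^sub>R (norm (f x))\<^sup>2 \<partial>lebesgue) \<le> (\<integral>x. indicator \<Omega> x *\<^sub>R (norm (f x))\<^sup>2 \<partial>lebesgue)"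
    using W(1) by (intro integral_mono i i') (auto simp: indicator_def)
  then show "L2_norm W f \<le> L2_norm \<Omega> f"
    unfolding L2_norm_def using W by (simp add: integral_restrict_space)
qed

theorem theorem2:
  fixes E \<nu> r \<delta> :: real and k :: nat
    and \<Omega> :: "(real^'n) set" and \<F> :: "(real^'n) set set"
    and n :: "real^'n \<Rightarrow> real^'n" and Q :: "real^'n \<Rightarrow> real"
    and \<Q> :: "(real^'n) quadrature set"
    and u :: "real^'n \<Rightarrow> real^'n" and u\<^sub>h :: "(real^'n) quadrature \<Rightarrow> real^'n \<Rightarrow> real^'n"
  assumes "CARD('n) = 2 \<or> CARD('n) = 3"
    and "E > 0" and "-1 < \<nu>" and "\<nu> < 1/2"
    and "\<Omega> \<noteq> {}" and "open \<Omega>" and "bounded \<Omega>" and "simply_connected \<Omega>"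
    and "lipschitz_boundary \<Omega>"
    and "closed_polyhedral_surface \<F>" and "\<Union>\<F> \<subseteq> \<Omega>"
    and "inward_unit_normal \<F> n"
    and "piecewise_Ck k \<F> Q"
    and "\<And>q. q \<in> \<Q> \<Longrightarrow> quadrature_on \<F> q"
    and "r > 0" and "quadrature_order k r \<F> \<Q>"
    and "dirichlet_solution E \<nu> \<Omega> (field_solution E \<nu> \<F> Q n) u"
    and "\<And>q. q \<in> \<Q> \<Longrightarrow>
           dirichlet_solution E \<nu> \<Omega> (discrete_field_solution E \<nu> q Q n) (u\<^sub>h q)"
    and "\<delta> > 0"
  shows "\<exists>C\<^sub>0>0. \<forall>q\<in>\<Q>.
           (\<lambda>x. u\<^sub>h q x - u x) \<in> L2_space {x\<in>\<Omega>. infdist x (\<Union>\<F>) > \<delta>} \<and>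
           L2_norm {x\<in>\<Omega>. infdist x (\<Union>\<F>) > \<delta>} (\<lambda>x. u\<^sub>h q x - u x) \<le> C\<^sub>0 * mesh_size q powr r"
proof -
  let ?\<Gamma> = "\<Union>\<F>"
  note \<Omega> = assms(6,7) and \<F> = assms(10) and q = assms(14)
  note \<Omega>m = open_bounded_measurable[OF \<Omega>]
  define \<theta> where "\<theta> j x' = Q x' * n x' $ j" for j x'
  define G where "G i j z = green E \<nu> z 0 $ i $ j" for i j and z :: "real^'n"
  have \<theta>: "piecewise_Ck k \<F> (\<theta> j)" for j
    unfolding \<theta>_def by (rule piecewise_Ck_mult_normal[OF \<F> assms(12,13)])
  have G: "Ck_on m (- {0}) (G i j)" for m i j unfolding G_def by (rule Ck_on_green)
  have DG: "Ck_on m (- {0}) (\<lambda>z. frechet_derivative (G i j) (at z) (axis l 1))" for m i j l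
    using G[of "Suc m" i j] by (simp add: axis_in_Basis_iff)
  define h where "h q = mesh_size q powr r" for q :: "(real^'n) quadrature"
  have h: "h q \<ge> 0" for q by (simp add: h_def)
  note \<Gamma>c = surface_compact[OF \<F>]
  have o\<Gamma>: "open (- ?\<Gamma>)" by (rule open_compl_surface[OF \<F>])
  have \<Gamma>ne: "?\<Gamma> \<noteq> {}" by (rule surface_nonempty[OF \<F>])
  have c\<Omega>: "- \<Omega> \<noteq> {}" using \<Omega>(2) not_bounded_UNIV by (metis Compl_empty_eq double_complement)
  \<comment> \<open>The surface is compact inside the open set \<Omega>, so this distance is
    positive; it sets the scale of the cut-off.\<close>
  define d where "d = setdist ?\<Gamma> (- \<Omega>)"
  have d: "d > 0" unfolding d_def
    using \<Gamma>c \<Gamma>ne c\<Omega> \<Omega>(1) assms(11) by (subst setdist_gt_0_compact_closed) auto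
  \<comment> \<open>X has to contain both the region at distance more than \<delta> and the part of
    \<Omega> at distance at least d/4, where the cut-off may be nonzero. One set of constants then
    serves the interior and the boundary estimate.\<close>
  define \<delta>' where "\<delta>' = min \<delta> (d / 4)"
  have \<delta>': "\<delta>' > 0" using d assms(19) by (simp add: \<delta>'_def)
  define X where "X = {x\<in>\<Omega>. infdist x ?\<Gamma> \<ge> \<delta>'}"
  have X: "bounded X" "\<And>x. x \<in> X \<Longrightarrow> infdist x ?\<Gamma> \<ge> \<delta>'"
    using bounded_subset[OF \<Omega>(2)] by (auto simp: X_def)
  have X\<Gamma>: "x \<notin> ?\<Gamma>" if "x \<in> X" for x using X(2)[OF that] \<delta>' infdist_zero[of x ?\<Gamma>] by fastforce

  \<comment> \<open>Uniform kernel errors away from the surface\<close>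
  have "\<exists>C\<ge>0. \<forall>p. \<forall>q\<in>\<Q>. \<forall>x\<in>X.
      \<bar>(\<lambda>(i, j) q x. quadrature_error \<F> q (\<theta> j) (G i j) x) p q x\<bar> \<le> C * h q"
    unfolding h_def
    by (rule uniform_bound_finite)
      (auto simp: split_paired_all quadrature_error_uniform[OF \<F> \<theta> G q assms(16) X \<delta>'])
  then obtain C\<^sub>1 where C1: "C\<^sub>1 \<ge> 0"
    "\<And>i j q x. q \<in> \<Q> \<Longrightarrow> x \<in> X \<Longrightarrow> \<bar>quadrature_error \<F> q (\<theta> j) (G i j) x\<bar> \<le> C\<^sub>1 * h q" by fastforce
  \<comment> \<open>The Jacobian of the cut-off error needs derivatives of the field error, that is,
    finitely many further kernels.\<close>
  have "\<exists>C\<ge>0. \<forall>p. \<forall>q\<in>\<Q>. \<forall>x\<in>X.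
      \<bar>(\<lambda>(i, j, l) q x. quadrature_error \<F> q (\<theta> j) (\<lambda>z. frechet_derivative (G i j) (at z) (axis l 1)) x) p q x\<bar> \<le> C * h q"
    unfolding h_def
    by (rule uniform_bound_finite)
      (auto simp: split_paired_all quadrature_error_uniform[OF \<F> \<theta> DG q assms(16) X \<delta>'])
  then obtain C\<^sub>2 where C2: "C\<^sub>2 \<ge> 0"
    "\<And>i j l q x. q \<in> \<Q> \<Longrightarrow> x \<in> X \<Longrightarrow>
       \<bar>quadrature_error \<F> q (\<theta> j) (\<lambda>z. frechet_derivative (G i j) (at z) (axis l 1)) x\<bar> \<le> C\<^sub>2 * h q" by fastforce

  \<comment> \<open>The field error and its derivative\<close>
  define N where "N = real CARD('n)"
  have N: "N \<ge> 0" by (simp add: N_def)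
  \<comment> \<open>The field error is expressed through scalar kernel errors, for which smoothness
    and bounds are available; off the surface it is the exact minus the discrete field
    solution.\<close>
  define e where "e q x = (\<chi> i. \<Sum>j\<in>UNIV. quadrature_error \<F> q (\<theta> j) (G i j) x)" for q x
  have e_eq: "e q x = field_solution E \<nu> \<F> Q n x - discrete_field_solution E \<nu> q Q n x" if "x \<notin> ?\<Gamma>" for q x
    using field_solution_nth[OF \<F> \<theta>[unfolded \<theta>_def[abs_def]] that, of E \<nu>]
    by (simp add: vec_eq_iff e_def quadrature_error_def discrete_field_solution_nth sum_subtractf
        \<theta>_def[abs_def] G_def[abs_def])
  have e_Ck: "Ck_on m (- ?\<Gamma>) (e q)" if "q \<in> \<Q>" for m q
    unfolding e_def[abs_def]
    by (intro Ck_on_vec_lambda Ck_on_sum o\<Gamma> Ck_on_quadrature_error[OF \<F> \<theta> G q[OF that]]) auto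
  have e_nth: "\<bar>e q x $ i\<bar> \<le> N * (C\<^sub>1 * h q)" if "q \<in> \<Q>" "x \<in> X" for q x i
    unfolding e_def N_def
    using order_trans[OF sum_abs sum_mono[of UNIV "\<lambda>j. \<bar>quadrature_error \<F> q (\<theta> j) (G i j) x\<bar>" "\<lambda>j. C\<^sub>1 * h q"]]
      C1(2)[OF that] by simp
  have e_norm: "norm (e q x) \<le> N * (N * (C\<^sub>1 * h q))" if "q \<in> \<Q>" "x \<in> X" for q x
    using norm_vec_le[of "e q x"] e_nth[OF that] by (simp add: N_def)
  have e_deriv: "(e q has_derivative (\<lambda>v. \<chi> i. \<Sum>j\<in>UNIV.
      quadrature_error \<F> q (\<theta> j) (\<lambda>z. frechet_derivative (G i j) (at z) v) x)) (at x)" if "q \<in> \<Q>" "x \<notin> ?\<Gamma>" for q x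
    unfolding e_def[abs_def]
    by (intro has_derivative_vec_lambda has_derivative_sum has_derivative_quadrature_error[OF \<F> \<theta> G q[OF that(1)] that(2)])
  have e_jac: "\<bar>frechet_derivative (e q) (at x) (axis l 1) $ i\<bar> \<le> N * (C\<^sub>2 * h q)" if "q \<in> \<Q>" "x \<in> X" for q x i l
    unfolding frechet_derivative_eqI[OF e_deriv[OF that(1) X\<Gamma>[OF that(2)]]] N_def
    using order_trans[OF sum_abs sum_mono[of UNIV "\<lambda>j. \<bar>quadrature_error \<F> q (\<theta> j)
        (\<lambda>z. frechet_derivative (G i j) (at z) (axis l 1)) x\<bar>" "\<lambda>j. C\<^sub>2 * h q"]]
      C2(2)[OF that] by simp

  \<comment> \<open>The cut-off and the localised field error\<close>
  obtain \<zeta> :: "real^'n \<Rightarrow> real" where \<zeta>: "\<And>k. Ck_on k UNIV \<zeta>" "\<And>x. infdist x ?\<Gamma> < d / 4 \<Longrightarrow> \<zeta> x = 0"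
    "\<And>x. infdist x ?\<Gamma> \<ge> 3 * d / 4 \<Longrightarrow> \<zeta> x = 1"
    by (rule smooth_cutoff[OF \<Gamma>c \<Gamma>ne d]) (rule that)
  have "\<exists>B. \<forall>x\<in>\<Omega>. \<bar>\<zeta> x\<bar> \<le> B" and "\<exists>B. \<forall>x\<in>\<Omega>. \<bar>frechet_derivative \<zeta> (at x) (axis l 1)\<bar> \<le> B" for l
  proof -
    have *: "\<exists>B. \<forall>x\<in>\<Omega>. \<bar>g x\<bar> \<le> B" if "continuous_on UNIV g" for g :: "real^'n \<Rightarrow> real"
    proof -
      have "compact (g ` closure \<Omega>)"
        using \<Omega>(2) that by (intro compact_continuous_image) (auto intro: continuous_on_subset)
      then have "bounded (g ` \<Omega>)"
        using compact_imp_bounded bounded_subset closure_subset image_mono by metis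
      then show ?thesis by (auto simp: bounded_iff)
    qed
    show "\<exists>B. \<forall>x\<in>\<Omega>. \<bar>\<zeta> x\<bar> \<le> B" by (rule *[OF Ck_on_imp_continuous_on[OF \<zeta>(1)]])
    show "\<exists>B. \<forall>x\<in>\<Omega>. \<bar>frechet_derivative \<zeta> (at x) (axis l 1)\<bar> \<le> B" by (rule *[OF Ck_on_1_directional[OF \<zeta>(1)]])
  qed
  then obtain B\<^sub>0 B\<^sub>1 where B01: "\<And>x. x \<in> \<Omega> \<Longrightarrow> \<bar>\<zeta> x\<bar> \<le> B\<^sub>0"
    "\<And>x l. x \<in> \<Omega> \<Longrightarrow> \<bar>frechet_derivative \<zeta> (at x) (axis l 1)\<bar> \<le> B\<^sub>1 l" by metis
  define B where "B = \<bar>B\<^sub>0\<bar> + (\<Sum>l\<in>UNIV. \<bar>B\<^sub>1 l\<bar>)"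
  have s1: "\<bar>B\<^sub>1 l\<bar> \<le> (\<Sum>l\<in>UNIV. \<bar>B\<^sub>1 l\<bar>)" for l by (rule member_le_sum) auto
  have s0: "(\<Sum>l\<in>UNIV. \<bar>B\<^sub>1 l\<bar>) \<ge> 0" by (rule sum_nonneg) auto
  have B: "B \<ge> 0" "\<And>x. x \<in> \<Omega> \<Longrightarrow> \<bar>\<zeta> x\<bar> \<le> B"
    "\<And>x l. x \<in> \<Omega> \<Longrightarrow> \<bar>frechet_derivative \<zeta> (at x) (axis l 1)\<bar> \<le> B"
  proof -
    show "B \<ge> 0" using s0 by (simp add: B_def)
    show "\<bar>\<zeta> x\<bar> \<le> B" if "x \<in> \<Omega>" for x using B01(1)[OF that] s0 unfolding B_def by linarith
    show "\<bar>frechet_derivative \<zeta> (at x) (axis l 1)\<bar> \<le> B" if "x \<in> \<Omega>" for x l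
      using B01(2)[OF that, of l] s1[of l] unfolding B_def by linarith
  qed

  \<comment> \<open>The first summand bounds g itself. The second bounds its Jacobian by the product
    rule; the outer factor N N comes from passing from entries to the matrix norm.\<close>
  define C\<^sub>3 where "C\<^sub>3 = B * (N * (N * C\<^sub>1)) + N * (N * (B * (N * C\<^sub>2) + B * (N * C\<^sub>1)))"
  have C3: "C\<^sub>3 \<ge> 0" unfolding C\<^sub>3_def using B(1) N C1(1) C2(1) by (intro add_nonneg_nonneg mult_nonneg_nonneg)
  define g where "g q x = \<zeta> x *\<^sub>R e q x" for q x
  define V where "V = {x. infdist x ?\<Gamma> < d / 4}"
  have oV: "open V" unfolding V_def by (intro open_Collect_less continuous_intros)
  have gV: "g q x = 0" if "x \<in> V" for q x using \<zeta>(2) that by (simp add: g_def V_def)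
  have \<Gamma>V: "?\<Gamma> \<subseteq> V"
  proof
    fix x assume "x \<in> ?\<Gamma>"
    from infdist_le[OF this, of x] d show "x \<in> V" by (simp add: V_def)
  qed
  \<comment> \<open>The field error is singular on the surface, but g vanishes on the open set
    \<open>V\<close> around it; the two descriptions are glued over an open cover of the whole
    space.\<close>
  have gC: "Ck_on (Suc 0) UNIV (g q)" if "q \<in> \<Q>" for q
  proof -
    have "Ck_on (Suc 0) (- ?\<Gamma>) (g q)"
      unfolding g_def[abs_def] by (intro Ck_on_scaleR o\<Gamma> e_Ck[OF that] Ck_on_subset[OF \<zeta>(1)]) auto
    moreover have "Ck_on (Suc 0) V (g q)"
      by (rule Ck_on_cong[OF oV Ck_on_const[OF oV, of _ 0]]) (simp add: gV)
    ultimately have "Ck_on (Suc 0) (- ?\<Gamma> \<union> V) (g q)" by (rule Ck_on_Un[OF o\<Gamma> oV])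
    moreover have "- ?\<Gamma> \<union> V = UNIV" using \<Gamma>V by blast
    ultimately show ?thesis by simp
  qed
  have VX: "x \<in> X" if "x \<in> \<Omega>" "x \<notin> V" for x using that by (auto simp: X_def V_def \<delta>'_def)
  have g_norm: "norm (g q x) \<le> C\<^sub>3 * h q" if qQ: "q \<in> \<Q>" and x: "x \<in> \<Omega>" for q x
  proof (cases "x \<in> V")
    case True then show ?thesis using gV C3 h by simp
  next
    case False
    have "norm (g q x) \<le> B * (N * (N * (C\<^sub>1 * h q)))"
      unfolding g_def norm_scaleR using B(1) B(2)[OF x] e_norm[OF qQ VX[OF x False]] by (intro mult_mono) auto
    also have "\<dots> = B * (N * (N * C\<^sub>1)) * h q" by simp
    also have "\<dots> \<le> C\<^sub>3 * h q"
      unfolding C\<^sub>3_def using B(1) N C1(1) C2(1) h by (intro mult_right_mono) auto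
    finally show ?thesis .
  qed
  have g_jac: "norm (jac (g q) x) \<le> C\<^sub>3 * h q" if qQ: "q \<in> \<Q>" and x: "x \<in> \<Omega>" for q x
  proof (cases "x \<in> V")
    case True
    have "((\<lambda>x. 0) has_derivative (\<lambda>v. 0)) (at x)" by simp
    then have "(g q has_derivative (\<lambda>v. 0)) (at x)"
      by (rule has_derivative_transform_within_open[OF _ oV True]) (simp add: gV)
    then have "jac (g q) x = 0" by (simp add: frechet_derivative_eqI matrix_def vec_eq_iff)
    then show ?thesis using C3 h by simp
  next
    case False
    note xX = VX[OF x False]
    have "(g q has_derivative (\<lambda>v. \<zeta> x *\<^sub>R frechet_derivative (e q) (at x) v + frechet_derivative \<zeta> (at x) v *\<^sub>R e q x)) (at x)"
      unfolding g_def[abs_def]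
      by (intro has_derivative_scaleR Ck_on_Suc_has_derivative[OF \<zeta>(1)] Ck_on_Suc_has_derivative[OF e_Ck[OF qQ]])
        (use X\<Gamma>[OF xX] in auto)
    note gd = frechet_derivative_eqI[OF this]
    have "\<bar>jac (g q) x $ i $ l\<bar> \<le> B * (N * (C\<^sub>2 * h q)) + B * (N * (C\<^sub>1 * h q))" for i l
    proof -
      have "\<bar>jac (g q) x $ i $ l\<bar> \<le> \<bar>\<zeta> x\<bar> * \<bar>frechet_derivative (e q) (at x) (axis l 1) $ i\<bar>
         + \<bar>frechet_derivative \<zeta> (at x) (axis l 1)\<bar> * \<bar>e q x $ i\<bar>"
        unfolding matrix_def by (simp add: gd abs_mult[symmetric])
      also have "\<dots> \<le> B * (N * (C\<^sub>2 * h q)) + B * (N * (C\<^sub>1 * h q))"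
        using B(1) B(2,3)[OF x] e_jac[OF qQ xX] e_nth[OF qQ xX] by (intro add_mono mult_mono) auto
      finally show ?thesis .
    qed
    from norm_matrix_le[OF this]
    have "norm (jac (g q) x) \<le> N * (N * (B * (N * C\<^sub>2) + B * (N * C\<^sub>1))) * h q"
      by (simp add: N_def algebra_simps)
    also have "\<dots> \<le> C\<^sub>3 * h q"
      unfolding C\<^sub>3_def using B(1) N C1(1) h by (intro mult_right_mono) auto
    finally show ?thesis .
  qed

  \<comment> \<open>The regular parts and the final estimate\<close>
  obtain C\<^sub>4 where C4: "C\<^sub>4 > 0"
    "\<And>g\<^sub>1 g\<^sub>2 v\<^sub>1 v\<^sub>2 g \<eta> U. \<lbrakk>elastic_weak_solution E \<nu> \<Omega> g\<^sub>1 v\<^sub>1; elastic_weak_solution E \<nu> \<Omega> g\<^sub>2 v\<^sub>2;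
       Ck_on (Suc 0) UNIV g; open U; frontier \<Omega> \<subseteq> U; \<forall>x\<in>U \<inter> \<Omega>. g x = g\<^sub>2 x - g\<^sub>1 x;
       \<eta> \<ge> 0; \<forall>x\<in>\<Omega>. norm (g x) \<le> \<eta>; \<forall>x\<in>\<Omega>. norm (jac g x) \<le> \<eta>\<rbrakk> \<Longrightarrow>
     (\<lambda>x. v\<^sub>2 x - v\<^sub>1 x) \<in> L2_space \<Omega> \<and> L2_norm \<Omega> (\<lambda>x. v\<^sub>2 x - v\<^sub>1 x) \<le> C\<^sub>4 * \<eta>"
    using elastic_stability[OF \<Omega> assms(1-4)] by blast
  \<comment> \<open>On U the cut-off equals 1, and boundary points of \<Omega> have distance at
    least d from the surface. So g equals the full difference of the boundary data near the
    boundary.\<close>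
  define U where "U = {x. infdist x ?\<Gamma> > 3 * d / 4}"
  have oU: "open U" unfolding U_def by (intro open_Collect_less continuous_intros)
  have fU: "frontier \<Omega> \<subseteq> U"
  proof
    fix x assume "x \<in> frontier \<Omega>"
    then have x: "x \<in> - \<Omega>" using \<Omega>(1) by (simp add: frontier_def interior_open)
    obtain y where y: "y \<in> ?\<Gamma>" "infdist x ?\<Gamma> = dist x y"
      using infdist_attains_inf[OF compact_imp_closed[OF \<Gamma>c] \<Gamma>ne] by metis
    have "d \<le> dist y x" unfolding d_def by (rule setdist_le_dist[OF y(1) x])
    then show "x \<in> U" using y(2) d by (simp add: U_def dist_commute)
  qed
  obtain v where v: "elastic_weak_solution E \<nu> \<Omega> (\<lambda>x. - field_solution E \<nu> \<F> Q n x) v"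
    "\<And>x. x \<in> \<Omega> \<Longrightarrow> u x = field_solution E \<nu> \<F> Q n x + v x"
    using assms(17) by (auto simp: dirichlet_solution_def)
  define W where "W = {x\<in>\<Omega>. infdist x ?\<Gamma> > \<delta>}"
  have "open {x. infdist x ?\<Gamma> > \<delta>}" by (intro open_Collect_less continuous_intros)
  moreover have "W = \<Omega> \<inter> {x. infdist x ?\<Gamma> > \<delta>}" by (auto simp: W_def)
  ultimately have "open W" using \<Omega>(1) by auto
  moreover have "W \<subseteq> \<Omega>" by (auto simp: W_def)
  ultimately have W: "open W" "bounded W" "W \<subseteq> \<Omega>" using bounded_subset[OF \<Omega>(2)] by auto
  note Wm = open_bounded_measurable[OF W(1,2)]
  have WX: "x \<in> X" if "x \<in> W" for x using that by (auto simp: W_def X_def \<delta>'_def)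
  \<comment> \<open>The summands stem from the regular parts and from the field error; the 1 ensures
    positivity.\<close>
  define C\<^sub>0 where "C\<^sub>0 = C\<^sub>4 * C\<^sub>3 + N * (N * C\<^sub>1) * sqrt (measure lebesgue W) + 1"
  have "C\<^sub>0 > 0" unfolding C\<^sub>0_def
    using C4(1) C3 N C1(1) by (intro add_nonneg_pos add_nonneg_nonneg mult_nonneg_nonneg) auto
  moreover have "(\<lambda>x. u\<^sub>h q x - u x) \<in> L2_space W \<and> L2_norm W (\<lambda>x. u\<^sub>h q x - u x) \<le> C\<^sub>0 * h q"
    if qQ: "q \<in> \<Q>" for q
  proof -
    obtain v\<^sub>h where vh: "elastic_weak_solution E \<nu> \<Omega> (\<lambda>x. - discrete_field_solution E \<nu> q Q n x) v\<^sub>h"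
      "\<And>x. x \<in> \<Omega> \<Longrightarrow> u\<^sub>h q x = discrete_field_solution E \<nu> q Q n x + v\<^sub>h x"
      using assms(18)[OF qQ] by (auto simp: dirichlet_solution_def)
    have "(\<lambda>x. v\<^sub>h x - v x) \<in> L2_space \<Omega> \<and> L2_norm \<Omega> (\<lambda>x. v\<^sub>h x - v x) \<le> C\<^sub>4 * (C\<^sub>3 * h q)"
    proof (rule C4(2)[OF v(1) vh(1) gC[OF qQ] oU fU], rule ballI)
      fix x assume x: "x \<in> U \<inter> \<Omega>"
      then have "\<zeta> x = 1" using \<zeta>(3) by (auto simp: U_def)
      moreover have "x \<notin> V" using x d by (auto simp: U_def V_def)
      ultimately show "g q x = - discrete_field_solution E \<nu> q Q n x - - field_solution E \<nu> \<F> Q n x"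
        using e_eq[of x q] \<Gamma>V by (auto simp: g_def)
    qed (use C3 h g_norm[OF qQ] g_jac[OF qQ] in auto)
    then have 1: "(\<lambda>x. v\<^sub>h x - v x) \<in> L2_space W" "L2_norm W (\<lambda>x. v\<^sub>h x - v x) \<le> C\<^sub>4 * (C\<^sub>3 * h q)"
      using L2_restrict[OF _ W(3) Wm(1) \<Omega>m(1), of "\<lambda>x. v\<^sub>h x - v x"] by auto
    have "continuous_on W (e q)"
      using Ck_on_imp_continuous_on[OF e_Ck[OF qQ, of 0]] by (rule continuous_on_subset) (use WX X\<Gamma> in auto)
    then have "e q \<in> borel_measurable (lebesgue_on W)"
      using Wm(1) by (rule continuous_imp_measurable_on_sets_lebesgue)
    then have 2: "e q \<in> L2_space W" "L2_norm W (e q) \<le> N * (N * (C\<^sub>1 * h q)) * sqrt (measure lebesgue W)"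
      using L2_bounded[OF _ Wm(2), of "e q" "N * (N * (C\<^sub>1 * h q))"] e_norm[OF qQ WX] N C1(1) h by auto
    \<comment> \<open>The field error e is the exact minus the discrete field, hence it is
      subtracted.\<close>
    have eq: "u\<^sub>h q x - u x = (v\<^sub>h x - v x) - e q x" if "x \<in> W" for x
      using v(2)[of x] vh(2)[of x] e_eq[OF X\<Gamma>[OF WX[OF that]], of q] that W(3) by auto
    have cong: "(\<lambda>x. u\<^sub>h q x - u x) \<in> L2_space W \<longleftrightarrow> (\<lambda>x. (v\<^sub>h x - v x) - e q x) \<in> L2_space W"
      "L2_norm W (\<lambda>x. u\<^sub>h q x - u x) = L2_norm W (\<lambda>x. (v\<^sub>h x - v x) - e q x)"
      by (rule L2_cong, erule eq)+
    have "L2_norm W (\<lambda>x. u\<^sub>h q x - u x) \<le> C\<^sub>4 * (C\<^sub>3 * h q) + N * (N * (C\<^sub>1 * h q)) * sqrt (measure lebesgue W)"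
      unfolding cong(2) using L2_diff(2)[OF 1(1) 2(1)] 1(2) 2(2) by linarith
    also have "\<dots> \<le> C\<^sub>0 * h q" using h[of q] by (simp add: C\<^sub>0_def algebra_simps)
    finally show ?thesis using cong(1) L2_diff(1)[OF 1(1) 2(1)] by simp
  qed
  ultimately show ?thesis unfolding W_def h_def by blast
qed

end
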